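(* Let $\mathbf X$ be a Euclidean space, let $f:\mathbf X\to[-\infty,+\infty]$ be prox-regular and subdifferentially continuous at $\bar x$ for $\bar v=0$, and let $\kappa$ and $\ell$ be two positive constants. Consider the following properties: (a) The point $\bar x$ is a tilt-stable local minimizer of $f$ with constant $\kappa$. (b) $q(w)\ge\ell\|w\|^2$ for all $w\in\mathbf X$ and all $q\in\mathrm{quad}\,f(\bar x,\bar v)$. The implication (a)$\implies$(b) holds for $\ell=1/\kappa$. The opposite implication (b)$\implies$(a) holds for any $\ell>1/\kappa$.
   Context: Euclidean spaces are finite-dimensional; $\mathbb B_r(z)$ is the closed ball of radius $r$ centered at $z$. $\partial f$ is the limiting (Mordukhovich) subdifferential and $\mathrm{gph}\,\partial f=\{(x,v): v\in\partial f(x)\}$. Prox-regularity: $f$ is prox-regular at $\bar x$ for $\bar v$ if $f$ is finite at $\bar x$ and locally lower semicontinuous around $\bar x$ with $\bar v\in\partial f(\bar x)$, and there exist $\varepsilon>0$, $r\ge0$ such that $f(x')\ge f(x)+\langle v,x'-x\rangle-\frac r2\|x'-x\|^2$ for all $x'\in\mathbb B_\varepsilon(\bar x)$ whenever $(x,v)\in(\mathrm{gph}\,\partial f)\cap\mathbb B_\varepsilon(\bar x,\bar v)$ with $f(x)<f(\bar x)+\varepsilon$. Subdifferential continuity: $f$ is subdifferentially continuous at $\bar x$ for $\bar v$ if $(x^k,v^k)\to(\bar x,\bar v)$ with $v^k\in\partial f(x^k)$ implies $f(x^k)\to f(\bar x)$. Second subderivative: $\mathrm d^2f(x,v)(w)=\liminf_{t\searrow0,\,u\to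 w}\dfrac{f(x+tu)-f(x)-t\langle v,u\rangle}{\frac12t^2}$. GQF: a proper function $\varphi:\mathbf X\to[-\infty,+\infty]$ is a generalized quadratic form (GQF) if $\mathrm{dom}\,\varphi$ is a linear subspace and there is a linear operator $L:\mathrm{dom}\,\varphi\to\mathbf X$ with $\langle Lx,y\rangle=\langle x,Ly\rangle$ for all $x,y\in\mathrm{dom}\,\varphi$ such that $\varphi(x)=\langle Lx,x\rangle$ for all $x\in\mathrm{dom}\,\varphi$. Quadratic bundle: $\mathrm{quad}\,f(\bar x,\bar v)$ is the set of all GQFs $q$ on $\mathbf X$ for which there is a sequence $(x^k,v^k)\in\mathrm{gph}\,\partial f$ with $(x^k,v^k)\to(\bar x,\bar v)$, with $\mathrm d^2f(x^k,v^k)$ a GQF for each $k$, and such that $\mathrm d^2f(x^k,v^k)$ epi-converges to $q$ (the epigraphs converge in the Painlevé–Kuratowski sense). Tilt stability: $\bar x$ is a tilt-stable local minimizer of $f$ with constant $\kappa>0$ if $f(\bar x)$ is finite and there is $\gamma>0$ such that the mapping $M_\gamma: v\mapsto\operatorname{argmin}\{f(x)-\langle v,x\rangle : x\in\mathbb B_\gamma(\bar x)\}$ is single-valued and Lipschitz continuous with constant $\kappa$ on a neighborhood of $0$, with $M_\gamma(0)=\{\bar x\}$. *)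

theory Defs
  imports "HOL-Analysis.Analysis"
begin

text \<open>
  Functions with values in the extended reals \<open>[-\<infinity>, +\<infinity>]\<close> have type \<open>'a \<Rightarrow> ereal\<close>.  In every difference
  below the subtracted value is finite wherever it matters (graph points of the subdifferential), so the
  convention for \<open>\<infinity> - \<infinity>\<close> plays no role.
\<close>

subsection \<open>Subdifferentials\<close>

definition regular_subdiff :: "('a::euclidean_space \<Rightarrow> ereal) \<Rightarrow> 'a \<Rightarrow> 'a set" where
  "regular_subdiff f x =
     {v. \<bar>f x\<bar> \<noteq> \<infinity> \<and>
         0 \<le> Liminf (at x) (\<lambda>y. (f y - f x - ereal (v \<bullet> (y - x))) / ereal (norm (y - x)))}"

text \<open>
  The limiting (Mordukhovich) subdifferential: limits of regular subgradients along sequences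
  converging to \<open>x\<close> in the \<open>f\<close>-attentive sense; empty where \<open>f\<close> is not finite.
\<close>

definition limiting_subdiff :: "('a::euclidean_space \<Rightarrow> ereal) \<Rightarrow> 'a \<Rightarrow> 'a set" where
  "limiting_subdiff f x =
     {v. \<bar>f x\<bar> \<noteq> \<infinity> \<and>
         (\<exists>xs vs. xs \<longlonglongrightarrow> x \<and> (\<lambda>k. f (xs k)) \<longlonglongrightarrow> f x \<and> vs \<longlonglongrightarrow> v \<and>
                  (\<forall>k. vs k \<in> regular_subdiff f (xs k)))}"

definition gph_subdiff :: "('a::euclidean_space \<Rightarrow> ereal) \<Rightarrow> ('a \<times> 'a) set" where
  "gph_subdiff f = {(x, v). v \<in> limiting_subdiff f x}"

subsection \<open>Prox-regularity and subdifferential continuity\<close>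

text \<open>
  Local lower semicontinuity as in Rockafellar and Wets, \<^emph>\<open>Variational Analysis\<close>, Definition 1.33
  (for \<open>f\<close> finite at \<open>xbar\<close>): the epigraph of \<open>f\<close> is locally closed at \<open>(xbar, f xbar)\<close>.  It holds in
  particular when \<open>f\<close> is lower semicontinuous on a neighbourhood of \<open>xbar\<close>.
\<close>

definition locally_lsc :: "('a::euclidean_space \<Rightarrow> ereal) \<Rightarrow> 'a \<Rightarrow> bool" where
  "locally_lsc f xbar \<longleftrightarrow>
     (\<exists>\<epsilon>>0. \<forall>\<alpha> \<le> f xbar + ereal \<epsilon>. closed {x \<in> cball xbar \<epsilon>. f x \<le> \<alpha>})"

definition prox_regular :: "('a::euclidean_space \<Rightarrow> ereal) \<Rightarrow> 'a \<Rightarrow> 'a \<Rightarrow> bool" where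
  "prox_regular f xbar vbar \<longleftrightarrow>
     \<bar>f xbar\<bar> \<noteq> \<infinity> \<and> locally_lsc f xbar \<and> vbar \<in> limiting_subdiff f xbar \<and>
     (\<exists>\<epsilon>>0. \<exists>r\<ge>0. \<forall>x v.
        (x, v) \<in> gph_subdiff f \<inter> cball (xbar, vbar) \<epsilon> \<and> f x < f xbar + ereal \<epsilon> \<longrightarrow>
        (\<forall>x' \<in> cball xbar \<epsilon>.
           f x' \<ge> f x + ereal (v \<bullet> (x' - x)) - ereal (r / 2 * (norm (x' - x))\<^sup>2)))"

definition subdiff_continuous :: "('a::euclidean_space \<Rightarrow> ereal) \<Rightarrow> 'a \<Rightarrow> 'a \<Rightarrow> bool" where
  "subdiff_continuous f xbar vbar \<longleftrightarrow>
     (\<forall>xs vs. xs \<longlonglongrightarrow> xbar \<and> vs \<longlonglongrightarrow> vbar \<and> (\<forall>k. vs k \<in> limiting_subdiff f (xs k)) \<longrightarrow>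
        (\<lambda>k. f (xs k)) \<longlonglongrightarrow> f xbar)"

subsection \<open>Second subderivatives and generalized quadratic forms\<close>

definition second_subderiv ::
    "('a::euclidean_space \<Rightarrow> ereal) \<Rightarrow> 'a \<Rightarrow> 'a \<Rightarrow> 'a \<Rightarrow> ereal" where
  "second_subderiv f x v w =
     Liminf (at_right (0::real) \<times>\<^sub>F nhds w)
       (\<lambda>(t, u). (f (x + t *\<^sub>R u) - f x - ereal (t * (v \<bullet> u))) / ereal (1/2 * t\<^sup>2))"

definition edom :: "('a \<Rightarrow> ereal) \<Rightarrow> 'a set" where
  "edom \<phi> = {x. \<phi> x < \<infinity>}"

definition proper_fun :: "('a \<Rightarrow> ereal) \<Rightarrow> bool" where
  "proper_fun \<phi> \<longleftrightarrow> (\<forall>x. \<phi> x \<noteq> -\<infinity>) \<and> edom \<phi> \<noteq> {}"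

text \<open>
  Linearity of \<open>L\<close> is required only on the subspace \<open>edom \<phi>\<close>; its values elsewhere are irrelevant.
\<close>

definition gqf :: "('a::euclidean_space \<Rightarrow> ereal) \<Rightarrow> bool" where
  "gqf \<phi> \<longleftrightarrow>
     proper_fun \<phi> \<and> subspace (edom \<phi>) \<and>
     (\<exists>L :: 'a \<Rightarrow> 'a.
        (\<forall>x\<in>edom \<phi>. \<forall>y\<in>edom \<phi>. L (x + y) = L x + L y) \<and>
        (\<forall>c. \<forall>x\<in>edom \<phi>. L (c *\<^sub>R x) = c *\<^sub>R L x) \<and>
        (\<forall>x\<in>edom \<phi>. \<forall>y\<in>edom \<phi>. L x \<bullet> y = x \<bullet> L y) \<and>
        (\<forall>x\<in>edom \<phi>. \<phi> x = ereal (L x \<bullet> x)))"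

subsection \<open>Epi-convergence and the quadratic bundle\<close>

definition inner_limit :: "(nat \<Rightarrow> 'b::topological_space set) \<Rightarrow> 'b set" where
  "inner_limit C = {x. \<exists>y. y \<longlonglongrightarrow> x \<and> (\<forall>\<^sub>F k in sequentially. y k \<in> C k)}"

definition outer_limit :: "(nat \<Rightarrow> 'b::topological_space set) \<Rightarrow> 'b set" where
  "outer_limit C = {x. \<exists>y s. strict_mono s \<and> y \<longlonglongrightarrow> x \<and> (\<forall>k. y k \<in> C (s k))}"

definition PK_converges :: "(nat \<Rightarrow> 'b::topological_space set) \<Rightarrow> 'b set \<Rightarrow> bool" where
  "PK_converges C D \<longleftrightarrow> inner_limit C = D \<and> outer_limit C = D"

definition epi :: "('a \<Rightarrow> ereal) \<Rightarrow> ('a \<times> real) set" where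
  "epi \<phi> = {(x, \<alpha>). \<phi> x \<le> ereal \<alpha>}"

definition epi_converges ::
    "(nat \<Rightarrow> 'a::euclidean_space \<Rightarrow> ereal) \<Rightarrow> ('a \<Rightarrow> ereal) \<Rightarrow> bool" where
  "epi_converges \<phi>s \<phi> \<longleftrightarrow> PK_converges (\<lambda>k. epi (\<phi>s k)) (epi \<phi>)"

definition quad ::
    "('a::euclidean_space \<Rightarrow> ereal) \<Rightarrow> 'a \<Rightarrow> 'a \<Rightarrow> ('a \<Rightarrow> ereal) set" where
  "quad f xbar vbar =
     {q. gqf q \<and>
         (\<exists>xs vs. (\<forall>k. (xs k, vs k) \<in> gph_subdiff f) \<and>
                  (\<lambda>k. (xs k, vs k)) \<longlonglongrightarrow> (xbar, vbar) \<and>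
                  (\<forall>k. gqf (second_subderiv f (xs k) (vs k))) \<and>
                  epi_converges (\<lambda>k. second_subderiv f (xs k) (vs k)) q)}"

subsection \<open>Tilt stability\<close>

definition tilt_argmin ::
    "('a::euclidean_space \<Rightarrow> ereal) \<Rightarrow> 'a \<Rightarrow> real \<Rightarrow> 'a \<Rightarrow> 'a set" where
  "tilt_argmin f xbar \<gamma> v =
     {x. is_arg_min (\<lambda>x. f x - ereal (v \<bullet> x)) (\<lambda>x. x \<in> cball xbar \<gamma>) x}"

definition tilt_stable ::
    "('a::euclidean_space \<Rightarrow> ereal) \<Rightarrow> 'a \<Rightarrow> real \<Rightarrow> bool" where
  "tilt_stable f xbar \<kappa> \<longleftrightarrow>
     \<bar>f xbar\<bar> \<noteq> \<infinity> \<and>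
     (\<exists>\<gamma>>0. tilt_argmin f xbar \<gamma> 0 = {xbar} \<and>
        (\<exists>U m. open U \<and> 0 \<in> U \<and> (\<forall>v\<in>U. tilt_argmin f xbar \<gamma> v = {m v}) \<and>
               \<kappa>-lipschitz_on U m))"

end

theory Submission
  imports Defs
begin

text \<open>
  If tilt stability holds with argmin map \<open>m\<close>, the function \<open>G v = max\<^sub>x (\<langle>v, x\<rangle> - f x)\<close> is convex with
  \<open>\<kappa>\<close>-Lipschitz gradient \<open>m\<close>. The quadratic upper bound for \<open>G\<close> dualises to the growth estimate
  \<open>f y \<ge> f x + \<langle>v, y - x\<rangle> + \<bar>y - x\<bar>\<^sup>2/(2 \<kappa>)\<close> for \<open>x = m v\<close>. Hypomonotonicity identifies \<open>gph \<partial>f\<close>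
  near \<open>(xbar, 0)\<close> with the pairs \<open>(m v, v)\<close>, so \<open>d\<^sup>2f(x, v)(w) \<ge> \<bar>w\<bar>\<^sup>2/\<kappa>\<close> there, and
  epi-limits inherit this bound.

  Conversely, the local proximal mapping \<open>P\<close> of \<open>f\<close> with step \<open>1/(2 r)\<close> is Lipschitz and is the gradient of a
  convex function \<open>p\<close>. By Rademacher's theorem it has a linear directional derivative \<open>A\<close> at almost every
  \<open>z\<close>; there \<open>A\<close> is symmetric and positive semidefinite, and \<open>d\<^sup>2f\<close> at the graph point of \<open>z\<close> is the form
  \<open>A \<zeta> \<mapsto> 2 r (\<langle>A \<zeta>, \<zeta>\<rangle> - \<bar>A \<zeta>\<bar>\<^sup>2)\<close>, infinite off the range of \<open>A\<close>. Epi-convergence of such forms follows from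
  convergence of the operators, which live in a compact set; hence a bound on the quadratic bundle bounds \<open>A\<close>
  uniformly near \<open>xbar\<close>. Integration turns this into \<open>\<langle>P z' - P z, z' - z\<rangle> \<le> \<mu> \<bar>z' - z\<bar>\<^sup>2\<close> with
  \<open>\<mu> = 2 r \<kappa>/(2 r \<kappa> + 1)\<close>, and the quadratic upper bound for \<open>p\<close> dualises to uniform quadratic growth of \<open>f\<close> and
  thus to tilt stability.
\<close>

subsection \<open>Differentiability of Lipschitz functions almost everywhere\<close>

text \<open>The subdifferential of \<open>f\<close> is set-valued, so its graph offers nothing to
  differentiate directly. The map sending z to the pair (\<open>P z\<close>, 2 r (z -
  \<open>P z\<close>)) parametrises that graph near (\<open>xbar\<close>, 0) by a Lipschitz function
  on a ball; this is why the converse runs through \<open>P\<close>. The step 1/(2 r) adds the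
  curvature 2 r, of which hypomonotonicity costs r, so that r remains.

  An eigenvalue a > 0 of A stands for the curvature 2 r (1/a - 1) of the second subderivative, which
  is at least 1/\<kappa> exactly when a \<le> \<mu>; the eigenvalue 0 stands for the value infinity.
  The strict inequality \<l> > 1/\<kappa> pays for compactness: a bound on limits returns to nearby
  points only with a smaller constant.

  Quotients of \<open>P\<close> and of its potential are taken only along fixed directions, so
  Gateaux derivatives suffice. An almost everywhere bound says nothing on one given segment, which
  is why increments are estimated after averaging over parallel segments.\<close>

lemma vitali_intervals:
  fixes E V :: "real set" and Q :: "real \<Rightarrow> real \<Rightarrow> bool"
  assumes E: "E \<in> sets borel" and V: "open V" "E \<subseteq> V"
    and fine: "\<And>x d. x \<in> E \<Longrightarrow> d > 0 \<Longrightarrow> \<exists>a b. a < b \<and> x \<in> {a..b} \<and> b - a < d \<and> Q a b"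
  obtains C where "countable C" "\<And>a b. (a, b) \<in> C \<Longrightarrow> a < b \<and> {a..b} \<subseteq> V \<and> Q a b"
    "disjoint_family_on (\<lambda>(a, b). {a..b}) C"
    "E - (\<Union>(a, b)\<in>C. {a..b}) \<in> null_sets lborel"
proof -
  define K where "K = {(a, b). a < b \<and> {a..b} \<subseteq> V \<and> Q a b}"
  define ctr where "ctr = (\<lambda>(a::real, b). (a + b) / 2)"
  define rad where "rad = (\<lambda>(a::real, b). (b - a) / 2)"
  have cb: "cball (ctr i) (rad i) = (case i of (a, b) \<Rightarrow> {a..b})" for i
    by (cases i) (auto simp: ctr_def rad_def cball_def dist_real_def abs_le_iff field_simps)
  have pos: "0 < rad i" if "i \<in> K" for i
    using that by (auto simp: K_def rad_def)
  have cov: "\<exists>i. i \<in> K \<and> x \<in> cball (ctr i) (rad i) \<and> rad i < d" if xE: "x \<in> E" and d0: "0 < d" for x d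
  proof -
    obtain e where e: "e > 0" "ball x e \<subseteq> V"
      using openE[OF V(1)] V(2) xE by (metis subsetD)
    obtain a b where ab: "a < b" "x \<in> {a..b}" "b - a < min d e" "Q a b"
      using fine[OF xE, of "min d e"] d0 e(1) by auto
    have "{a..b} \<subseteq> ball x e" using ab by (auto simp: dist_real_def)
    then have "(a, b) \<in> K" using ab e by (auto simp: K_def)
    moreover have "rad (a, b) < d" using ab d0 by (auto simp: rad_def)
    ultimately show ?thesis using ab(2) by (intro exI[of _ "(a, b)"]) (simp add: cb)
  qed
  obtain C where C: "countable C" "C \<subseteq> K"
     "pairwise (\<lambda>i j. disjnt (cball (ctr i) (rad i)) (cball (ctr j) (rad j))) C"
     "negligible (E - (\<Union>i \<in> C. cball (ctr i) (rad i)))"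
    using Vitali_covering_theorem_cballs[of K rad E ctr, OF pos cov] by blast
  have "E - (\<Union>i \<in> C. cball (ctr i) (rad i)) \<in> sets lborel"
    using E C(1) by (auto intro!: sets.Diff sets.countable_UN')
  with C(4) have "E - (\<Union>i \<in> C. cball (ctr i) (rad i)) \<in> null_sets lborel"
    by (simp add: negligible_iff_null_sets null_sets_completion_iff)
  then have "E - (\<Union>(a, b)\<in>C. {a..b}) \<in> null_sets lborel" by (simp add: cb)
  moreover have "disjoint_family_on (\<lambda>(a, b). {a..b}) C"
    using C(3) by (simp add: cb disjoint_family_on_def pairwise_def disjnt_def)
  ultimately show ?thesis using C(1,2) by (intro that[of C]) (auto simp: K_def)
qed

text \<open>By continuity the Stieltjes measure of \<open>{a..b}\<close> is g b - g a. A disjoint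
  Vitali family of steep intervals inside V exhausts E up to a null set, and the estimate is summed
  over the family.\<close>

lemma slope_measure_lower:
  fixes g :: "real \<Rightarrow> real"
  assumes mono: "\<And>x y. x \<le> y \<Longrightarrow> g x \<le> g y" and cont: "continuous_on UNIV g"
    and E: "E \<in> sets borel" and V: "open V" "E \<subseteq> V" and q: "0 \<le> q"
    and steep: "\<And>x d. x \<in> E \<Longrightarrow> d > 0 \<Longrightarrow>
      \<exists>a b. a < b \<and> x \<in> {a..b} \<and> b - a < d \<and> q * (b - a) \<le> g b - g a"
  shows "ennreal q * emeasure lborel E \<le> emeasure (interval_measure g) V"
proof -
  obtain C where C: "countable C"
    "\<And>a b. (a, b) \<in> C \<Longrightarrow> a < b \<and> {a..b} \<subseteq> V \<and> q * (b - a) \<le> g b - g a"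
    "disjoint_family_on (\<lambda>(a, b). {a..b}) C"
    "E - (\<Union>(a, b)\<in>C. {a..b}) \<in> null_sets lborel"
    using vitali_intervals[where Q="\<lambda>a b. q * (b - a) \<le> g b - g a", OF E V steep] by metis
  let ?I = "\<lambda>(a::real, b). {a..b}"
  have I: "?I i \<in> sets borel" for i by (cases i) auto
  have U: "(\<Union>i\<in>C. ?I i) \<in> sets borel" using C(1) I by (auto intro!: sets.countable_UN')
  have "emeasure lborel E \<le> emeasure lborel ((\<Union>i\<in>C. ?I i) \<union> (E - (\<Union>i\<in>C. ?I i)))"
    using U E by (intro emeasure_mono) auto
  also have "\<dots> = emeasure lborel (\<Union>i\<in>C. ?I i)"
    using U C(4) by (intro emeasure_Un_null_set) auto
  also have "\<dots> = (\<integral>\<^sup>+i. emeasure lborel (?I i) \<partial>count_space C)"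
    using C I by (intro emeasure_UN_countable) auto
  finally have "ennreal q * emeasure lborel E \<le> ennreal q * (\<integral>\<^sup>+i. emeasure lborel (?I i) \<partial>count_space C)"
    by (rule mult_left_mono) auto
  also have "\<dots> = (\<integral>\<^sup>+i. ennreal q * emeasure lborel (?I i) \<partial>count_space C)"
    by (simp add: nn_integral_cmult)
  also have "\<dots> \<le> (\<integral>\<^sup>+i. emeasure (interval_measure g) (?I i) \<partial>count_space C)"
  proof (rule nn_integral_mono)
    fix i assume "i \<in> space (count_space C)"
    then obtain a b where i: "i = (a, b)" "(a, b) \<in> C" by (cases i) auto
    have "a < b" "q * (b - a) \<le> g b - g a" using C(2)[OF i(2)] by auto
    then show "ennreal q * emeasure lborel (?I i) \<le> emeasure (interval_measure g) (?I i)"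
      using q by (simp add: i emeasure_interval_measure_Icc[OF _ mono cont] ennreal_mult[symmetric] ennreal_leI)
  qed
  also have "\<dots> = emeasure (interval_measure g) (\<Union>i\<in>C. ?I i)"
    using C I by (intro emeasure_UN_countable[symmetric]) auto
  also have "\<dots> \<le> emeasure (interval_measure g) V"
    using C(2) V by (intro emeasure_mono) auto
  finally show ?thesis .
qed

text \<open>Cover E twice. Flat intervals inside a slightly larger open set have total Stieltjes
  measure at most p (|E| + e); steep intervals inside the flat ones show that the same measure is at
  least q |E|. Hence q |E| \<le> p |E|.\<close>

lemma oscillating_slopes_null:
  fixes g :: "real \<Rightarrow> real"
  assumes mono: "\<And>x y. x \<le> y \<Longrightarrow> g x \<le> g y" and cont: "continuous_on UNIV g"
    and E: "E \<in> sets borel" "emeasure lborel E < \<infinity>" and pq: "0 \<le> p" "p < q"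
    and steep: "\<And>x d. x \<in> E \<Longrightarrow> d > 0 \<Longrightarrow>
      \<exists>a b. a < b \<and> x \<in> {a..b} \<and> b - a < d \<and> q * (b - a) \<le> g b - g a"
    and flat: "\<And>x d. x \<in> E \<Longrightarrow> d > 0 \<Longrightarrow>
      \<exists>a b. a < b \<and> x \<in> {a..b} \<and> b - a < d \<and> g b - g a \<le> p * (b - a)"
  shows "E \<in> null_sets lborel"
proof -
  have bound: "ennreal q * emeasure lborel E \<le> ennreal p * (emeasure lborel E + ennreal e)"
    if e: "e > 0" for e
  proof -
    obtain V where V: "open V" "E \<subseteq> V" "emeasure lborel (V - E) < e"
      using outer_regular_lborel[OF E(1) e] by metis
    obtain C where C: "countable C"
      "\<And>a b. (a, b) \<in> C \<Longrightarrow> a < b \<and> {a..b} \<subseteq> V \<and> g b - g a \<le> p * (b - a)"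
      "disjoint_family_on (\<lambda>(a, b). {a..b}) C"
      "E - (\<Union>(a, b)\<in>C. {a..b}) \<in> null_sets lborel"
      using vitali_intervals[where Q="\<lambda>a b. g b - g a \<le> p * (b - a)", OF E(1) V(1,2) flat] by metis
    let ?I = "\<lambda>(a::real, b). {a..b}"
    have I: "?I i \<in> sets borel" for i by (cases i) auto
    have U: "(\<Union>i\<in>C. ?I i) \<in> sets borel" using C(1) I by (auto intro!: sets.countable_UN')
    \<comment> \<open>The steep covering needs an open set around it, so the flat intervals lose
      their endpoints; this costs E only countably many points.\<close>
    define W where "W = (\<Union>(a, b)\<in>C. {a<..<b})"
    have W: "open W" by (auto simp: W_def)
    have "E - W \<subseteq> (E - (\<Union>i\<in>C. ?I i)) \<union> (fst ` C \<union> snd ` C)"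
    proof
      fix x assume x: "x \<in> E - W"
      show "x \<in> (E - (\<Union>i\<in>C. ?I i)) \<union> (fst ` C \<union> snd ` C)"
      proof (cases "x \<in> (\<Union>i\<in>C. ?I i)")
        case True
        then obtain a b where ab: "(a, b) \<in> C" "x \<in> {a..b}" by auto
        with x have "x \<notin> {a<..<b}" unfolding W_def by blast
        with ab(2) have "x = a \<or> x = b" by auto
        with ab(1) show ?thesis by force
      qed (use x in auto)
    qed
    moreover have "(E - (\<Union>i\<in>C. ?I i)) \<union> (fst ` C \<union> snd ` C) \<in> null_sets lborel"
      by (rule null_sets.Un[OF C(4) countable_imp_null_set_lborel]) (simp add: C(1))
    ultimately have EW: "E - W \<in> null_sets lborel"
      using E(1) W by (metis null_sets_subset borel_open sets.Diff sets_lborel)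
    have "emeasure lborel E = emeasure lborel ((E \<inter> W) \<union> (E - W))"
      by (rule arg_cong[where f="emeasure lborel"]) auto
    also have "\<dots> = emeasure lborel (E \<inter> W)"
      using EW E(1) W by (intro emeasure_Un_null_set) auto
    finally have "ennreal q * emeasure lborel E = ennreal q * emeasure lborel (E \<inter> W)" by simp
    also have "\<dots> \<le> emeasure (interval_measure g) W"
      using E(1) W pq steep by (intro slope_measure_lower[OF mono cont]) auto
    also have "\<dots> \<le> emeasure (interval_measure g) (\<Union>i\<in>C. ?I i)"
      using U unfolding W_def by (intro emeasure_mono UN_mono) auto
    also have "\<dots> = (\<integral>\<^sup>+i. emeasure (interval_measure g) (?I i) \<partial>count_space C)"
      using C I by (intro emeasure_UN_countable) auto
    also have "\<dots> \<le> (\<integral>\<^sup>+i. ennreal p * emeasure lborel (?I i) \<partial>count_space C)"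
    proof (rule nn_integral_mono)
      fix i assume "i \<in> space (count_space C)"
      then obtain a b where i: "i = (a, b)" "(a, b) \<in> C" by (cases i) auto
      have "a < b" "g b - g a \<le> p * (b - a)" using C(2)[OF i(2)] by auto
      then show "emeasure (interval_measure g) (?I i) \<le> ennreal p * emeasure lborel (?I i)"
        using pq by (simp add: i emeasure_interval_measure_Icc[OF _ mono cont] ennreal_mult[symmetric] ennreal_leI)
    qed
    also have "\<dots> = ennreal p * (\<integral>\<^sup>+i. emeasure lborel (?I i) \<partial>count_space C)"
      by (simp add: nn_integral_cmult)
    also have "\<dots> = ennreal p * emeasure lborel (\<Union>i\<in>C. ?I i)"
      using C I by (subst emeasure_UN_countable) auto
    also have "\<dots> \<le> ennreal p * emeasure lborel V"
      using C(2) V by (intro mult_left_mono emeasure_mono) auto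
    also have "emeasure lborel V = emeasure lborel E + emeasure lborel (V - E)"
      using V E by (subst plus_emeasure) (auto intro!: arg_cong[where f="emeasure lborel"])
    also have "ennreal p * \<dots> \<le> ennreal p * (emeasure lborel E + ennreal e)"
      using V(3) by (intro mult_left_mono add_left_mono) auto
    finally show ?thesis .
  qed
  obtain m where m: "emeasure lborel E = ennreal m" "m \<ge> 0"
    using E(2) by (cases "emeasure lborel E") auto
  \<comment> \<open>The error is scaled by p + 1 and not by p, which may be 0.\<close>
  have "q * m \<le> p * m + e" if "e > 0" for e
  proof -
    have "ennreal (q * m) \<le> ennreal (p * (m + e / (p + 1)))"
      using bound[of "e / (p + 1)"] that m pq
      by (simp add: ennreal_mult' ennreal_plus[symmetric] del: ennreal_plus)
    then have "q * m \<le> p * (m + e / (p + 1))"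
      using m pq that by (subst (asm) ennreal_le_iff) auto
    also have "\<dots> \<le> p * m + e"
      using pq that by (simp add: field_simps)
    finally show ?thesis .
  qed
  then have "q * m \<le> p * m" by (rule field_le_epsilon)
  then have "m \<le> 0" using pq by (simp add: mult_le_cancel_right)
  then show ?thesis using m E(1) by auto
qed

section \<open>Directional differentiability: measurability and the one-dimensional case\<close>

definition dir_diff :: "('a::real_normed_vector \<Rightarrow> real) \<Rightarrow> 'a \<Rightarrow> 'a \<Rightarrow> bool" where
  "dir_diff F w z \<longleftrightarrow> (\<exists>l. ((\<lambda>t. (F (z + t *\<^sub>R w) - F z) / t) \<longlongrightarrow> l) (at 0))"

text \<open>Eliminating the unknown limit leaves quantifiers over natural numbers outside and a
  non-strict inequality inside, the form from which Borel measurability can be read off.\<close>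

lemma tendsto_at_0_iff_Cauchy:
  fixes Q :: "real \<Rightarrow> real"
  shows "(\<exists>l. (Q \<longlongrightarrow> l) (at 0)) \<longleftrightarrow>
    (\<forall>m::nat. \<exists>n::nat. \<forall>s t. 0 < \<bar>s\<bar> \<and> \<bar>s\<bar> < 1 / Suc n \<and> 0 < \<bar>t\<bar> \<and> \<bar>t\<bar> < 1 / Suc n \<longrightarrow> \<bar>Q s - Q t\<bar> \<le> 1 / Suc m)"
  (is "?L \<longleftrightarrow> ?R")
proof
  assume ?L
  then obtain l where l: "(Q \<longlongrightarrow> l) (at 0)" by blast
  show ?R
  proof
    fix m :: nat
    define c where "c = 1 / real (Suc m)"
    have "eventually (\<lambda>t. dist (Q t) l < c / 2) (at 0)"
      using l by (rule tendstoD) (simp add: c_def)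
    then obtain d where d: "d > 0" "\<And>t. t \<noteq> 0 \<Longrightarrow> \<bar>t\<bar> < d \<Longrightarrow> \<bar>Q t - l\<bar> < c / 2"
      by (auto simp: eventually_at dist_real_def)
    obtain n where n: "1 / Suc n < d" using d(1) by (metis nat_approx_posE)
    have "\<bar>Q s - Q t\<bar> \<le> 1 / Suc m"
      if "0 < \<bar>s\<bar> \<and> \<bar>s\<bar> < 1 / Suc n \<and> 0 < \<bar>t\<bar> \<and> \<bar>t\<bar> < 1 / Suc n" for s t
      using d(2)[of s] d(2)[of t] that n unfolding c_def[symmetric] by linarith
    then show "\<exists>n. \<forall>s t. 0 < \<bar>s\<bar> \<and> \<bar>s\<bar> < 1 / Suc n \<and> 0 < \<bar>t\<bar> \<and> \<bar>t\<bar> < 1 / Suc n \<longrightarrow> \<bar>Q s - Q t\<bar> \<le> 1 / Suc m"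
      by blast
  qed
next
  assume R: ?R
  \<comment> \<open>The double successor keeps the sample points strictly below 1/(n + 1) already
    for k = n.\<close>
  define X where "X k = Q (1 / Suc (Suc k))" for k
  have small: "1 / real (Suc (Suc k)) < 1 / Suc n" if "k \<ge> n" for k n
    using that by (simp add: field_simps)
  have "Cauchy X"
  proof (rule metric_CauchyI)
    fix e :: real assume "e > 0"
    then obtain m where m: "1 / Suc m < e" by (metis nat_approx_posE)
    obtain n where n: "\<And>s t. 0 < \<bar>s\<bar> \<and> \<bar>s\<bar> < 1 / Suc n \<and> 0 < \<bar>t\<bar> \<and> \<bar>t\<bar> < 1 / Suc n \<Longrightarrow> \<bar>Q s - Q t\<bar> \<le> 1 / Suc m"
      using R by blast
    have "dist (X i) (X j) < e" if "i \<ge> n" "j \<ge> n" for i j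
      using n[of "1 / Suc (Suc i)" "1 / Suc (Suc j)"] small[OF that(1)] small[OF that(2)] m
      by (auto simp: X_def dist_real_def)
    then show "\<exists>M. \<forall>i\<ge>M. \<forall>j\<ge>M. dist (X i) (X j) < e" by blast
  qed
  then obtain l where l: "X \<longlonglongrightarrow> l" by (auto simp: Cauchy_convergent_iff convergent_def)
  have "(Q \<longlongrightarrow> l) (at 0)"
  proof (rule tendstoI)
    fix e :: real assume "e > 0"
    then obtain m where m: "1 / Suc m < e" by (metis nat_approx_posE)
    obtain n where n: "\<And>s t. 0 < \<bar>s\<bar> \<and> \<bar>s\<bar> < 1 / Suc n \<and> 0 < \<bar>t\<bar> \<and> \<bar>t\<bar> < 1 / Suc n \<Longrightarrow> \<bar>Q s - Q t\<bar> \<le> 1 / Suc m"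
      using R by blast
    have "dist (Q t) l < e" if t: "t \<noteq> 0" "\<bar>t\<bar> < 1 / Suc n" for t
    proof -
      have "(\<lambda>k. \<bar>Q t - X k\<bar>) \<longlonglongrightarrow> \<bar>Q t - l\<bar>" using l by (intro tendsto_intros)
      moreover have "\<bar>Q t - X k\<bar> \<le> 1 / Suc m" if "k \<ge> n" for k
        using n[of t "1 / Suc (Suc k)"] t small[OF that] by (auto simp: X_def)
      ultimately have "\<bar>Q t - l\<bar> \<le> 1 / Suc m" by (intro LIMSEQ_le_const2) auto
      then show ?thesis using m by (simp add: dist_real_def)
    qed
    then show "eventually (\<lambda>t. dist (Q t) l < e) (at 0)"
      by (auto simp: eventually_at dist_real_def intro!: exI[of _ "1 / Suc n"])
  qed
  then show ?L by blast
qed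

text \<open>The intersection over s and t is uncountable, but by continuity of F it is an
  intersection of closed sets, hence closed; the remaining operations are countable.\<close>

lemma sets_dir_diff:
  fixes F :: "'a::euclidean_space \<Rightarrow> real"
  assumes cont: "continuous_on UNIV F"
  shows "{z. dir_diff F w z} \<in> sets borel"
proof -
  let ?Q = "\<lambda>t z. (F (z + t *\<^sub>R w) - F z) / t"
  let ?T = "\<lambda>n::nat. {(s, t). 0 < \<bar>s\<bar> \<and> \<bar>s\<bar> < 1 / Suc n \<and> 0 < \<bar>t\<bar> \<and> \<bar>t\<bar> < 1 / real (Suc n)}"
  have cl: "closed {z. \<bar>?Q s z - ?Q t z\<bar> \<le> c}" for s t c
  proof -
    have F: "continuous_on UNIV (\<lambda>z. F (z + u *\<^sub>R w))" for u
      by (rule continuous_on_compose2[OF cont]) (auto intro!: continuous_intros)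
    have "continuous_on UNIV (\<lambda>z. (F (z + s *\<^sub>R w) - F z) * inverse s - (F (z + t *\<^sub>R w) - F z) * inverse t)"
      by (intro continuous_intros F cont)
    from closed_Collect_le[OF continuous_on_rabs[OF this] continuous_on_const[of UNIV c]]
    show ?thesis by (simp add: divide_inverse)
  qed
  have "{z. dir_diff F w z} = (\<Inter>m::nat. \<Union>n. \<Inter>(s, t)\<in>?T n. {z. \<bar>?Q s z - ?Q t z\<bar> \<le> 1 / Suc m})"
    unfolding dir_diff_def tendsto_at_0_iff_Cauchy by auto
  moreover have "closed (\<Inter>(s, t)\<in>?T n. {z. \<bar>?Q s z - ?Q t z\<bar> \<le> 1 / Suc m})" for n m :: nat
    using cl by (intro closed_INT) auto
  ultimately show ?thesis by (auto intro!: sets.countable_INT' sets.countable_UN' borel_closed)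
qed

text \<open>Where the slopes have no limit, they oscillate across some rational gap p < q at
  arbitrarily small scales, and each such gap contributes a null set.\<close>

lemma mono_Lipschitz_AE_dir_diff:
  fixes h :: "real \<Rightarrow> real"
  assumes mono: "\<And>x y. x \<le> y \<Longrightarrow> h x \<le> h y" and lip: "K-lipschitz_on UNIV h"
  shows "AE x in lborel. dir_diff h 1 x"
proof -
  have cont: "continuous_on UNIV h" using lip by (rule lipschitz_on_continuous_on)
  define S where "S x t = (h (x + t) - h x) / t" for x t
  have S0: "0 \<le> S x t" for x t
    using mono[of x "x + t"] mono[of "x + t" x] by (cases "t \<ge> 0") (auto simp: S_def divide_nonpos_neg zero_le_divide_iff)
  have SK: "S x t \<le> K" if "t \<noteq> 0" for x t
  proof -
    have "\<bar>h (x + t) - h x\<bar> \<le> K * \<bar>t\<bar>" using lipschitz_onD[OF lip, of "x + t" x] by (simp add: dist_real_def)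
    then have "\<bar>S x t\<bar> \<le> K" using that by (simp add: S_def abs_divide pos_divide_le_eq)
    then show ?thesis by simp
  qed
  have contS: "continuous_on UNIV (\<lambda>x. S x t)" for t
  proof -
    have "continuous_on UNIV (\<lambda>x. h (x + t))"
      by (rule continuous_on_compose2[OF cont]) (auto intro!: continuous_intros)
    then show ?thesis unfolding S_def divide_inverse by (intro continuous_intros cont)
  qed
  define T where "T k = {t::real. 0 < \<bar>t\<bar> \<and> \<bar>t\<bar> < 1 / Suc k}" for k :: nat
  \<comment> \<open>The window (-n, n) provides the finite measure that
    \<open>oscillating_slopes_null\<close> asks for. The unions over t are open, which makes the set
    Borel although t ranges over an uncountable set.\<close>
  define E where "E p q n = {- real n<..<real n} \<inter> (\<Inter>k. \<Union>t\<in>T k. {x. S x t < p}) \<inter> (\<Inter>k. \<Union>t\<in>T k. {x. q < S x t})"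
    for p q :: real and n :: nat
  have Eborel: "E p q n \<in> sets borel" for p q n
  proof -
    have "open (\<Union>t\<in>T k. {x. S x t < p})" "open (\<Union>t\<in>T k. {x. q < S x t})" for k
      by (auto intro!: open_UN open_Collect_less contS continuous_intros)
    then show ?thesis unfolding E_def by (intro sets.Int sets.countable_INT') auto
  qed
  have interval: "\<exists>a b. a < b \<and> x \<in> {a..b} \<and> b - a < d \<and> h b - h a = S x t * (b - a)"
    if "t \<in> T k" "1 / Suc k < d" for x t k d
  proof (cases "t > 0")
    case True
    moreover have "t < d" using that True unfolding T_def by (auto intro: less_trans)
    ultimately show ?thesis by (intro exI[of _ "x + t", THEN exI[of _ x]]) (auto simp: S_def)
  next
    case False
    with that have "t < 0" by (auto simp: T_def)
    moreover have "- t < d" using that \<open>t < 0\<close> unfolding T_def by (auto intro: less_trans)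
    ultimately show ?thesis by (intro exI[of _ x, THEN exI[of _ "x + t"]]) (auto simp: S_def field_simps)
  qed
  have null: "E p q n \<in> null_sets lborel" if pq: "p < q" for p q n
  proof (cases "p > 0")
    case True
    show ?thesis
    proof (rule oscillating_slopes_null[OF mono cont Eborel _ _ pq])
      have "emeasure lborel (E p q n) \<le> emeasure lborel {- real n<..<real n}"
        by (rule emeasure_mono) (auto simp: E_def)
      then show "emeasure lborel (E p q n) < \<infinity>"
        by (rule le_less_trans) simp
      show "0 \<le> p" using True by simp
      fix x d :: real assume x: "x \<in> E p q n" and d: "d > 0"
      obtain k where k: "1 / Suc k < d" using d by (metis nat_approx_posE)
      obtain t where t: "t \<in> T k" "q < S x t" using x unfolding E_def by blast
      obtain s where s: "s \<in> T k" "S x s < p" using x unfolding E_def by blast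
      show "\<exists>a b. a < b \<and> x \<in> {a..b} \<and> b - a < d \<and> q * (b - a) \<le> h b - h a"
        using interval[OF t(1) k, of x] t(2) by (metis diff_ge_0_iff_ge less_imp_le mult_right_mono)
      show "\<exists>a b. a < b \<and> x \<in> {a..b} \<and> b - a < d \<and> h b - h a \<le> p * (b - a)"
        using interval[OF s(1) k, of x] s(2) by (metis diff_ge_0_iff_ge less_imp_le mult_right_mono)
    qed
  next
    case False
    have "x \<notin> E p q n" for x
      using S0[of x] False unfolding E_def by (auto simp: not_less intro: order_trans)
    then have "E p q n = {}" by blast
    then show ?thesis by simp
  qed
  have "{x. \<not> dir_diff h 1 x} \<subseteq> (\<Union>(p, q)\<in>{(p, q)\<in>\<rat> \<times> \<rat>. p < q}. \<Union>n. E p q n)"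
  proof
    fix x assume "x \<in> {x. \<not> dir_diff h 1 x}"
    then have nl: "\<not> (S x \<longlongrightarrow> l) (at 0)" for l
      by (auto simp: dir_diff_def S_def[abs_def])
    \<comment> \<open>This is the liminf of the slopes; it is a real number because all slopes lie
      between 0 and K.\<close>
    define l where "l = Sup {c. eventually (\<lambda>t. c \<le> S x t) (at 0)}"
    have ne: "0 \<in> {c. eventually (\<lambda>t. c \<le> S x t) (at 0)}" using S0 by auto
    have bd: "c \<le> K" if "eventually (\<lambda>t. c \<le> S x t) (at 0)" for c
    proof -
      have "eventually (\<lambda>t::real. t \<noteq> 0) (at 0)" by (simp add: eventually_at_filter)
      with that have "eventually (\<lambda>t. c \<le> K) (at (0::real))"
        by eventually_elim (use SK order_trans in blast)
      then show ?thesis by simp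
    qed
    have bdd: "bdd_above {c. eventually (\<lambda>t. c \<le> S x t) (at 0)}" using bd by (auto intro!: bdd_aboveI)
    obtain e where e: "e > 0" "\<not> eventually (\<lambda>t. dist (S x t) l < e) (at 0)"
      using nl[of l] by (auto simp: tendsto_iff)
    have low: "eventually (\<lambda>t. l - e / 2 \<le> S x t) (at 0)"
    proof -
      obtain c where c: "eventually (\<lambda>t. c \<le> S x t) (at 0)" "l - e / 2 < c"
        using less_cSup_iff[OF _ bdd, of "l - e / 2"] ne e(1) unfolding l_def[symmetric] by auto
      show ?thesis using c(1) by eventually_elim (use c(2) in auto)
    qed
    have up: "\<not> eventually (\<lambda>t. S x t < l + e) (at 0)"
    proof
      assume "eventually (\<lambda>t. S x t < l + e) (at 0)"
      with low have "eventually (\<lambda>t. dist (S x t) l < e) (at 0)"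
        by eventually_elim (use e(1) in \<open>auto simp: dist_real_def abs_less_iff\<close>)
      with e show False by simp
    qed
    have lo: "\<not> eventually (\<lambda>t. l + e / 3 \<le> S x t) (at 0)"
    proof
      assume "eventually (\<lambda>t. l + e / 3 \<le> S x t) (at 0)"
      then have "l + e / 3 \<le> l" unfolding l_def by (intro cSup_upper bdd) auto
      then show False using e by simp
    qed
    \<comment> \<open>Slopes below l + e/3 recur by maximality of l. Slopes of at least l + e recur
      as well, since convergence to l fails by e and cannot fail from below. The two rationals are
      picked on either side of l + e/2.\<close>
    obtain p q where pq: "p \<in> \<rat>" "q \<in> \<rat>" "l + e / 3 < p" "p < q" "q < l + e"
    proof -
      obtain p where "p \<in> \<rat>" "l + e / 3 < p" "p < l + e / 2" using Rats_dense_in_real[of "l + e / 3" "l + e / 2"] e by auto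
      moreover obtain q where "q \<in> \<rat>" "l + e / 2 < q" "q < l + e" using Rats_dense_in_real[of "l + e / 2" "l + e"] e by auto
      ultimately show ?thesis using that[of p q] by auto
    qed
    have "\<exists>t\<in>T k. S x t < p" "\<exists>t\<in>T k. q < S x t" for k
    proof -
      have "\<exists>t. t \<noteq> 0 \<and> \<bar>t\<bar> < 1 / Suc k \<and> \<not> l + e / 3 \<le> S x t"
        using lo unfolding eventually_at by (force simp: dist_real_def)
      then show "\<exists>t\<in>T k. S x t < p" using pq by (force simp: T_def)
      have "\<exists>t. t \<noteq> 0 \<and> \<bar>t\<bar> < 1 / Suc k \<and> \<not> S x t < l + e"
        using up unfolding eventually_at by (force simp: dist_real_def)
      then show "\<exists>t\<in>T k. q < S x t" using pq by (force simp: T_def)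
    qed
    moreover obtain n :: nat where "\<bar>x\<bar> < real n" using reals_Archimedean2 by blast
    ultimately have "x \<in> E p q n" by (auto simp: E_def)
    then show "x \<in> (\<Union>(p, q)\<in>{(p, q)\<in>\<rat> \<times> \<rat>. p < q}. \<Union>n. E p q n)" using pq by auto
  qed
  moreover have "(\<Union>(p, q)\<in>{(p, q)\<in>\<rat> \<times> \<rat>. p < q}. \<Union>n. E p q n) \<in> null_sets lborel"
  proof (intro null_sets_UN')
    show "countable {(p, q)\<in>\<rat> \<times> \<rat>. p < (q::real)}"
      by (rule countable_subset[of _ "\<rat> \<times> \<rat>"]) (auto intro: countable_rat)
  qed (use null in auto)
  ultimately show ?thesis by (intro AE_I'[of "\<Union>(p, q)\<in>{(p, q)\<in>\<rat> \<times> \<rat>. p < q}. \<Union>n. E p q n"]) auto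
qed

text \<open>Adding K x makes the function monotone and shifts every slope by the constant K.\<close>

lemma Lipschitz_AE_dir_diff_real:
  fixes g :: "real \<Rightarrow> real"
  assumes lip: "K-lipschitz_on UNIV g"
  shows "AE x in lborel. dir_diff g 1 x"
proof -
  define h where "h x = g x + K * x" for x
  have K: "K \<ge> 0" using lip by (rule lipschitz_on_nonneg)
  have g: "\<bar>g x - g y\<bar> \<le> K * \<bar>x - y\<bar>" for x y
    using lipschitz_onD[OF lip, of x y] by (simp add: dist_real_def)
  have mono: "h x \<le> h y" if "x \<le> y" for x y
    using g[of x y] that by (auto simp: h_def algebra_simps)
  have "(K + K)-lipschitz_on UNIV h"
    unfolding h_def using K
    by (intro lipschitz_on_add[OF lip]) (auto intro!: lipschitz_onI simp: dist_real_def abs_mult right_diff_distrib[symmetric])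
  with mono have "AE x in lborel. dir_diff h 1 x" by (rule mono_Lipschitz_AE_dir_diff)
  then show ?thesis
  proof (rule AE_mp, intro AE_I2 impI)
    fix x assume "dir_diff h 1 x"
    then obtain l where l: "((\<lambda>t. (h (x + t) - h x) / t) \<longlongrightarrow> l) (at 0)" by (auto simp: dir_diff_def)
    have "((\<lambda>t. (h (x + t) - h x) / t - K) \<longlongrightarrow> l - K) (at 0)" using l by (intro tendsto_intros)
    moreover have "eventually (\<lambda>t. (h (x + t) - h x) / t - K = (g (x + t) - g x) / t) (at 0)"
      by (auto simp: eventually_at_filter h_def field_simps)
    ultimately have "((\<lambda>t. (g (x + t) - g x) / t) \<longlongrightarrow> l - K) (at 0)"
      by (rule Lim_transform_eventually)
    then show "dir_diff g 1 x" by (auto simp: dir_diff_def)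
  qed
qed

section \<open>From lines to the whole space by translation invariance\<close>

lemma nn_integral_lborel_translate:
  fixes f :: "'a::euclidean_space \<Rightarrow> ennreal"
  assumes [measurable]: "f \<in> borel_measurable borel"
  shows "(\<integral>\<^sup>+z. f (c + z) \<partial>lborel) = (\<integral>\<^sup>+z. f z \<partial>lborel)"
  by (subst (2) lborel_distr_plus[of c, symmetric]) (simp add: nn_integral_distr)

lemma AE_lborel_translate:
  fixes c :: "'a::euclidean_space"
  assumes "AE z in lborel. P z"
  shows "AE z in lborel. P (c + z)"
proof -
  obtain N where N: "{z. \<not> P z} \<subseteq> N" "N \<in> null_sets lborel"
    using assms unfolding eventually_ae_filter by auto
  have "AE z in distr lborel borel ((+) c). z \<notin> N"
    using AE_not_in[OF N(2)] by (subst lborel_distr_plus)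
  then have "AE z in lborel. c + z \<notin> N" using N(2) by (subst (asm) AE_distr_iff) auto
  then show ?thesis by eventually_elim (use N(1) in auto)
qed

text \<open>
  Averaging the indicator of the exceptional set over translates along \<open>w\<close> reduces the claim to lines in
  direction \<open>w\<close> without a change of coordinates.
\<close>

lemma AE_lborel_if_AE_lines:
  fixes w :: "'a::euclidean_space"
  assumes S: "S \<in> sets borel" and lines: "\<And>z. AE s in lborel. z + s *\<^sub>R w \<in> S"
  shows "AE z in lborel. z \<in> S"
proof -
  define f where "f s z = indicator {0..1::real} s * (indicator (- S) (s *\<^sub>R w + z) :: ennreal)" for s z
  have [measurable]: "- S \<in> sets borel" using S by auto
  have ind: "(indicator (- S) :: 'a \<Rightarrow> ennreal) \<in> borel_measurable borel"
    using S by (intro borel_measurable_indicator) auto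
  have "(\<lambda>x::real \<times> 'a. fst x *\<^sub>R w + snd x) \<in> lborel \<Otimes>\<^sub>M lborel \<rightarrow>\<^sub>M borel" by measurable
  from measurable_compose[OF this ind]
  have mS: "(\<lambda>x. indicator (- S) (fst x *\<^sub>R w + snd x) :: ennreal) \<in> borel_measurable (lborel \<Otimes>\<^sub>M lborel)" .
  have meas: "case_prod f \<in> borel_measurable (lborel \<Otimes>\<^sub>M lborel)"
    unfolding f_def case_prod_beta' by (rule borel_measurable_times_ennreal[OF _ mS]) measurable
  have "(\<integral>\<^sup>+z. (\<integral>\<^sup>+s. f s z \<partial>lborel) \<partial>lborel) = 0"
  proof -
    have "(\<integral>\<^sup>+s. f s z \<partial>lborel) = 0" for z
    proof -
      have "AE s in lborel. f s z = 0"
        using lines[of z] by eventually_elim (auto simp: f_def add.commute)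
      then show ?thesis by (subst nn_integral_0_iff_AE) (auto simp: f_def)
    qed
    then show ?thesis by simp
  qed
  moreover have "(\<integral>\<^sup>+z. (\<integral>\<^sup>+s. f s z \<partial>lborel) \<partial>lborel) = (\<integral>\<^sup>+s. (\<integral>\<^sup>+z. f s z \<partial>lborel) \<partial>lborel)"
    using lborel_pair.Fubini'[OF meas] by simp
  moreover have "(\<integral>\<^sup>+z. f s z \<partial>lborel) = indicator {0..1} s * emeasure lborel (- S)" for s
    unfolding f_def
    by (subst nn_integral_cmult) (auto simp: nn_integral_lborel_translate[of "indicator (- S)"])
  ultimately have "emeasure lborel (- S) = 0"
    by (simp add: nn_integral_multc)
  then have "- S \<in> null_sets lborel" using S by auto
  from AE_not_in[OF this] show ?thesis by simp
qed

lemma Lipschitz_AE_dir_diff: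
  fixes F :: "'a::euclidean_space \<Rightarrow> real"
  assumes lip: "K-lipschitz_on UNIV F"
  shows "AE z in lborel. dir_diff F w z"
proof -
  have "AE z in lborel. z \<in> {z. dir_diff F w z}"
  proof (rule AE_lborel_if_AE_lines[where w=w])
    show "{z. dir_diff F w z} \<in> sets borel"
      using lip by (intro sets_dir_diff lipschitz_on_continuous_on)
    fix z
    have "(K * norm w)-lipschitz_on UNIV (\<lambda>s. F (z + s *\<^sub>R w))"
    proof (rule lipschitz_onI)
      show "0 \<le> K * norm w" using lipschitz_on_nonneg[OF lip] by simp
      fix s t :: real
      have "dist (F (z + s *\<^sub>R w)) (F (z + t *\<^sub>R w)) \<le> K * dist (z + s *\<^sub>R w) (z + t *\<^sub>R w)"
        using lip by (rule lipschitz_onD) auto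
      also have "dist (z + s *\<^sub>R w) (z + t *\<^sub>R w) = \<bar>s - t\<bar> * norm w"
        by (simp add: dist_norm scaleR_diff_left[symmetric])
      finally show "dist (F (z + s *\<^sub>R w)) (F (z + t *\<^sub>R w)) \<le> K * norm w * dist s t"
        by (simp add: dist_real_def mult_ac)
    qed
    from Lipschitz_AE_dir_diff_real[OF this]
    show "AE s in lborel. z + s *\<^sub>R w \<in> {z. dir_diff F w z}"
      by (auto simp: dir_diff_def algebra_simps)
  qed
  then show ?thesis by simp
qed

subsection \<open>Rademacher's theorem\<close>

text \<open>Adding K turns the signed density h into a non-negative one. The measures with densities
  h + K and K then agree on boxes, an intersection-stable generator of the Borel sets, so the
  densities agree almost everywhere.\<close>

lemma AE_eq_0_if_box_integrals_0:
  fixes h :: "'a::euclidean_space \<Rightarrow> real"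
  assumes h: "h \<in> borel_measurable borel" and bd: "\<And>z. \<bar>h z\<bar> \<le> K"
    and int0: "\<And>a b. (\<integral>z. indicator (box a b) z * h z \<partial>lborel) = 0"
  shows "AE z in lborel. h z = 0"
proof -
  have K: "K \<ge> 0" using bd[of 0] by linarith
  have [measurable]: "h \<in> borel_measurable borel" by (rule h)
  let ?M = "density lborel (\<lambda>z. ennreal (h z + K))" and ?N = "density lborel (\<lambda>z. ennreal K)"
  have fin: "emeasure lborel (box a b) < \<infinity>" for a b :: 'a
    by (intro emeasure_bounded_finite bounded_box)
  have emN: "emeasure ?N (box a b) = ennreal K * emeasure lborel (box a b)" for a b
    by (simp add: emeasure_density nn_integral_cmult_indicator)
  have eq: "emeasure ?M (box a b) = emeasure ?N (box a b)" for a b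
  proof -
    have i1: "integrable lborel (\<lambda>z. indicator (box a b) z * K)"
      using fin[of a b] by (intro integrable_mult_left integrable_real_indicator) auto
    have i2: "integrable lborel (\<lambda>z. indicator (box a b) z * h z)"
      by (rule Bochner_Integration.integrable_bound[OF i1]) (use bd K in \<open>auto simp: indicator_def\<close>)
    have pos: "0 \<le> h z + K" for z using bd[of z] by linarith
    have "emeasure ?M (box a b) = (\<integral>\<^sup>+z. ennreal (indicator (box a b) z * h z + indicator (box a b) z * K) \<partial>lborel)"
      by (subst emeasure_density) (auto intro!: nn_integral_cong simp: indicator_def)
    also have "\<dots> = ennreal (\<integral>z. indicator (box a b) z * h z + indicator (box a b) z * K \<partial>lborel)"
      using i1 i2 pos by (intro nn_integral_eq_integral) (auto simp: indicator_def)
    also have "\<dots> = ennreal (\<integral>z. indicator (box a b) z * K \<partial>lborel)"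
      using i1 i2 by (simp add: int0)
    also have "\<dots> = (\<integral>\<^sup>+z. ennreal (indicator (box a b) z * K) \<partial>lborel)"
      using i1 K by (intro nn_integral_eq_integral[symmetric]) auto
    also have "\<dots> = emeasure ?N (box a b)"
      by (subst emeasure_density) (auto intro!: nn_integral_cong simp: indicator_def)
    finally show ?thesis .
  qed
  have "?M = ?N"
  proof (rule measure_eqI_generator_eq[where E="range (\<lambda>(a, b). box a b)" and \<Omega>=UNIV
        and A="\<lambda>n::nat. box (- (real n *\<^sub>R One)) (real n *\<^sub>R One)"])
    show "Int_stable (range (\<lambda>(a, b). box a b :: 'a set))"
      by (auto simp: Int_stable_def box_Int_box)
    show "sets ?M = sigma_sets UNIV (range (\<lambda>(a, b). box a b))" "sets ?N = sigma_sets UNIV (range (\<lambda>(a, b). box a b))"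
      by (simp_all add: borel_eq_box)
    show "(\<Union>n::nat. box (- (real n *\<^sub>R One)) (real n *\<^sub>R One)) = (UNIV :: 'a set)"
      by (simp add: UN_box_eq_UNIV)
    show "emeasure ?M (box (- (real i *\<^sub>R One)) (real i *\<^sub>R One)) \<noteq> \<infinity>" for i
      unfolding eq emN using fin by (simp add: ennreal_mult_eq_top_iff less_top)
  qed (use eq in auto)
  then have "AE z in lborel. ennreal (h z + K) = ennreal K"
    by (subst (asm) sigma_finite_measure.density_unique_iff[OF lborel.sigma_finite_measure_axioms]) auto
  then show ?thesis
  proof eventually_elim
    case (elim z)
    then show ?case using bd[of z] K by (simp add: abs_le_iff)
  qed
qed

definition dq :: "('a::real_normed_vector \<Rightarrow> real) \<Rightarrow> 'a \<Rightarrow> nat \<Rightarrow> 'a \<Rightarrow> real" where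
  "dq F w n z = (F (z + (1 / real (Suc n)) *\<^sub>R w) - F z) / (1 / real (Suc n))"

text \<open>The limit is taken along the fixed steps 1/(n + 1), which makes the function measurable
  on the whole space; where the quotients diverge its value is arbitrary.\<close>

definition dir_deriv :: "('a::real_normed_vector \<Rightarrow> real) \<Rightarrow> 'a \<Rightarrow> 'a \<Rightarrow> real" where
  "dir_deriv F w z = lim (\<lambda>n. dq F w n z)"

lemma dir_diff_tendsto:
  assumes "dir_diff F w z"
  shows "((\<lambda>t. (F (z + t *\<^sub>R w) - F z) / t) \<longlongrightarrow> dir_deriv F w z) (at 0)"
proof -
  obtain l where l: "((\<lambda>t. (F (z + t *\<^sub>R w) - F z) / t) \<longlongrightarrow> l) (at 0)"
    using assms by (auto simp: dir_diff_def)
  have "filterlim (\<lambda>n. 1 / real (Suc n)) (at 0) sequentially"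
    unfolding filterlim_at using LIMSEQ_inverse_real_of_nat by (auto simp: inverse_eq_divide)
  from filterlim_compose[OF l this] have "(\<lambda>n. dq F w n z) \<longlonglongrightarrow> l" by (simp add: dq_def)
  then have "dir_deriv F w z = l" unfolding dir_deriv_def by (rule limI)
  with l show ?thesis by simp
qed

lemma dir_diff_dq_tendsto:
  assumes "dir_diff F w z"
  shows "(\<lambda>n. dq F w n z) \<longlonglongrightarrow> dir_deriv F w z"
proof -
  have "filterlim (\<lambda>n. 1 / real (Suc n)) (at 0) sequentially"
    unfolding filterlim_at using LIMSEQ_inverse_real_of_nat by (auto simp: inverse_eq_divide)
  from filterlim_compose[OF dir_diff_tendsto[OF assms] this] show ?thesis by (simp add: dq_def)
qed

lemma dir_deriv_eqI:
  assumes "((\<lambda>t. (F (z + t *\<^sub>R w) - F z) / t) \<longlongrightarrow> l) (at 0)"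
  shows "dir_diff F w z" "dir_deriv F w z = l"
proof -
  show d: "dir_diff F w z" using assms by (auto simp: dir_diff_def)
  show "dir_deriv F w z = l"
    using tendsto_unique[OF _ dir_diff_tendsto[OF d] assms] by simp
qed

lemma Lipschitz_quotient_bound:
  fixes F :: "'a::real_normed_vector \<Rightarrow> real"
  assumes "K-lipschitz_on UNIV F"
  shows "\<bar>(F (z + t *\<^sub>R w) - F z) / t\<bar> \<le> K * norm w"
proof (cases "t = 0")
  case True
  then show ?thesis using lipschitz_on_nonneg[OF assms] by simp
next
  case False
  have "\<bar>F (z + t *\<^sub>R w) - F z\<bar> \<le> K * (\<bar>t\<bar> * norm w)"
    using lipschitz_onD[OF assms, of "z + t *\<^sub>R w" z] by (simp add: dist_norm)
  then show ?thesis using False by (simp add: abs_divide divide_le_eq mult_ac)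
qed

lemma Lipschitz_dq_bound:
  fixes F :: "'a::real_normed_vector \<Rightarrow> real"
  assumes "K-lipschitz_on UNIV F"
  shows "\<bar>dq F w n z\<bar> \<le> K * norm w"
  unfolding dq_def using assms by (rule Lipschitz_quotient_bound)

lemma Lipschitz_dir_deriv_bound:
  fixes F :: "'a::real_normed_vector \<Rightarrow> real"
  assumes lip: "K-lipschitz_on UNIV F" and "dir_diff F w z"
  shows "\<bar>dir_deriv F w z\<bar> \<le> K * norm w"
  using dir_diff_dq_tendsto[OF assms(2), THEN tendsto_rabs]
  by (rule LIMSEQ_le_const2) (use Lipschitz_dq_bound[OF lip] in auto)

lemma dir_deriv_scaleR:
  assumes "dir_diff F w z"
  shows "dir_diff F (c *\<^sub>R w) z" "dir_deriv F (c *\<^sub>R w) z = c * dir_deriv F w z"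
proof -
  have "((\<lambda>t. (F (z + t *\<^sub>R c *\<^sub>R w) - F z) / t) \<longlongrightarrow> c * dir_deriv F w z) (at 0)"
  proof (cases "c = 0")
    case False
    have "filterlim (\<lambda>t. t * c) (at 0) (at 0)"
      using False by (auto simp: filterlim_at eventually_at_filter intro!: tendsto_eq_intros)
    from filterlim_compose[OF dir_diff_tendsto[OF assms] this]
    have "((\<lambda>t. c * ((F (z + (t * c) *\<^sub>R w) - F z) / (t * c))) \<longlongrightarrow> c * dir_deriv F w z) (at 0)"
      by (rule tendsto_mult_left)
    then show ?thesis using False by simp
  qed simp
  from dir_deriv_eqI[OF this] show "dir_diff F (c *\<^sub>R w) z" "dir_deriv F (c *\<^sub>R w) z = c * dir_deriv F w z" by auto
qed

context
  fixes F :: "'a::euclidean_space \<Rightarrow> real" and K :: real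
  assumes lip: "K-lipschitz_on UNIV F"
begin

lemma Lipschitz_measurable: "F \<in> borel_measurable borel"
  using lipschitz_on_continuous_on[OF lip] by (rule borel_measurable_continuous_onI)

lemma dq_measurable: "dq F w n \<in> borel_measurable borel"
proof -
  note [measurable] = Lipschitz_measurable
  show ?thesis unfolding dq_def[abs_def] by measurable
qed

lemma dir_deriv_measurable: "dir_deriv F w \<in> borel_measurable borel"
  unfolding dir_deriv_def[abs_def] using dq_measurable by (intro borel_measurable_lim_metric)

text \<open>Substitution moves the vanishing shift from the difference quotient, which need not be
  continuous in the limit, to the indicator of the box. That indicator converges off the frontier of
  the box, a null set, and dominated convergence applies.\<close>

lemma box_integral_dq_shift:
  assumes c: "c \<longlonglongrightarrow> 0"
  shows "(\<lambda>n. \<integral>z. indicator (box a b) z * dq F w n (c n + z) \<partial>lborel)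
    \<longlonglongrightarrow> (\<integral>z. indicator (box a b) z * dir_deriv F w z \<partial>lborel)"
proof -
  note [measurable] = dq_measurable dir_deriv_measurable
  obtain r where r: "box a b \<subseteq> ball 0 r" "r > 0"
    using bounded_subset_ballD[OF bounded_box, of a b 0] by auto
  have shift: "(\<integral>z. indicator (box a b) z * dq F w n (c n + z) \<partial>lborel)
      = (\<integral>z. indicator (box a b) (z - c n) * dq F w n z \<partial>lborel)" for n
    by (subst (2) lborel_distr_plus[of "c n", symmetric]) (simp add: integral_distr)
  obtain R where R: "\<And>n. norm (c n) \<le> R"
    using convergent_imp_Bseq[OF convergentI[OF c]] by (auto simp: Bseq_def)
  have "(\<lambda>n. \<integral>z. indicator (box a b) (z - c n) * dq F w n z \<partial>lborel)
      \<longlonglongrightarrow> (\<integral>z. indicator (box a b) z * dir_deriv F w z \<partial>lborel)"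
  proof (rule integral_dominated_convergence[where w="\<lambda>z. indicator (ball 0 (r + R + 1)) z * (K * norm w)"])
    show "integrable lborel (\<lambda>z. indicator (ball (0::'a) (r + R + 1)) z * (K * norm w))"
      using emeasure_bounded_finite[OF bounded_ball, of "0::'a" "r + R + 1"]
      by (intro integrable_mult_left integrable_real_indicator) auto
    have "frontier (box a b) \<in> null_sets lborel"
    proof -
      have "negligible (frontier (box a b))"
        by (simp add: negligible_convex_frontier)
      then show ?thesis by (simp add: negligible_iff_null_sets null_sets_completion_iff)
    qed
    from AE_not_in[OF this] Lipschitz_AE_dir_diff[OF lip, of w]
    show "AE z in lborel. (\<lambda>n. indicator (box a b) (z - c n) * dq F w n z) \<longlonglongrightarrow> indicator (box a b) z * dir_deriv F w z"
    proof eventually_elim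
      case (elim z)
      have lim: "(\<lambda>n. z - c n) \<longlonglongrightarrow> z" using c by (auto intro!: tendsto_eq_intros)
      have "eventually (\<lambda>n. indicator (box a b) (z - c n) = (indicator (box a b) z :: real)) sequentially"
      proof (cases "z \<in> box a b")
        case True
        then show ?thesis using topological_tendstoD[OF lim open_box True]
          by (auto elim!: eventually_mono)
      next
        case False
        with elim(1) have "z \<in> - closure (box a b)" by (simp add: frontier_def interior_open[OF open_box])
        then have "eventually (\<lambda>n. z - c n \<in> - closure (box a b)) sequentially"
          using topological_tendstoD[OF lim, of "- closure (box a b)"] by auto
        then show ?thesis
          by eventually_elim (use False closure_subset[of "box a b"] in \<open>auto simp: indicator_def\<close>)
      qed
      then have "(\<lambda>n. indicator (box a b) (z - c n) :: real) \<longlonglongrightarrow> indicator (box a b) z"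
        by (rule tendsto_eventually)
      then show ?case by (intro tendsto_mult dir_diff_dq_tendsto elim)
    qed
    fix n
    show "AE z in lborel. norm (indicator (box a b) (z - c n) * dq F w n z) \<le> indicator (ball 0 (r + R + 1)) z * (K * norm w)"
    proof (rule AE_I2)
      fix z
      have q: "\<bar>dq F w n z\<bar> \<le> K * norm w" by (rule Lipschitz_dq_bound[OF lip])
      have "norm z < r + R + 1" if "z - c n \<in> box a b"
      proof -
        have "norm (z - c n) < r" using that r by auto
        then show ?thesis using R[of n] norm_triangle_sub[of z "c n"] by linarith
      qed
      then show "norm (indicator (box a b) (z - c n) * dq F w n z) \<le> indicator (ball 0 (r + R + 1)) z * (K * norm w)"
        using q by (auto simp: indicator_def)
    qed
  qed measurable
  then show ?thesis by (simp add: shift)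
qed

text \<open>
  The difference quotient for \<open>w + w'\<close> is the one for \<open>w\<close> plus a translate of the one for \<open>w'\<close>; translation
  disappears in the limit after integration over a box.
\<close>

lemma AE_dir_deriv_add:
  "AE z in lborel. dir_deriv F (w + w') z = dir_deriv F w z + dir_deriv F w' z"
proof -
  note [measurable] = dq_measurable dir_deriv_measurable sets_dir_diff[OF lipschitz_on_continuous_on[OF lip]]
  define G where "G = {z. dir_diff F (w + w') z} \<inter> {z. dir_diff F w z} \<inter> {z. dir_diff F w' z}"
  have G[measurable]: "G \<in> sets borel"
    using sets_dir_diff[OF lipschitz_on_continuous_on[OF lip]] by (auto simp: G_def)
  have AEG: "AE z in lborel. z \<in> G"
    using Lipschitz_AE_dir_diff[OF lip, of "w + w'"] Lipschitz_AE_dir_diff[OF lip, of w] Lipschitz_AE_dir_diff[OF lip, of w']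
    by eventually_elim (auto simp: G_def)
  \<comment> \<open>The indicator of G makes the bound on h hold at every point, as
    \<open>AE_eq_0_if_box_integrals_0\<close> requires.\<close>
  define h where "h z = indicator G z * (dir_deriv F (w + w') z - dir_deriv F w z - dir_deriv F w' z)" for z
  have hm: "h \<in> borel_measurable borel" unfolding h_def[abs_def] by measurable
  have K: "K \<ge> 0" using lip by (rule lipschitz_on_nonneg)
  have int: "integrable lborel (\<lambda>z. indicator (box a b) z * dq F v n (c + z))"
    and intD: "integrable lborel (\<lambda>z. indicator (box a b) z * dir_deriv F v z)" for a b v n c
  proof -
    have i: "integrable lborel (\<lambda>z. indicator (box a b) z * (K * norm v))"
      using emeasure_bounded_finite[OF bounded_box, of a b]
      by (intro integrable_mult_left integrable_real_indicator) auto
    show "integrable lborel (\<lambda>z. indicator (box a b) z * dq F v n (c + z))"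
    proof (rule Bochner_Integration.integrable_bound[OF i])
      show "AE z in lborel. norm (indicator (box a b) z * dq F v n (c + z)) \<le> norm (indicator (box a b) z * (K * norm v))"
        using K Lipschitz_dq_bound[OF lip] by (intro AE_I2) (auto simp: indicator_def)
    qed measurable
    have "AE z in lborel. norm (indicator (box a b) z * dir_deriv F v z) \<le> norm (indicator (box a b) z * (K * norm v))"
      using Lipschitz_AE_dir_diff[OF lip, of v]
      by eventually_elim (use Lipschitz_dir_deriv_bound[OF lip] K in \<open>auto simp: indicator_def\<close>)
    then show "integrable lborel (\<lambda>z. indicator (box a b) z * dir_deriv F v z)"
      by (intro Bochner_Integration.integrable_bound[OF i]) auto
  qed
  have "AE z in lborel. h z = 0"
  proof (rule AE_eq_0_if_box_integrals_0[OF hm])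
    show "\<bar>h z\<bar> \<le> K * norm (w + w') + K * norm w + K * norm w'" for z
    proof (cases "z \<in> G")
      case True
      then show ?thesis
        using Lipschitz_dir_deriv_bound[OF lip, of "w + w'" z] Lipschitz_dir_deriv_bound[OF lip, of w z]
          Lipschitz_dir_deriv_bound[OF lip, of w' z] by (auto simp: h_def G_def)
    qed (use K in \<open>auto simp: h_def\<close>)
    fix a b :: 'a
    let ?I = "\<lambda>g. \<integral>z. indicator (box a b) z * g z \<partial>lborel"
    have eq: "?I (dq F (w + w') n) = ?I (\<lambda>z. dq F w' n ((1 / real (Suc n)) *\<^sub>R w + z)) + ?I (dq F w n)" for n
    proof -
      have "dq F (w + w') n z = dq F w' n ((1 / real (Suc n)) *\<^sub>R w + z) + dq F w n z" for z
        by (simp add: dq_def algebra_simps add_divide_distrib[symmetric] diff_divide_distrib[symmetric])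
      then show ?thesis using int[of a b w n 0] int[of a b w' n "(1 / real (Suc n)) *\<^sub>R w"]
        by (simp add: distrib_left)
    qed
    have c: "(\<lambda>n. (1 / real (Suc n)) *\<^sub>R w) \<longlonglongrightarrow> 0"
      using tendsto_scaleR[OF LIMSEQ_inverse_real_of_nat tendsto_const[of w]] by (simp add: inverse_eq_divide)
    have l1: "(\<lambda>n. ?I (dq F v n)) \<longlonglongrightarrow> ?I (dir_deriv F v)" for v
      using box_integral_dq_shift[OF tendsto_const[of 0], where w=v] by simp
    have "(\<lambda>n. ?I (dq F (w + w') n)) \<longlonglongrightarrow> ?I (dir_deriv F w') + ?I (dir_deriv F w)"
      unfolding eq by (intro tendsto_add l1 box_integral_dq_shift[OF c])
    from LIMSEQ_unique[OF this l1] have "?I (dir_deriv F (w + w')) = ?I (dir_deriv F w') + ?I (dir_deriv F w)" by simp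
    moreover have "?I h = ?I (\<lambda>z. dir_deriv F (w + w') z - dir_deriv F w z - dir_deriv F w' z)"
      by (rule integral_cong_AE) (use AEG in \<open>auto simp: h_def hm elim!: eventually_mono\<close>)
    ultimately show "?I h = 0" using intD by (simp add: right_diff_distrib)
  qed
  with AEG show ?thesis by eventually_elim (auto simp: h_def)
qed

lemma AE_dir_deriv_linear:
  "AE z in lborel. dir_deriv F w z = (\<Sum>b\<in>Basis. (w \<bullet> b) * dir_deriv F b z)"
proof -
  have "AE z in lborel. dir_deriv F (\<Sum>b\<in>S. (w \<bullet> b) *\<^sub>R b) z = (\<Sum>b\<in>S. (w \<bullet> b) * dir_deriv F b z)"
    if "finite S" for S
    using that
  proof induction
    case empty
    have "((\<lambda>t. (F (z + t *\<^sub>R 0) - F z) / t) \<longlongrightarrow> 0) (at 0)" for z by simp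
    from dir_deriv_eqI(2)[OF this] show ?case by simp
  next
    case (insert x S)
    from insert.IH Lipschitz_AE_dir_diff[OF lip, of x] AE_dir_deriv_add[of "(w \<bullet> x) *\<^sub>R x" "\<Sum>b\<in>S. (w \<bullet> b) *\<^sub>R b"]
    show ?case by eventually_elim (simp add: insert dir_deriv_scaleR)
  qed
  from this[OF finite_Basis] show ?thesis by (simp add: euclidean_representation)
qed

text \<open>A countable dense set of directions has one common exceptional null set. Off it,
  quotients and candidate derivative are both Lipschitz in the direction, so convergence spreads to
  all directions.\<close>

theorem Rademacher_Gateaux:
  "AE z in lborel. \<exists>A. linear A \<and> (\<forall>w. ((\<lambda>t. (F (z + t *\<^sub>R w) - F z) / t) \<longlongrightarrow> A w) (at 0))"
proof -
  have K: "K \<ge> 0" using lip by (rule lipschitz_on_nonneg)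
  obtain W :: "'a set" where W: "countable W" "\<And>X. open X \<Longrightarrow> X \<noteq> {} \<Longrightarrow> \<exists>d\<in>W. d \<in> X"
    using countable_dense_exists[where 'a='a] by blast
  have "AE z in lborel. \<forall>w\<in>W. dir_diff F w z \<and> dir_deriv F w z = (\<Sum>b\<in>Basis. (w \<bullet> b) * dir_deriv F b z)"
    unfolding AE_ball_countable[OF W(1)] using Lipschitz_AE_dir_diff[OF lip] AE_dir_deriv_linear by auto
  then show ?thesis
  proof eventually_elim
    case (elim z)
    define A where "A w = (\<Sum>b\<in>Basis. (w \<bullet> b) * dir_deriv F b z)" for w
    have lin: "linear A"
      unfolding A_def[abs_def]
      by (rule linearI) (simp_all add: inner_add_left distrib_right sum.distrib sum_distrib_left mult.assoc)
    then obtain B where B: "\<And>w. \<bar>A w\<bar> \<le> B * norm w" "B > 0"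
      using linear_bounded_pos[OF lin] by auto
    have "((\<lambda>t. (F (z + t *\<^sub>R w) - F z) / t) \<longlongrightarrow> A w) (at 0)" for w
    proof (rule tendstoI)
      fix e :: real assume e: "e > 0"
      \<comment> \<open>Replacing w by v changes the quotient by at most K |w - v| and A by at most
        B |w - v|; together this stays below e/2.\<close>
      define d where "d = e / (2 * (K + B))"
      have KB: "K + B > 0" using K B by linarith
      have d: "d > 0" using e KB by (simp add: d_def)
      obtain v where v: "v \<in> W" "v \<in> ball w d" using W(2)[of "ball w d"] d by auto
      have "((\<lambda>t. (F (z + t *\<^sub>R v) - F z) / t) \<longlongrightarrow> A v) (at 0)"
        using dir_diff_tendsto[of F v z] elim v by (auto simp: A_def)
      then have "eventually (\<lambda>t. dist ((F (z + t *\<^sub>R v) - F z) / t) (A v) < e / 2) (at 0)"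
        using e by (intro tendstoD) auto
      then show "eventually (\<lambda>t. dist ((F (z + t *\<^sub>R w) - F z) / t) (A w) < e) (at 0)"
      proof eventually_elim
        case (elim t)
        have "\<bar>F (z + t *\<^sub>R w) - F (z + t *\<^sub>R v)\<bar> \<le> K * (\<bar>t\<bar> * norm (w - v))"
          using lipschitz_onD[OF lip, of "z + t *\<^sub>R w" "z + t *\<^sub>R v"]
          by (simp add: dist_norm scaleR_diff_right[symmetric])
        then have "\<bar>(F (z + t *\<^sub>R w) - F (z + t *\<^sub>R v)) / t\<bar> \<le> K * norm (w - v)"
          using K by (cases "t = 0") (auto simp: abs_divide divide_le_eq mult_ac)
        moreover have "\<bar>A w - A v\<bar> \<le> B * norm (w - v)"
          using B(1)[of "w - v"] lin by (simp add: linear_diff)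
        moreover have "(F (z + t *\<^sub>R w) - F z) / t - A w =
          (F (z + t *\<^sub>R w) - F (z + t *\<^sub>R v)) / t + ((F (z + t *\<^sub>R v) - F z) / t - A v) - (A w - A v)"
          by (simp add: diff_divide_distrib)
        moreover have "K * norm (w - v) + B * norm (w - v) < e / 2"
        proof -
          have "(K + B) * norm (w - v) < (K + B) * d" using v KB by (simp add: dist_norm)
          also have "\<dots> = e / 2" unfolding d_def using KB by (simp add: nonzero_divide_eq_eq)
          finally show ?thesis by (simp add: distrib_right)
        qed
        ultimately show ?case using elim unfolding dist_real_def by linarith
      qed
    qed
    then show ?case using lin by blast
  qed
qed

end

text \<open>In dimension at least two the segment is itself a null set. Integrating F over
  translates of the segment by a small ball gives a differentiable function \<Phi> of the parameter
  whose derivative sees only almost every point; the mean value theorem bounds its increment, and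
  the Lipschitz property bounds the cost of the averaging.\<close>

lemma increment_le_if_AE_dir_deriv_le:
  fixes F :: "'a::euclidean_space \<Rightarrow> real"
  assumes lip: "K-lipschitz_on UNIV F" and G: "open G" "closed_segment x (x + w) \<subseteq> G"
    and le: "AE z in lborel. z \<in> G \<longrightarrow> dir_deriv F w z \<le> M"
  shows "F (x + w) - F x \<le> M"
proof (rule ccontr)
  assume "\<not> F (x + w) - F x \<le> M"
  then have gap: "M < F (x + w) - F x" by simp
  have K: "K \<ge> 0" using lip by (rule lipschitz_on_nonneg)
  have cont: "continuous_on UNIV F" using lip by (rule lipschitz_on_continuous_on)
  note [measurable] = Lipschitz_measurable[OF lip] dir_deriv_measurable[OF lip]
  obtain d1 where d1: "d1 > 0" "(\<Union>y\<in>closed_segment x (x + w). ball y d1) \<subseteq> G"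
    using compact_subset_open_imp_ball_epsilon_subset[OF compact_segment G(1) G(2)] by auto
  define e where "e = (F (x + w) - F x - M) / 2"
  have e: "e > 0" using gap by (simp add: e_def)
  \<comment> \<open>The first bound keeps the translated segments inside G, the second keeps the
    averaging cost 2 K d below half of the assumed gap; adding 1 covers K = 0.\<close>
  define d where "d = min d1 (e / (2 * K + 1))"
  have d: "d > 0" "d \<le> d1" using d1 e K by (auto simp: d_def)
  have Kd: "2 * K * d \<le> e"
  proof -
    have "2 * K * d \<le> 2 * K * (e / (2 * K + 1))" using K by (intro mult_left_mono) (auto simp: d_def)
    also have "\<dots> \<le> e" using K e by (simp add: field_simps)
    finally show ?thesis .
  qed
  define B where "B = (\<lambda>y::'a. indicator (ball 0 d) y :: real)"
  have Bint: "integrable lborel (\<lambda>y. B y * c)" for c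
    using emeasure_bounded_finite[OF bounded_ball, of "0::'a" d]
    unfolding B_def by (intro integrable_mult_left integrable_real_indicator) auto
  have Bm[measurable]: "B \<in> borel_measurable borel" unfolding B_def by (intro borel_measurable_indicator) auto
  have vol: "0 < (\<integral>y. B y \<partial>lborel)"
    using d(1) content_ball_pos[of d "0::'a"] by (simp add: B_def)
  define \<Phi> where "\<Phi> t = (\<integral>y. B y * F (x + t *\<^sub>R w + y) \<partial>lborel)" for t
  have intF: "integrable lborel (\<lambda>y. B y * F (x + t *\<^sub>R w + y))" for t
  proof (rule Bochner_Integration.integrable_bound[OF Bint[of "\<bar>F (x + t *\<^sub>R w)\<bar> + K * d"]])
    show "AE y in lborel. norm (B y * F (x + t *\<^sub>R w + y)) \<le> norm (B y * (\<bar>F (x + t *\<^sub>R w)\<bar> + K * d))"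
    proof (rule AE_I2)
      fix y
      have "\<bar>F (x + t *\<^sub>R w + y)\<bar> \<le> \<bar>F (x + t *\<^sub>R w)\<bar> + K * d" if "norm y < d"
      proof -
        have "\<bar>F (x + t *\<^sub>R w + y) - F (x + t *\<^sub>R w)\<bar> \<le> K * norm y"
          using lipschitz_onD[OF lip, of "x + t *\<^sub>R w + y" "x + t *\<^sub>R w"] by (simp add: dist_norm)
        also have "\<dots> \<le> K * d" using K that by (intro mult_left_mono) auto
        finally show ?thesis by linarith
      qed
      then show "norm (B y * F (x + t *\<^sub>R w + y)) \<le> norm (B y * (\<bar>F (x + t *\<^sub>R w)\<bar> + K * d))"
        using K d by (auto simp: B_def indicator_def)
    qed
  qed measurable
  have deriv: "(\<Phi> has_real_derivative (\<integral>y. B y * dir_deriv F w (x + t *\<^sub>R w + y) \<partial>lborel)) (at t)" for t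
  proof -
    have "((\<lambda>h. (\<Phi> (t + h) - \<Phi> t) / h) \<longlongrightarrow> (\<integral>y. B y * dir_deriv F w (x + t *\<^sub>R w + y) \<partial>lborel)) (at 0)"
      unfolding tendsto_at_iff_sequentially comp_def
    proof (intro allI impI)
      fix X :: "nat \<Rightarrow> real" assume X: "\<forall>i. X i \<in> UNIV - {0}" "X \<longlonglongrightarrow> 0"
      define q where "q n y = (F (x + t *\<^sub>R w + y + X n *\<^sub>R w) - F (x + t *\<^sub>R w + y)) / X n" for n y
      have "(\<lambda>n. \<integral>y. B y * q n y \<partial>lborel) \<longlonglongrightarrow> (\<integral>y. B y * dir_deriv F w (x + t *\<^sub>R w + y) \<partial>lborel)"
      proof (rule integral_dominated_convergence[OF _ _ Bint[of "K * norm w"]])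
        have XF: "filterlim X (at 0) sequentially" using X by (auto simp: filterlim_at)
        show "AE y in lborel. (\<lambda>n. B y * q n y) \<longlonglongrightarrow> B y * dir_deriv F w (x + t *\<^sub>R w + y)"
          using AE_lborel_translate[OF Lipschitz_AE_dir_diff[OF lip, of w], of "x + t *\<^sub>R w"]
        proof eventually_elim
          case (elim y)
          from filterlim_compose[OF dir_diff_tendsto[OF elim] XF] show ?case
            unfolding q_def by (intro tendsto_intros)
        qed
        show "AE y in lborel. norm (B y * q n y) \<le> B y * (K * norm w)" for n
          using Lipschitz_quotient_bound[OF lip] by (intro AE_I2) (auto simp: B_def indicator_def q_def)
        show "(\<lambda>y. B y * q n y) \<in> borel_measurable lborel" for n unfolding q_def by measurable
      qed measurable
      moreover have "(\<integral>y. B y * q n y \<partial>lborel) = (\<Phi> (t + X n) - \<Phi> t) / X n" for n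
      proof -
        have "B y * q n y = (B y * F (x + (t + X n) *\<^sub>R w + y) - B y * F (x + t *\<^sub>R w + y)) / X n" for y
          by (simp add: q_def algebra_simps diff_divide_distrib)
        then show ?thesis by (simp add: \<Phi>_def intF)
      qed
      ultimately show "(\<lambda>n. (\<Phi> (t + X n) - \<Phi> t) / X n) \<longlonglongrightarrow> (\<integral>y. B y * dir_deriv F w (x + t *\<^sub>R w + y) \<partial>lborel)"
        by simp
    qed
    then show ?thesis by (simp add: DERIV_def)
  qed
  have slope: "(\<integral>y. B y * dir_deriv F w (x + t *\<^sub>R w + y) \<partial>lborel) \<le> (\<integral>y. B y * M \<partial>lborel)" if t: "0 < t" "t < 1" for t
  proof (rule integral_mono_AE)
    have AE1: "AE y in lborel. dir_diff F w (x + t *\<^sub>R w + y) \<and> (x + t *\<^sub>R w + y \<in> G \<longrightarrow> dir_deriv F w (x + t *\<^sub>R w + y) \<le> M)"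
      using AE_lborel_translate[OF Lipschitz_AE_dir_diff[OF lip, of w], of "x + t *\<^sub>R w"]
        AE_lborel_translate[OF le, of "x + t *\<^sub>R w"] by eventually_elim auto
    then have "AE y in lborel. norm (B y * dir_deriv F w (x + t *\<^sub>R w + y)) \<le> norm (B y * (K * norm w))"
      by eventually_elim (use Lipschitz_dir_deriv_bound[OF lip] K in \<open>auto simp: B_def indicator_def\<close>)
    then show "integrable lborel (\<lambda>y. B y * dir_deriv F w (x + t *\<^sub>R w + y))"
      by (intro Bochner_Integration.integrable_bound[OF Bint[of "K * norm w"]]) auto
    show "integrable lborel (\<lambda>y. B y * M)" by (rule Bint)
    have "x + t *\<^sub>R w \<in> closed_segment x (x + w)"
      using t by (auto simp: in_segment algebra_simps intro!: exI[of _ t])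
    then have inG: "x + t *\<^sub>R w + y \<in> G" if "norm y < d" for y
      using d1(2) that d(2) by (force simp: dist_norm)
    from AE1 show "AE y in lborel. B y * dir_deriv F w (x + t *\<^sub>R w + y) \<le> B y * M"
      by eventually_elim (use inG in \<open>auto simp: B_def indicator_def\<close>)
  qed
  obtain t where t: "0 < t" "t < 1" "\<Phi> 1 - \<Phi> 0 = (1 - 0) * (\<integral>y. B y * dir_deriv F w (x + t *\<^sub>R w + y) \<partial>lborel)"
    using MVT2[of 0 1 \<Phi> "\<lambda>t. \<integral>y. B y * dir_deriv F w (x + t *\<^sub>R w + y) \<partial>lborel"] deriv by auto
  have "(\<integral>y. B y * (M + e) \<partial>lborel) \<le> \<Phi> 1 - \<Phi> 0"
  proof -
    have "\<Phi> 1 - \<Phi> 0 = (\<integral>y. B y * F (x + 1 *\<^sub>R w + y) - B y * F (x + 0 *\<^sub>R w + y) \<partial>lborel)"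
      using intF[of 1] intF[of 0] by (simp add: \<Phi>_def)
    moreover have "B y * (M + e) \<le> B y * F (x + 1 *\<^sub>R w + y) - B y * F (x + 0 *\<^sub>R w + y)" for y
    proof (cases "norm y < d")
      case True
      have "\<bar>F (x + w + y) - F (x + w)\<bar> \<le> K * norm y" "\<bar>F (x + y) - F x\<bar> \<le> K * norm y"
        using lipschitz_onD[OF lip, of "x + w + y" "x + w"] lipschitz_onD[OF lip, of "x + y" x] by (auto simp: dist_norm)
      moreover have "2 * (K * norm y) \<le> 2 * K * d" using K True by (simp add: mult_left_mono)
      ultimately have "M + e \<le> F (x + w + y) - F (x + y)" using Kd by (simp add: e_def field_simps)
      then show ?thesis using True by (simp add: B_def)
    qed (simp add: B_def)
    moreover have "(\<integral>y. B y * (M + e) \<partial>lborel) \<le> (\<integral>y. B y * F (x + 1 *\<^sub>R w + y) - B y * F (x + 0 *\<^sub>R w + y) \<partial>lborel)"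
      using calculation(2) by (intro integral_mono Bint Bochner_Integration.integrable_diff intF)
    ultimately show ?thesis by linarith
  qed
  also have "\<dots> \<le> (\<integral>y. B y * M \<partial>lborel)" using t slope[OF t(1,2)] by simp
  finally have "(\<integral>y. B y \<partial>lborel) * (M + e) \<le> (\<integral>y. B y \<partial>lborel) * M" by simp
  with vol e show False by (simp add: mult_le_cancel_left)
qed

subsection \<open>Convex potentials\<close>

text \<open>The subgradient inequalities at u and at u + h d squeeze the remainder of the
  first-order expansion between 0 and k |d|^2 h^2. The lemma serves both potentials of the proof:
  \<open>p\<close> with gradient \<open>P\<close>, and the conjugate of f with the argmin map as
  gradient.\<close>

lemma subgradient_line_derivative:
  fixes G :: "'a::real_inner \<Rightarrow> real" and M :: "'a \<Rightarrow> 'a"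
  assumes S: "open S" "u \<in> S"
    and sub: "\<And>u u'. u \<in> S \<Longrightarrow> u' \<in> S \<Longrightarrow> G u + M u \<bullet> (u' - u) \<le> G u'"
    and mono: "\<And>u u'. u \<in> S \<Longrightarrow> u' \<in> S \<Longrightarrow> (M u' - M u) \<bullet> (u' - u) \<le> k * (norm (u' - u))\<^sup>2"
  shows "((\<lambda>h. G (u + h *\<^sub>R d)) has_real_derivative M u \<bullet> d) (at 0)"
proof -
  obtain e where e: "e > 0" "ball u e \<subseteq> S" using openE[OF S] by blast
  have "((\<lambda>h. norm (h *\<^sub>R d)) \<longlongrightarrow> 0) (at (0::real))" by (auto intro!: tendsto_eq_intros)
  then have "eventually (\<lambda>h. norm (h *\<^sub>R d) < e) (at (0::real))" using e(1) by (rule order_tendstoD)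
  moreover have "eventually (\<lambda>h::real. h \<noteq> 0) (at 0)" by (simp add: eventually_at_filter)
  ultimately have "eventually (\<lambda>h. norm ((G (u + h *\<^sub>R d) - G u) / h - M u \<bullet> d) \<le> \<bar>k * (norm d)\<^sup>2 * h\<bar>) (at 0)"
  proof eventually_elim
    case (elim h)
    let ?y = "u + h *\<^sub>R d"
    have y: "?y \<in> S" using elim(1) e(2) by (auto simp: dist_norm)
    have 1: "0 \<le> G ?y - G u - h * (M u \<bullet> d)"
      using sub[OF S(2) y] by simp
    have "G ?y - G u \<le> h * (M ?y \<bullet> d)"
      using sub[OF y S(2)] by simp
    moreover have "h * (M ?y \<bullet> d) - h * (M u \<bullet> d) \<le> k * (norm d)\<^sup>2 * h\<^sup>2"
      using mono[OF S(2) y] by (simp add: inner_diff_left power_mult_distrib algebra_simps)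
    ultimately have 2: "G ?y - G u - h * (M u \<bullet> d) \<le> k * (norm d)\<^sup>2 * h\<^sup>2" by linarith
    have "\<bar>(G ?y - G u) / h - M u \<bullet> d\<bar> * \<bar>h\<bar> = \<bar>G ?y - G u - h * (M u \<bullet> d)\<bar>"
      using elim(2) unfolding abs_mult[symmetric] left_diff_distrib by (simp add: mult.commute)
    also have "\<dots> \<le> \<bar>k * (norm d)\<^sup>2 * h\<bar> * \<bar>h\<bar>"
      using 1 2 by (simp add: abs_mult[symmetric] power2_eq_square mult.assoc)
    finally show ?case using elim(2) by simp
  qed
  moreover have "((\<lambda>h. \<bar>k * (norm d)\<^sup>2 * h\<bar>) \<longlongrightarrow> 0) (at 0)" by (auto intro!: tendsto_eq_intros)
  ultimately have "((\<lambda>h. (G (u + h *\<^sub>R d) - G u) / h - M u \<bullet> d) \<longlongrightarrow> 0) (at 0)"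
    by (rule Lim_null_comparison)
  then have "((\<lambda>h. (G (u + h *\<^sub>R d) - G u) / h) \<longlongrightarrow> M u \<bullet> d) (at 0)" by (rule LIM_zero_cancel)
  then show ?thesis by (simp add: DERIV_def)
qed

lemma subgradient_line_derivative_at:
  fixes G :: "'a::real_inner \<Rightarrow> real" and M :: "'a \<Rightarrow> 'a"
  assumes S: "open S" "u + s *\<^sub>R d \<in> S"
    and sub: "\<And>u u'. u \<in> S \<Longrightarrow> u' \<in> S \<Longrightarrow> G u + M u \<bullet> (u' - u) \<le> G u'"
    and mono: "\<And>u u'. u \<in> S \<Longrightarrow> u' \<in> S \<Longrightarrow> (M u' - M u) \<bullet> (u' - u) \<le> k * (norm (u' - u))\<^sup>2"
  shows "((\<lambda>s. G (u + s *\<^sub>R d)) has_real_derivative M (u + s *\<^sub>R d) \<bullet> d) (at s)"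
  using subgradient_line_derivative[where G=G and M=M and d=d, OF S sub mono]
  by (simp add: DERIV_def algebra_simps)

text \<open>Descent lemma: subtracting the right-hand side along the segment leaves a function
  \<psi> whose derivative is non-positive by \<open>mono\<close>.\<close>

lemma subgradient_quadratic_upper:
  fixes G :: "'a::real_inner \<Rightarrow> real" and M :: "'a \<Rightarrow> 'a"
  assumes S: "open S" "convex S"
    and sub: "\<And>u u'. u \<in> S \<Longrightarrow> u' \<in> S \<Longrightarrow> G u + M u \<bullet> (u' - u) \<le> G u'"
    and mono: "\<And>u u'. u \<in> S \<Longrightarrow> u' \<in> S \<Longrightarrow> (M u' - M u) \<bullet> (u' - u) \<le> k * (norm (u' - u))\<^sup>2"
    and u: "u \<in> S" "u' \<in> S"
  shows "G u' \<le> G u + M u \<bullet> (u' - u) + k / 2 * (norm (u' - u))\<^sup>2"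
proof -
  define d where "d = u' - u"
  define \<psi> where "\<psi> s = G (u + s *\<^sub>R d) - s * (M u \<bullet> d) - k / 2 * (norm d)\<^sup>2 * s\<^sup>2" for s
  have seg: "u + s *\<^sub>R d \<in> S" if "0 \<le> s" "s \<le> 1" for s
    using convexD_alt[OF S(2) u that] by (simp add: d_def algebra_simps)
  have der: "DERIV \<psi> s :> M (u + s *\<^sub>R d) \<bullet> d - M u \<bullet> d - k * (norm d)\<^sup>2 * s" if s: "0 \<le> s" "s \<le> 1" for s
    unfolding \<psi>_def
    by (rule derivative_eq_intros subgradient_line_derivative_at[where G=G and M=M, OF S(1) seg[OF s] sub mono] refl | simp)+
  have "\<psi> 1 \<le> \<psi> 0"
  proof (rule DERIV_nonpos_imp_nonincreasing[of 0 1])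
    fix s :: real assume s: "0 \<le> s" "s \<le> 1"
    have "M (u + s *\<^sub>R d) \<bullet> d - M u \<bullet> d - k * (norm d)\<^sup>2 * s \<le> 0"
    proof (cases "s = 0")
      case False
      have "s * ((M (u + s *\<^sub>R d) - M u) \<bullet> d) \<le> s * (k * (norm d)\<^sup>2 * s)"
        using mono[OF u(1) seg[OF s]] by (simp add: power_mult_distrib power2_eq_square mult_ac)
      then show ?thesis using False s by (simp add: mult_le_cancel_left_pos inner_diff_left)
    qed simp
    then show "\<exists>y. DERIV \<psi> s :> y \<and> y \<le> 0" using der[OF s] by blast
  qed simp
  then show ?thesis by (simp add: \<psi>_def d_def)
qed

subsection \<open>Subgradients\<close>

lemma regular_subdiffI:
  fixes f :: "'a::euclidean_space \<Rightarrow> ereal"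
  assumes fin: "\<bar>f x\<bar> \<noteq> \<infinity>" and d: "d > 0" and c: "c \<ge> 0"
    and le: "\<And>y. dist y x < d \<Longrightarrow> f x + ereal (v \<bullet> (y - x) - c * (norm (y - x))\<^sup>2) \<le> f y"
  shows "v \<in> regular_subdiff f x"
proof -
  obtain a where a: "f x = ereal a" using fin by (cases "f x") auto
  have "0 \<le> Liminf (at x) (\<lambda>y. (f y - f x - ereal (v \<bullet> (y - x))) / ereal (norm (y - x)))"
    unfolding le_Liminf_iff
  proof (intro allI impI)
    fix b :: ereal assume b: "b < 0"
    obtain z where "b < ereal z" "z < 0" using ereal_dense2[OF b] by auto
    then obtain B where b': "b < ereal (- B)" "B > 0" by (metis minus_minus neg_less_0_iff_less)
    have "eventually (\<lambda>y. y \<in> ball x (min d (B / (c + 1))) - {x}) (at x)"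
      using b' d c by (intro eventually_at_in_open) auto
    then show "eventually (\<lambda>y. b < (f y - f x - ereal (v \<bullet> (y - x))) / ereal (norm (y - x))) (at x)"
    proof eventually_elim
      case (elim y)
      define n where "n = norm (y - x)"
      have n: "0 < n" "n < d" "n < B / (c + 1)" using elim by (auto simp: n_def dist_norm norm_minus_commute)
      have "- B \<le> - (c * n)"
      proof -
        have "c * n \<le> (c + 1) * n" using n by (simp add: algebra_simps)
        also have "\<dots> \<le> B" using n(3) c by (simp add: pos_less_divide_eq mult.commute)
        finally show ?thesis by simp
      qed
      moreover have "ereal (- (c * n)) \<le> (f y - f x - ereal (v \<bullet> (y - x))) / ereal n"
        using le[of y] n by (cases "f y")
          (auto simp: a n_def dist_norm norm_minus_commute field_simps power2_eq_square)
      ultimately show ?case using b'(1) unfolding n_def by (meson ereal_less_eq(3) less_le_trans order_trans)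
    qed
  qed
  with fin show ?thesis by (simp add: regular_subdiff_def)
qed

lemma regular_subdiff_subset_limiting: "regular_subdiff f x \<subseteq> limiting_subdiff f x"
proof
  fix v assume v: "v \<in> regular_subdiff f x"
  then have "\<exists>xs vs. xs \<longlonglongrightarrow> x \<and> (\<lambda>k. f (xs k)) \<longlonglongrightarrow> f x \<and> vs \<longlonglongrightarrow> v \<and> (\<forall>k::nat. vs k \<in> regular_subdiff f (xs k))"
    by (intro exI[where P="\<lambda>xs. \<exists>vs. _ xs vs" and x="\<lambda>_. x"] exI[where x="\<lambda>_. v"]) auto
  with v show "v \<in> limiting_subdiff f x" by (simp add: limiting_subdiff_def regular_subdiff_def)
qed

lemma limiting_subdiff_finite: "v \<in> limiting_subdiff f x \<Longrightarrow> \<bar>f x\<bar> \<noteq> \<infinity>"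
  by (simp add: limiting_subdiff_def)

subsection \<open>Localisation of a prox-regular function\<close>

text \<open>Subdifferential continuity has been spent here: the condition
  \<open>f x < f xbar + ereal \<epsilon>\<close> of prox-regularity is gone, at the price of a
  smaller radius \<delta> for the pairs (x, v). The constant r is positive so that 1/(2 r) is a
  legitimate proximal step.\<close>

locale prox_local =
  fixes f :: "'a::euclidean_space \<Rightarrow> ereal" and xbar :: 'a and \<epsilon> \<delta> r :: real
  assumes eps: "\<epsilon> > 0" and delta: "0 < \<delta>" "\<delta> \<le> \<epsilon>" and r: "r > 0"
    and fin: "\<bar>f xbar\<bar> \<noteq> \<infinity>"
    and closed_sublevel: "\<And>\<alpha>. \<alpha> \<le> f xbar + ereal \<epsilon> \<Longrightarrow> closed {x \<in> cball xbar \<epsilon>. f x \<le> \<alpha>}"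
    and zero: "0 \<in> limiting_subdiff f xbar"
    and prox: "\<And>x v x'. v \<in> limiting_subdiff f x \<Longrightarrow> dist xbar x \<le> \<delta> \<Longrightarrow> norm v \<le> \<delta> \<Longrightarrow> dist xbar x' \<le> \<epsilon> \<Longrightarrow>
      f x + ereal (v \<bullet> (x' - x) - r / 2 * (norm (x' - x))\<^sup>2) \<le> f x'"

lemma prox_local_exists:
  assumes pr: "prox_regular f xbar 0" and sc: "subdiff_continuous f xbar 0"
  shows "\<exists>\<epsilon> \<delta> r. prox_local f xbar \<epsilon> \<delta> r"
proof -
  obtain e1 where e1: "e1 > 0" "\<And>\<alpha>. \<alpha> \<le> f xbar + ereal e1 \<Longrightarrow> closed {x \<in> cball xbar e1. f x \<le> \<alpha>}"
    using pr by (auto simp: prox_regular_def locally_lsc_def)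
  have fin: "\<bar>f xbar\<bar> \<noteq> \<infinity>" and zero: "0 \<in> limiting_subdiff f xbar" using pr by (auto simp: prox_regular_def)
  obtain e2 r where e2: "e2 > 0" "r \<ge> 0" and pr2: "\<And>x v x'. (x, v) \<in> gph_subdiff f \<inter> cball (xbar, 0) e2 \<and> f x < f xbar + ereal e2
     \<Longrightarrow> x' \<in> cball xbar e2 \<Longrightarrow> f x' \<ge> f x + ereal (v \<bullet> (x' - x)) - ereal (r / 2 * (norm (x' - x))\<^sup>2)"
    using pr by (auto simp: prox_regular_def)
  have "\<exists>d>0. \<forall>x v. v \<in> limiting_subdiff f x \<and> dist xbar x \<le> d \<and> norm v \<le> d \<longrightarrow> f x < f xbar + ereal e2"
  proof (rule ccontr)
    assume "\<not> ?thesis"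
    then have "\<forall>n::nat. \<exists>x v. v \<in> limiting_subdiff f x \<and> dist xbar x \<le> 1 / Suc n \<and> norm v \<le> 1 / Suc n \<and> \<not> f x < f xbar + ereal e2"
      by (metis divide_pos_pos of_nat_0_less_iff zero_less_Suc zero_less_one)
    then obtain xs vs where xv: "\<And>n::nat. vs n \<in> limiting_subdiff f (xs n)" "\<And>n. dist xbar (xs n) \<le> 1 / Suc n"
       "\<And>n. norm (vs n) \<le> 1 / Suc n" "\<And>n. \<not> f (xs n) < f xbar + ereal e2"
      by metis
    have inv: "(\<lambda>n. 1 / real (Suc n)) \<longlonglongrightarrow> 0"
      using LIMSEQ_inverse_real_of_nat by (simp add: inverse_eq_divide)
    have "(\<lambda>n. dist (xs n) xbar) \<longlonglongrightarrow> 0"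
      by (rule tendsto_sandwich[OF _ _ tendsto_const inv]) (use xv(2) in \<open>auto simp: dist_commute\<close>)
    then have x: "xs \<longlonglongrightarrow> xbar" by (subst tendsto_dist_iff)
    have v: "vs \<longlonglongrightarrow> 0" by (rule Lim_null_comparison[OF _ inv]) (use xv(3) in auto)
    have "(\<lambda>k. f (xs k)) \<longlonglongrightarrow> f xbar" using sc x v xv(1) by (auto simp: subdiff_continuous_def)
    moreover have "f xbar < f xbar + ereal e2" using fin e2 by (cases "f xbar") auto
    ultimately have "eventually (\<lambda>k. f (xs k) < f xbar + ereal e2) sequentially"
      by (rule order_tendstoD)
    then show False using xv(4) by (simp add: eventually_sequentially)
  qed
  then obtain d where d: "d > 0" "\<And>x v. v \<in> limiting_subdiff f x \<Longrightarrow> dist xbar x \<le> d \<Longrightarrow> norm v \<le> d \<Longrightarrow> f x < f xbar + ereal e2"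
    by blast
  define e where "e = min e1 e2"
  have e: "e > 0" "e \<le> e1" "e \<le> e2" using e1 e2 by (auto simp: e_def)
  \<comment> \<open>Half of e, because the distance in the product space is estimated by the sum of
    the two component distances.\<close>
  define D where "D = min d (e / 2)"
  have "prox_local f xbar e D (r + 1)"
  proof
    show "0 < e" "0 < D" "D \<le> e" "r + 1 > 0" using e d e2 by (auto simp: D_def)
    show "\<bar>f xbar\<bar> \<noteq> \<infinity>" "0 \<in> limiting_subdiff f xbar" by fact+
    fix \<alpha> assume "\<alpha> \<le> f xbar + ereal e"
    also have "\<dots> \<le> f xbar + ereal e1" using e by (intro add_left_mono) auto
    finally have "closed (cball xbar e \<inter> {x \<in> cball xbar e1. f x \<le> \<alpha>})" using e1 by (intro closed_Int) auto
    also have "cball xbar e \<inter> {x \<in> cball xbar e1. f x \<le> \<alpha>} = {x \<in> cball xbar e. f x \<le> \<alpha>}" using e by auto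
    finally show "closed {x \<in> cball xbar e. f x \<le> \<alpha>}" .
  next
    fix x v x' assume v: "v \<in> limiting_subdiff f x" and x: "dist xbar x \<le> D" "norm v \<le> D" and x': "dist xbar x' \<le> e"
    have "dist (xbar, 0) (x, v) \<le> dist xbar x + norm v"
      using sqrt_sum_squares_le_sum[of "dist xbar x" "norm v"] by (simp add: dist_Pair_Pair)
    also have "\<dots> \<le> e2" using x e by (simp add: D_def)
    finally have "f x + ereal (v \<bullet> (x' - x)) - ereal (r / 2 * (norm (x' - x))\<^sup>2) \<le> f x'"
      using v d(2)[OF v] x x' e by (intro pr2) (auto simp: gph_subdiff_def D_def)
    moreover have "v \<bullet> (x' - x) - (r + 1) / 2 * (norm (x' - x))\<^sup>2 \<le> v \<bullet> (x' - x) - r / 2 * (norm (x' - x))\<^sup>2"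
      by (simp add: field_simps)
    moreover obtain a where "f x = ereal a" using limiting_subdiff_finite[OF v] by (cases "f x") auto
    ultimately show "f x + ereal (v \<bullet> (x' - x) - (r + 1) / 2 * (norm (x' - x))\<^sup>2) \<le> f x'"
      by (cases "f x'") auto
  qed
  then show ?thesis by blast
qed

subsection \<open>The local proximal mapping\<close>

context prox_local begin

section \<open>Minimisers of f under a tilt and a quadratic perturbation\<close>

definition f0 :: real where "f0 = real_of_ereal (f xbar)"

lemma f_xbar: "f xbar = ereal f0"
  using fin by (simp add: f0_def ereal_real)

lemma base_bound: "dist xbar y \<le> \<epsilon> \<Longrightarrow> ereal (f0 - r / 2 * (norm (y - xbar))\<^sup>2) \<le> f y"
  using prox[OF zero, of y] delta by (simp add: f_xbar)

text \<open>This is the direct method under a weak form of lower semicontinuity: sublevel sets are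
  closed only up to the level f xbar + \<epsilon>. The assumption norm u < 1 guarantees that the
  limiting value of f along a minimising sequence stays below that level.\<close>

lemma perturbed_argmin_exists:
  assumes eta: "0 < \<eta>" "\<eta> \<le> \<epsilon>" and u: "norm u < 1" and rho: "\<rho> \<ge> 0"
  shows "\<exists>x. dist xbar x \<le> \<eta> \<and>
    (\<forall>y. dist xbar y \<le> \<eta> \<longrightarrow> f x + ereal (\<rho> / 2 * (norm (x - xbar))\<^sup>2 - u \<bullet> x) \<le> f y + ereal (\<rho> / 2 * (norm (y - xbar))\<^sup>2 - u \<bullet> y))"
proof -
  define c where "c y = \<rho> / 2 * (norm (y - xbar))\<^sup>2 - u \<bullet> y" for y
  have contc: "isCont c y" for y unfolding c_def by (intro continuous_intros)
  define R where "R = {t. \<exists>y. dist xbar y \<le> \<eta> \<and> f y = ereal (t - c y)}"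
  have RI: "f0 + c xbar \<in> R" using eta by (auto simp: R_def f_xbar intro!: exI[of _ xbar])
  have low: "f0 - r / 2 * \<eta>\<^sup>2 - norm u * (norm xbar + \<eta>) \<le> t" if "t \<in> R" for t
  proof -
    obtain y where y: "dist xbar y \<le> \<eta>" "f y = ereal (t - c y)" using \<open>t \<in> R\<close> by (auto simp: R_def)
    have n: "norm (y - xbar) \<le> \<eta>" using y(1) by (simp add: dist_norm norm_minus_commute)
    have "f0 - r / 2 * (norm (y - xbar))\<^sup>2 \<le> t - c y" using base_bound[of y] y eta by simp
    moreover have "r / 2 * (norm (y - xbar))\<^sup>2 \<le> r / 2 * \<eta>\<^sup>2" using n r by (intro mult_left_mono power_mono) auto
    moreover have "u \<bullet> y \<le> norm u * (norm xbar + \<eta>)"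
    proof -
      have "u \<bullet> y \<le> norm u * norm y" by (rule norm_cauchy_schwarz)
      also have "norm y \<le> norm xbar + \<eta>" using n norm_triangle_sub[of y xbar] by linarith
      finally show ?thesis by (simp add: mult_left_mono)
    qed
    moreover have "0 \<le> \<rho> / 2 * (norm (y - xbar))\<^sup>2" using rho by simp
    ultimately show ?thesis by (simp add: c_def)
  qed
  then have bdd: "bdd_below R" by (rule bdd_belowI)
  define m where "m = Inf R"
  have "\<exists>t y. dist xbar y \<le> \<eta> \<and> f y = ereal (t - c y) \<and> m \<le> t \<and> t < m + 1 / Suc n" for n :: nat
  proof -
    obtain t where "t \<in> R" "t < m + 1 / Suc n"
      using cInf_less_iff[OF _ bdd, of "m + 1 / Suc n"] RI by (auto simp: m_def)
    then show ?thesis using cInf_lower[OF _ bdd, of t] by (auto simp: R_def m_def)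
  qed
  then obtain t y where ty: "\<And>n::nat. dist xbar (y n) \<le> \<eta>" "\<And>n. f (y n) = ereal (t n - c (y n))"
     "\<And>n. m \<le> t n" "\<And>n. t n < m + 1 / Suc n" by metis
  obtain x s where x: "x \<in> cball xbar \<eta>" "strict_mono (s :: nat \<Rightarrow> nat)" "(y \<circ> s) \<longlonglongrightarrow> x"
    using compact_cball[of xbar \<eta>] ty(1) unfolding compact_def by (metis mem_cball)
  have inv: "(\<lambda>n. m + 1 / real (Suc n)) \<longlonglongrightarrow> m + 0"
    using LIMSEQ_inverse_real_of_nat by (intro tendsto_add tendsto_const) (simp add: inverse_eq_divide)
  have "t \<longlonglongrightarrow> m"
    by (rule tendsto_sandwich[OF _ _ tendsto_const[of m] inv[simplified]]) (use ty(3) less_imp_le[OF ty(4)] in auto)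
  then have lim: "(\<lambda>n. t (s n) - c (y (s n))) \<longlonglongrightarrow> m - c x"
    using LIMSEQ_subseq_LIMSEQ[OF _ x(2), of t m] isCont_tendsto_compose[OF contc x(3)]
    by (intro tendsto_diff) (auto simp: o_def)
  \<comment> \<open>Comparison with xbar: the tilt can raise the value by less than \<eta> \<le>
    \<epsilon>, and the quadratic term only helps.\<close>
  have small: "m - c x < f0 + \<epsilon>"
  proof -
    have n: "norm (x - xbar) \<le> \<eta>" using x(1) by (simp add: dist_norm norm_minus_commute)
    have "m \<le> f0 + c xbar" unfolding m_def using RI bdd by (rule cInf_lower)
    moreover have "u \<bullet> (x - xbar) < \<epsilon>"
    proof -
      have "u \<bullet> (x - xbar) \<le> norm u * norm (x - xbar)" by (rule norm_cauchy_schwarz)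
      also have "\<dots> \<le> norm u * \<eta>" using n by (intro mult_left_mono) auto
      also have "\<dots> < 1 * \<eta>" using u eta by (intro mult_strict_right_mono) auto
      finally show ?thesis using eta by simp
    qed
    moreover have "0 \<le> \<rho> / 2 * (norm (x - xbar))\<^sup>2" using rho by simp
    ultimately show ?thesis by (simp add: c_def inner_diff_right)
  qed
  have fx: "f x \<le> ereal \<beta>" if b: "m - c x < \<beta>" "\<beta> \<le> f0 + \<epsilon>" for \<beta>
  proof -
    have "closed {x \<in> cball xbar \<epsilon>. f x \<le> ereal \<beta>}"
      using b by (intro closed_sublevel) (simp add: f_xbar)
    moreover have "eventually (\<lambda>n. (y \<circ> s) n \<in> {x \<in> cball xbar \<epsilon>. f x \<le> ereal \<beta>}) sequentially"
      using order_tendstoD(2)[OF lim b(1)]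
      by eventually_elim (use ty(1,2) eta in \<open>auto intro: order_trans\<close>)
    ultimately have "x \<in> {x \<in> cball xbar \<epsilon>. f x \<le> ereal \<beta>}"
      using x(3) by (intro Lim_in_closed_set[of _ "y \<circ> s" sequentially x]) auto
    then show ?thesis by simp
  qed
  have fx': "f x \<le> ereal (m - c x)"
  proof (rule ereal_le_epsilon2)
    fix e :: real assume "0 < e"
    define \<beta> where "\<beta> = min (m - c x + e) (f0 + \<epsilon>)"
    have "f x \<le> ereal \<beta>" using small \<open>0 < e\<close> by (intro fx) (auto simp: \<beta>_def)
    also have "\<dots> \<le> ereal (m - c x) + ereal e" by (simp add: \<beta>_def)
    finally show "f x \<le> ereal (m - c x) + ereal e" .
  qed
  have "f x + ereal (c x) \<le> f z + ereal (c z)" if z: "dist xbar z \<le> \<eta>" for z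
  proof -
    have "f z \<noteq> -\<infinity>" using base_bound[of z] z eta by auto
    then consider "f z = \<infinity>" | a where "f z = ereal a" by (cases "f z") auto
    then show ?thesis
    proof cases
      case 2
      then have "a + c z \<in> R" using z by (auto simp: R_def)
      then have "m \<le> a + c z" unfolding m_def using bdd by (rule cInf_lower)
      moreover have "f x + ereal (c x) \<le> ereal (m - c x) + ereal (c x)" using fx' by (rule add_right_mono)
      ultimately show ?thesis using 2 by (auto intro: order_trans)
    qed simp
  qed
  then show ?thesis using x(1) by (auto simp: c_def)
qed

text \<open>Growth at xbar against a tilt of size |u| confines a minimiser to distance 2
  |u|/\<sigma>, hence to the interior of the ball, where Fermat's rule applies. The case \<rho> = 2
  r, \<sigma> = r produces the proximal mapping; the case \<rho> = 0 produces the tilted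
  minimisers.\<close>

lemma perturbed_argmin:
  assumes eta: "0 < \<eta>" "\<eta> \<le> \<epsilon>" and rho: "\<rho> \<ge> 0" "\<sigma> > 0"
    and growth: "\<And>y. dist xbar y \<le> \<eta> \<Longrightarrow> f xbar + ereal (\<sigma> / 2 * (norm (y - xbar))\<^sup>2) \<le> f y + ereal (\<rho> / 2 * (norm (y - xbar))\<^sup>2)"
    and u: "norm u < 1" "norm u < \<sigma> * \<eta> / 2"
  obtains x where "dist xbar x \<le> 2 * norm u / \<sigma>" "u - \<rho> *\<^sub>R (x - xbar) \<in> limiting_subdiff f x"
    "\<And>y. dist xbar y \<le> \<eta> \<Longrightarrow> f x + ereal (\<rho> / 2 * (norm (x - xbar))\<^sup>2 - u \<bullet> x) \<le> f y + ereal (\<rho> / 2 * (norm (y - xbar))\<^sup>2 - u \<bullet> y)"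
proof -
  obtain x where x: "dist xbar x \<le> \<eta>"
    and min: "\<And>y. dist xbar y \<le> \<eta> \<Longrightarrow> f x + ereal (\<rho> / 2 * (norm (x - xbar))\<^sup>2 - u \<bullet> x) \<le> f y + ereal (\<rho> / 2 * (norm (y - xbar))\<^sup>2 - u \<bullet> y)"
    using perturbed_argmin_exists[OF eta u(1) rho(1)] by blast
  have "f x \<noteq> -\<infinity>" "f x \<noteq> \<infinity>" using base_bound[of x] x eta min[of xbar] by (auto simp: f_xbar)
  then obtain a where a: "f x = ereal a" by (cases "f x") auto
  define n where "n = norm (x - xbar)"
  have "a + \<rho> / 2 * n\<^sup>2 - u \<bullet> x \<le> f0 - u \<bullet> xbar" using min[of xbar] eta by (simp add: a f_xbar n_def)
  moreover have "f0 + \<sigma> / 2 * n\<^sup>2 \<le> a + \<rho> / 2 * n\<^sup>2" using growth[OF x] by (simp add: a f_xbar n_def)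
  moreover have "u \<bullet> (x - xbar) \<le> norm u * n" unfolding n_def by (rule norm_cauchy_schwarz)
  ultimately have "\<sigma> / 2 * n\<^sup>2 \<le> norm u * n" by (simp add: inner_diff_right)
  then have "\<sigma> / 2 * n \<le> norm u"
    by (cases "n = 0") (auto simp: n_def power2_eq_square mult.assoc[symmetric] mult_le_cancel_right)
  then have loc: "n \<le> 2 * norm u / \<sigma>" using rho by (simp add: field_simps)
  also have "\<dots> < \<eta>" using u rho by (simp add: field_simps)
  finally have int: "n < \<eta>" .
  have "u - \<rho> *\<^sub>R (x - xbar) \<in> regular_subdiff f x"
  proof (rule regular_subdiffI[of f x "\<eta> - n" "\<rho> / 2"])
    show "\<bar>f x\<bar> \<noteq> \<infinity>" "\<eta> - n > 0" "\<rho> / 2 \<ge> 0" using a int rho by auto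
    fix y assume "dist y x < \<eta> - n"
    then have y: "dist xbar y \<le> \<eta>" using dist_triangle[of xbar y x] by (simp add: n_def dist_commute dist_norm norm_minus_commute)
    have id: "(norm (y - xbar))\<^sup>2 = (norm (x - xbar))\<^sup>2 + 2 * ((x - xbar) \<bullet> (y - x)) + (norm (y - x))\<^sup>2"
      by (simp add: power2_norm_eq_inner inner_diff_left inner_diff_right inner_commute)
    show "f x + ereal ((u - \<rho> *\<^sub>R (x - xbar)) \<bullet> (y - x) - \<rho> / 2 * (norm (y - x))\<^sup>2) \<le> f y"
    proof -
      have "f y \<noteq> -\<infinity>" using base_bound[of y] y eta by auto
      then show ?thesis using min[OF y] by (cases "f y") (auto simp: a id inner_diff_left inner_diff_right algebra_simps)
    qed
  qed
  then show ?thesis using loc min regular_subdiff_subset_limiting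
    by (intro that[of x]) (auto simp: n_def dist_norm norm_minus_commute)
qed

text \<open>\<open>P\<close> is the local resolvent \<open>(I + (2 r)\<^sup>-\<^sup>1 \<partial>f)\<^sup>-\<^sup>1\<close>, that is, the proximal mapping with step \<open>1/(2 r)\<close>.\<close>

definition \<tau> :: real where
  "\<tau> = Min {1 / (4 * r), \<epsilon> / 8, \<delta> / 8, \<delta> / (20 * r)}"

definition P :: "'a \<Rightarrow> 'a" where
  "P z = (SOME x. dist xbar x \<le> 4 * dist xbar z \<and> (2 * r) *\<^sub>R (z - x) \<in> limiting_subdiff f x)"

text \<open>For u = 2 r (z - xbar) the bounds by 1/(4 r) and \<epsilon>/8 give norm u < 1 and norm u
  < r \<epsilon>/2. The bounds by \<delta>/8 and \<delta>/(20 r) match the factors 4 and 10 r in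
  \<open>P_props\<close> and keep both components of the graph point within \<delta>.\<close>

lemma tau: "0 < \<tau>" "\<tau> \<le> 1 / (4 * r)" "\<tau> \<le> \<epsilon> / 8" "\<tau> \<le> \<delta> / 8" "\<tau> \<le> \<delta> / (20 * r)"
  using r eps delta by (auto simp: \<tau>_def)

text \<open>The proximal problem for z is the perturbed problem with \<rho> = 2 r and u = 2 r (z -
  xbar). Since f loses at most curvature r at xbar, growth with \<sigma> = r remains, and 2
  |u|/\<sigma> is the factor 4. The estimate |z - P z| \<le> 5 |z - xbar| then yields 10 r.\<close>

lemma P_props:
  assumes z: "z \<in> ball xbar \<tau>"
  shows P_dist: "dist xbar (P z) \<le> 4 * dist xbar z" and P_sub: "(2 * r) *\<^sub>R (z - P z) \<in> limiting_subdiff f (P z)"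
    and P_near: "dist xbar (P z) \<le> \<delta>" and P_dual: "norm ((2 * r) *\<^sub>R (z - P z)) \<le> 10 * r * dist xbar z"
    and P_dual_le: "norm ((2 * r) *\<^sub>R (z - P z)) \<le> \<delta>"
proof -
  have zt: "dist xbar z < \<tau>" using z by simp
  define u where "u = (2 * r) *\<^sub>R (z - xbar)"
  have nu: "norm u = 2 * r * dist xbar z" using r by (simp add: u_def dist_norm norm_minus_commute)
  have growth: "f xbar + ereal (r / 2 * (norm (y - xbar))\<^sup>2) \<le> f y + ereal ((2 * r) / 2 * (norm (y - xbar))\<^sup>2)"
    if y: "dist xbar y \<le> \<epsilon>" for y
    using base_bound[OF y] by (cases "f y") (auto simp: f_xbar)
  have "norm u < 1" "norm u < r * \<epsilon> / 2"
  proof -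
    have "dist xbar z < 1 / (4 * r)" "dist xbar z < \<epsilon> / 8" using zt tau by linarith+
    then show "norm u < 1" "norm u < r * \<epsilon> / 2" using r eps by (auto simp: nu field_simps)
  qed
  from perturbed_argmin[OF eps order_refl _ r growth this]
  obtain x where x: "dist xbar x \<le> 2 * norm u / r" "u - (2 * r) *\<^sub>R (x - xbar) \<in> limiting_subdiff f x"
    using r by (metis less_eq_real_def mult_2 add_nonneg_nonneg)
  have "u - (2 * r) *\<^sub>R (x - xbar) = (2 * r) *\<^sub>R (z - x)" by (simp add: u_def algebra_simps)
  moreover have "dist xbar x \<le> 4 * dist xbar z" using x(1) r by (simp add: nu)
  ultimately have "dist xbar x \<le> 4 * dist xbar z \<and> (2 * r) *\<^sub>R (z - x) \<in> limiting_subdiff f x"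
    using x(2) by simp
  from someI[where P="\<lambda>x. dist xbar x \<le> 4 * dist xbar z \<and> (2 * r) *\<^sub>R (z - x) \<in> limiting_subdiff f x", OF this]
  show 1: "dist xbar (P z) \<le> 4 * dist xbar z" and "(2 * r) *\<^sub>R (z - P z) \<in> limiting_subdiff f (P z)"
    unfolding P_def by blast+
  show "dist xbar (P z) \<le> \<delta>" using 1 zt tau delta by linarith
  have "dist z (P z) \<le> 5 * dist xbar z" using dist_triangle3[of z "P z" xbar] 1 by linarith
  then show 2: "norm ((2 * r) *\<^sub>R (z - P z)) \<le> 10 * r * dist xbar z"
    using r by (simp add: dist_norm)
  have "dist xbar z < \<delta> / (20 * r)" using zt tau by linarith
  then have "10 * r * dist xbar z \<le> \<delta>" using r delta by (simp add: field_simps)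
  with 2 show "norm ((2 * r) *\<^sub>R (z - P z)) \<le> \<delta>" by simp
qed

lemma hypomonotone:
  assumes "v \<in> limiting_subdiff f x" "dist xbar x \<le> \<delta>" "norm v \<le> \<delta>"
    and "v' \<in> limiting_subdiff f x'" "dist xbar x' \<le> \<delta>" "norm v' \<le> \<delta>"
  shows "- r * (norm (x - x'))\<^sup>2 \<le> (v - v') \<bullet> (x - x')"
proof -
  obtain a a' where "f x = ereal a" "f x' = ereal a'"
    using limiting_subdiff_finite[OF assms(1)] limiting_subdiff_finite[OF assms(4)] by (cases "f x"; cases "f x'") auto
  then show ?thesis
    using prox[OF assms(1-3), of x'] prox[OF assms(4-6), of x] assms(2,5) delta
    by (simp add: inner_diff_left inner_diff_right norm_minus_commute[of x' x] algebra_simps)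
qed

text \<open>Hypomonotonicity with constant r is weighed against the multiplier 2 r, which leaves
  half of the usual firm nonexpansiveness; Cauchy-Schwarz turns it into the Lipschitz constant
  2.\<close>

lemma P_cocoercive:
  assumes "z \<in> ball xbar \<tau>" "z' \<in> ball xbar \<tau>"
  shows "(norm (P z - P z'))\<^sup>2 \<le> 2 * ((P z - P z') \<bullet> (z - z'))"
proof -
  define a where "a = P z - P z'"
  have "- r * (norm a)\<^sup>2 \<le> ((2 * r) *\<^sub>R (z - P z) - (2 * r) *\<^sub>R (z' - P z')) \<bullet> a"
    unfolding a_def using assms by (intro hypomonotone P_sub P_near P_dual_le)
  also have "(2 * r) *\<^sub>R (z - P z) - (2 * r) *\<^sub>R (z' - P z') = (2 * r) *\<^sub>R (z - z' - a)"
    by (simp add: a_def algebra_simps)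
  also have "\<dots> \<bullet> a = r * (2 * (a \<bullet> (z - z')) - 2 * (norm a)\<^sup>2)"
    by (simp add: inner_diff_left power2_norm_eq_inner inner_commute algebra_simps)
  finally have "r * (- (norm a)\<^sup>2) \<le> r * (2 * (a \<bullet> (z - z')) - 2 * (norm a)\<^sup>2)" by simp
  then have "- (norm a)\<^sup>2 \<le> 2 * (a \<bullet> (z - z')) - 2 * (norm a)\<^sup>2" using r by (simp only: mult_le_cancel_left_pos)
  then show ?thesis by (simp add: a_def)
qed

lemma P_Lipschitz:
  assumes "z \<in> ball xbar \<tau>" "z' \<in> ball xbar \<tau>"
  shows "norm (P z - P z') \<le> 2 * norm (z - z')"
proof -
  have "(norm (P z - P z'))\<^sup>2 \<le> 2 * (norm (P z - P z') * norm (z - z'))"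
    using P_cocoercive[OF assms] norm_cauchy_schwarz[of "P z - P z'" "z - z'"] by linarith
  then show ?thesis by (cases "P z = P z'") (auto simp: power2_eq_square mult.left_commute[of 2])
qed

text \<open>Two graph points with the same z have subgradients differing by -2 r times the
  difference of the points, more than hypomonotonicity allows. Thus every graph point near (xbar, 0)
  is reached by the parametrisation through \<open>P\<close>.\<close>

lemma P_unique:
  assumes v: "v \<in> limiting_subdiff f x" "dist xbar x \<le> \<delta>" "norm v \<le> \<delta>" and z: "x + v /\<^sub>R (2 * r) \<in> ball xbar \<tau>"
  shows "P (x + v /\<^sub>R (2 * r)) = x"
proof -
  define z where "z = x + v /\<^sub>R (2 * r)"
  define a where "a = P z - x"
  have zb: "z \<in> ball xbar \<tau>" using z by (simp add: z_def)
  have "- r * (norm a)\<^sup>2 \<le> ((2 * r) *\<^sub>R (z - P z) - v) \<bullet> a"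
    unfolding a_def using zb v by (intro hypomonotone P_sub P_near P_dual_le)
  also have "(2 * r) *\<^sub>R (z - P z) - v = - (2 * r) *\<^sub>R a"
    using r by (simp add: a_def z_def algebra_simps)
  finally have "r * (norm a)\<^sup>2 \<le> 0" by (simp add: power2_norm_eq_inner)
  then have "a = 0" using r by (simp add: mult_le_0_iff)
  then show ?thesis by (simp add: a_def z_def)
qed

text \<open>This is the conjugate of f/(2 r) + |.|^2/2, localised near xbar and evaluated at its
  maximiser; equivalently |z|^2/2 minus the Moreau envelope of f divided by 2 r.\<close>

definition p :: "'a \<Rightarrow> real" where
  "p z = P z \<bullet> z - (norm (P z))\<^sup>2 / 2 - real_of_ereal (f (P z)) / (2 * r)"

lemma f_P:
  assumes "z \<in> ball xbar \<tau>"
  shows "f (P z) = ereal (2 * r * (P z \<bullet> z - (norm (P z))\<^sup>2 / 2 - p z))"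
proof -
  obtain a where "f (P z) = ereal a"
    using limiting_subdiff_finite[OF P_sub[OF assms]] by (cases "f (P z)") auto
  then show ?thesis using r by (simp add: p_def)
qed

text \<open>Fenchel-Young inequality for p, with equality at y = P z by \<open>f_P\<close>. Every z
  supplies one lower bound for f, and the later growth estimates consist in choosing z well.\<close>

lemma f_lower:
  assumes z: "z \<in> ball xbar \<tau>" and y: "dist xbar y \<le> \<epsilon>"
  shows "ereal (2 * r * (y \<bullet> z - (norm y)\<^sup>2 / 2 - p z)) \<le> f y"
proof -
  let ?x = "P z"
  have "2 * r * (y \<bullet> z - (norm y)\<^sup>2 / 2 - p z) =
    2 * r * (?x \<bullet> z - (norm ?x)\<^sup>2 / 2 - p z) + ((2 * r) *\<^sub>R (z - ?x) \<bullet> (y - ?x) - (2 * r) / 2 * (norm (y - ?x))\<^sup>2)"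
    using r by (simp add: power2_norm_eq_inner inner_diff_left inner_diff_right inner_commute algebra_simps)
  also have "\<dots> \<le> 2 * r * (?x \<bullet> z - (norm ?x)\<^sup>2 / 2 - p z) + ((2 * r) *\<^sub>R (z - ?x) \<bullet> (y - ?x) - r / 2 * (norm (y - ?x))\<^sup>2)"
    using r by simp
  finally show ?thesis
    using prox[OF P_sub[OF z] P_near[OF z] P_dual_le[OF z] y] f_P[OF z]
    by (auto intro: order_trans[rotated])
qed

lemma p_subgradient:
  assumes z: "z \<in> ball xbar \<tau>" and z': "z' \<in> ball xbar \<tau>"
  shows "p z + P z \<bullet> (z' - z) \<le> p z'"
proof -
  have "dist xbar (P z) \<le> \<epsilon>" using P_near[OF z] delta by simp
  from f_lower[OF z' this] have "P z \<bullet> z' - (norm (P z))\<^sup>2 / 2 - p z' \<le> P z \<bullet> z - (norm (P z))\<^sup>2 / 2 - p z"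
    using r by (simp add: f_P[OF z] mult_le_cancel_left)
  then show ?thesis by (simp add: inner_diff_right)
qed

lemma P_line_derivative:
  assumes "z + s *\<^sub>R \<zeta> \<in> ball xbar \<tau>"
  shows "((\<lambda>s. p (z + s *\<^sub>R \<zeta>)) has_real_derivative P (z + s *\<^sub>R \<zeta>) \<bullet> \<zeta>) (at s)"
proof (rule subgradient_line_derivative_at[where S="ball xbar \<tau>" and k=2, OF open_ball assms p_subgradient])
  fix u u' assume u: "u \<in> ball xbar \<tau>" "u' \<in> ball xbar \<tau>"
  have "(P u' - P u) \<bullet> (u' - u) \<le> norm (P u' - P u) * norm (u' - u)" by (rule norm_cauchy_schwarz)
  also have "\<dots> \<le> 2 * norm (u' - u) * norm (u' - u)"
    using u by (intro mult_right_mono P_Lipschitz) auto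
  finally show "(P u' - P u) \<bullet> (u' - u) \<le> 2 * (norm (u' - u))\<^sup>2" by (simp add: power2_eq_square)
qed

end

subsection \<open>Bounds on second subderivatives\<close>

lemma second_subderiv_geI:
  fixes f :: "'a::euclidean_space \<Rightarrow> ereal"
  assumes a: "f x = ereal a"
    and ge: "\<And>e. e > 0 \<Longrightarrow> \<exists>d>0. \<forall>t u. 0 < t \<and> t < d \<and> dist u w < d \<longrightarrow>
      ereal (a + t * (v \<bullet> u) + t\<^sup>2 / 2 * (c - e)) \<le> f (x + t *\<^sub>R u)"
  shows "ereal c \<le> second_subderiv f x v w"
  unfolding second_subderiv_def le_Liminf_iff
proof (intro allI impI)
  fix y assume "y < ereal c"
  then obtain b where b: "y < ereal b" "b < c" using ereal_dense2 by force
  obtain d where d: "d > 0" "\<And>t u. 0 < t \<Longrightarrow> t < d \<Longrightarrow> dist u w < d \<Longrightarrow>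
      ereal (a + t * (v \<bullet> u) + t\<^sup>2 / 2 * (c - (c - b))) \<le> f (x + t *\<^sub>R u)"
    using ge[of "c - b"] b by auto
  have "eventually (\<lambda>t. 0 < t \<and> t < d) (at_right (0::real))"
    using d(1) by (auto simp: eventually_at_right)
  moreover have "eventually (\<lambda>u. dist u w < d) (nhds w)"
    using d(1) by (auto simp: eventually_nhds_metric)
  ultimately have "eventually (\<lambda>(t, u). (0 < t \<and> t < d) \<and> dist u w < d) (at_right 0 \<times>\<^sub>F nhds w)"
    by (auto simp: eventually_prod_filter)
  then show "eventually (\<lambda>tu. y < (case tu of (t, u) \<Rightarrow>
      (f (x + t *\<^sub>R u) - f x - ereal (t * (v \<bullet> u))) / ereal (1 / 2 * t\<^sup>2))) (at_right 0 \<times>\<^sub>F nhds w)"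
  proof eventually_elim
    case (elim tu)
    obtain t u where tu: "tu = (t, u)" by force
    with elim have t: "0 < t" "t < d" "dist u w < d" by auto
    have "ereal b \<le> (f (x + t *\<^sub>R u) - f x - ereal (t * (v \<bullet> u))) / ereal (1 / 2 * t\<^sup>2)"
      using d(2)[OF t] t(1) by (cases "f (x + t *\<^sub>R u)") (auto simp: a field_simps)
    then show ?case using b(1) by (auto simp: tu intro: less_le_trans)
  qed
qed

text \<open>The liminf over all (t, u) is bounded by the limit along one curve (t, U t).\<close>

lemma second_subderiv_leI:
  fixes f :: "'a::euclidean_space \<Rightarrow> ereal"
  assumes a: "f x = ereal a" and U: "(U \<longlongrightarrow> w) (at_right 0)" and b: "(b \<longlongrightarrow> c) (at_right 0)"
    and eq: "eventually (\<lambda>t. f (x + t *\<^sub>R U t) = ereal (a + t * (v \<bullet> U t) + t\<^sup>2 / 2 * b t)) (at_right 0)"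
  shows "second_subderiv f x v w \<le> ereal c"
proof (rule ccontr)
  assume "\<not> ?thesis"
  then obtain y where y: "ereal c < y" "y < second_subderiv f x v w" using dense[of "ereal c" "second_subderiv f x v w"] by (auto simp: not_le)
  have "eventually (\<lambda>(t, u). y < (f (x + t *\<^sub>R u) - f x - ereal (t * (v \<bullet> u))) / ereal (1 / 2 * t\<^sup>2)) (at_right 0 \<times>\<^sub>F nhds w)"
    using y(2) unfolding second_subderiv_def by (auto dest!: less_LiminfD simp: case_prod_unfold)
  moreover have "filterlim (\<lambda>t. (t, U t)) (at_right 0 \<times>\<^sub>F nhds w) (at_right 0)"
    using U by (intro filterlim_Pair filterlim_ident)
  ultimately have "eventually (\<lambda>t. y < (f (x + t *\<^sub>R U t) - f x - ereal (t * (v \<bullet> U t))) / ereal (1 / 2 * t\<^sup>2)) (at_right 0)"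
    by (auto simp: filterlim_iff)
  moreover have "eventually (\<lambda>t. 0 < t) (at_right (0::real))" by (simp add: eventually_at_right_less)
  ultimately have "eventually (\<lambda>t. y < ereal (b t)) (at_right 0)"
    using eq by eventually_elim (auto simp: a field_simps)
  moreover obtain c' where "ereal c < ereal c'" "ereal c' < y" using y(1) ereal_dense2 by blast
  ultimately have "eventually (\<lambda>t. c' < b t) (at_right 0)"
    by (auto elim!: eventually_mono dest: less_trans)
  then have "c' \<le> c" using b by (intro tendsto_lowerbound) (auto elim: eventually_mono)
  with \<open>ereal c < ereal c'\<close> show False by simp
qed

subsection \<open>Quadratic forms attached to a positive semidefinite operator\<close>

definition sym_psd :: "('a::real_inner \<Rightarrow> 'a) \<Rightarrow> bool" where
  "sym_psd A \<longleftrightarrow> linear A \<and> (\<forall>x y. A x \<bullet> y = x \<bullet> A y) \<and> (\<forall>x. 0 \<le> A x \<bullet> x)"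

text \<open>
  For invertible \<open>A\<close> this is \<open>2 r \<langle>(A\<^sup>-\<^sup>1 - I) w, w\<rangle>\<close>; the conjugate form makes sense for every \<open>A\<close>
  and is stable under limits of operators.
\<close>

definition qform :: "real \<Rightarrow> ('a::real_inner \<Rightarrow> 'a) \<Rightarrow> 'a \<Rightarrow> ereal" where
  "qform r A w = (SUP \<zeta>. ereal (2 * r * (2 * (w \<bullet> \<zeta>) - A \<zeta> \<bullet> \<zeta> - (norm w)\<^sup>2)))"

lemma qform_ge: "ereal (2 * r * (2 * (w \<bullet> \<zeta>) - A \<zeta> \<bullet> \<zeta> - (norm w)\<^sup>2)) \<le> qform r A w"
  unfolding qform_def by (rule SUP_upper) simp

lemma qform_range:
  assumes A: "sym_psd A" and r: "r > 0"
  shows "qform r A (A \<zeta>) = ereal (2 * r * (A \<zeta> \<bullet> \<zeta> - (norm (A \<zeta>))\<^sup>2))"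
proof (rule antisym)
  show "qform r A (A \<zeta>) \<le> ereal (2 * r * (A \<zeta> \<bullet> \<zeta> - (norm (A \<zeta>))\<^sup>2))"
    unfolding qform_def
  proof (rule SUP_least)
    fix \<eta>
    have "0 \<le> A (\<zeta> - \<eta>) \<bullet> (\<zeta> - \<eta>)" using A by (auto simp: sym_psd_def)
    also have "\<dots> = A \<zeta> \<bullet> \<zeta> - 2 * (A \<zeta> \<bullet> \<eta>) + A \<eta> \<bullet> \<eta>"
      using A by (auto simp: sym_psd_def linear_diff inner_diff_left inner_diff_right inner_commute)
    finally have "2 * (A \<zeta> \<bullet> \<eta>) - A \<eta> \<bullet> \<eta> \<le> A \<zeta> \<bullet> \<zeta>" by simp
    then show "ereal (2 * r * (2 * (A \<zeta> \<bullet> \<eta>) - A \<eta> \<bullet> \<eta> - (norm (A \<zeta>))\<^sup>2)) \<le> ereal (2 * r * (A \<zeta> \<bullet> \<zeta> - (norm (A \<zeta>))\<^sup>2))"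
      using r by simp
  qed
  show "ereal (2 * r * (A \<zeta> \<bullet> \<zeta> - (norm (A \<zeta>))\<^sup>2)) \<le> qform r A (A \<zeta>)"
    using qform_ge[of r "A \<zeta>" \<zeta> A] by simp
qed

text \<open>By symmetry the component b of w orthogonal to the range lies in the kernel of A, so
  along multiples of b the expression in the supremum grows linearly.\<close>

lemma qform_infinite:
  fixes A :: "'a::euclidean_space \<Rightarrow> 'a"
  assumes A: "sym_psd A" and r: "r > 0" and w: "w \<notin> range A"
  shows "qform r A w = \<infinity>"
proof -
  have lin: "linear A" using A by (simp add: sym_psd_def)
  have sub: "subspace (range A)" using lin by (simp add: linear_subspace_image)
  obtain a b where ab: "a \<in> span (range A)" "\<And>y. y \<in> span (range A) \<Longrightarrow> orthogonal b y" "w = a + b"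
    using orthogonal_subspace_decomp_exists[of "range A" w] by metis
  have b0: "b \<noteq> 0" using ab w by (metis add.right_neutral span_eq_iff sub)
  have ker: "A b = 0"
  proof -
    have "A b \<bullet> A b = b \<bullet> A (A b)" using A by (auto simp: sym_psd_def)
    also have "\<dots> = 0" using ab(2)[of "A (A b)"] by (auto simp: orthogonal_def span_base)
    finally show ?thesis by simp
  qed
  have wb: "w \<bullet> b = (norm b)\<^sup>2"
    using ab(2)[OF ab(1)] ab(3) by (simp add: orthogonal_def inner_add_left inner_add_right inner_commute power2_norm_eq_inner)
  have "ereal M \<le> qform r A w" for M
  proof -
    \<comment> \<open>Solves for the multiple of b at which the expression equals M.\<close>
    define s where "s = (M / (2 * r) + (norm w)\<^sup>2) / (2 * (norm b)\<^sup>2)"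
    have "2 * s * (norm b)\<^sup>2 = M / (2 * r) + (norm w)\<^sup>2" using b0 by (simp add: s_def)
    then have "2 * r * (2 * (w \<bullet> (s *\<^sub>R b)) - A (s *\<^sub>R b) \<bullet> (s *\<^sub>R b) - (norm w)\<^sup>2) = M"
      using lin r by (simp add: linear_scale ker wb field_simps)
    then show ?thesis using qform_ge[of r w "s *\<^sub>R b" A] by simp
  qed
  then show ?thesis using ereal_top by blast
qed

lemma edom_qform:
  fixes A :: "'a::euclidean_space \<Rightarrow> 'a"
  assumes "sym_psd A" "r > 0"
  shows "edom (qform r A) = range A"
  using qform_range[OF assms] qform_infinite[OF assms] by (fastforce simp: edom_def)

text \<open>A linear right inverse B of A on its range gives the operator 2 r (B - I). B need not be
  symmetric as a map, but on the range \<langle>B x, y\<rangle> = \<langle>B x, A (B y)\<rangle> =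
  \<langle>A (B x), B y\<rangle> = \<langle>x, B y\<rangle>.\<close>

lemma gqf_qform:
  fixes A :: "'a::euclidean_space \<Rightarrow> 'a"
  assumes A: "sym_psd A" and r: "r > 0"
  shows "gqf (qform r A)"
proof -
  have lin: "linear A" using A by (simp add: sym_psd_def)
  obtain B where B: "linear B" "\<And>w. w \<in> range A \<Longrightarrow> A (B w) = w"
    using linear_exists_right_inverse_on[OF lin subspace_UNIV] by auto
  define L where "L w = (2 * r) *\<^sub>R (B w - w)" for w
  have lB: "linear (\<lambda>w. B w - w)" using B(1) by (intro linearI) (simp_all add: linear_add linear_scale scaleR_diff_right)
  have "qform r A w \<noteq> -\<infinity>" for w using qform_ge[of r w 0 A] by auto
  then have proper: "proper_fun (qform r A)"
    using edom_qform[OF A r] by (auto simp: proper_fun_def)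
  have sym: "B x \<bullet> y = x \<bullet> B y" if "x \<in> range A" "y \<in> range A" for x y
    using A B(2)[OF that(1)] B(2)[OF that(2)] by (metis inner_commute sym_psd_def)
  have val: "qform r A x = ereal (L x \<bullet> x)" if "x \<in> range A" for x
  proof -
    have "qform r A x = qform r A (A (B x))" using B(2)[OF that] by simp
    also have "\<dots> = ereal (2 * r * (A (B x) \<bullet> B x - (norm (A (B x)))\<^sup>2))" by (rule qform_range[OF A r])
    finally show ?thesis
      using B(2)[OF that] by (simp add: L_def inner_diff_left inner_diff_right power2_norm_eq_inner inner_commute)
  qed
  have "subspace (range A)" using lin by (simp add: linear_subspace_image)
  then show ?thesis
    unfolding gqf_def edom_qform[OF A r] using proper val sym
    by (intro conjI exI[of _ L])
      (auto simp: L_def linear_add[OF lB] linear_scale[OF lB] scaleR_add_right inner_diff_left inner_diff_right mult.left_commute)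
qed

text \<open>For A' \<zeta> the points A k \<zeta> form a recovery sequence, with the slack \<alpha>
  - g A' carried along. Conversely each expression in the supremum is jointly continuous in operator
  and argument, so its inequality survives limits. Ranks may drop in the limit without harm.\<close>

lemma epi_converges_qform:
  fixes A :: "nat \<Rightarrow> 'a::euclidean_space \<Rightarrow> 'a"
  assumes A: "\<And>k. sym_psd (A k)" "sym_psd A'" and r: "r > 0" and lim: "\<And>\<zeta>. (\<lambda>k. A k \<zeta>) \<longlonglongrightarrow> A' \<zeta>"
  shows "epi_converges (\<lambda>k. qform r (A k)) (qform r A')"
proof -
  let ?C = "\<lambda>k. epi (qform r (A k))"
  have 1: "epi (qform r A') \<subseteq> inner_limit ?C"
  proof
    fix y assume "y \<in> epi (qform r A')"
    then obtain w \<alpha> where y: "y = (w, \<alpha>)" "qform r A' w \<le> ereal \<alpha>" by (auto simp: epi_def)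
    have "w \<in> range A'"
    proof (rule ccontr)
      assume "w \<notin> range A'"
      from qform_infinite[OF A(2) r this] show False using y by simp
    qed
    then obtain \<zeta> where w: "w = A' \<zeta>" by blast
    define g where "g B = 2 * r * (B \<zeta> \<bullet> \<zeta> - (norm (B \<zeta>))\<^sup>2)" for B :: "'a \<Rightarrow> 'a"
    have g: "g A' \<le> \<alpha>" using y(2) by (simp add: w qform_range[OF A(2) r] g_def)
    have "(\<lambda>k. (A k \<zeta>, g (A k) + (\<alpha> - g A'))) \<longlonglongrightarrow> (A' \<zeta>, g A' + (\<alpha> - g A'))"
      unfolding g_def by (intro tendsto_intros lim)
    moreover have "(A k \<zeta>, g (A k) + (\<alpha> - g A')) \<in> ?C k" for k
      using g by (simp add: epi_def qform_range[OF A(1) r] g_def)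
    ultimately show "y \<in> inner_limit ?C" by (auto simp: inner_limit_def y w)
  qed
  have 2: "inner_limit ?C \<subseteq> outer_limit ?C"
  proof
    fix x assume "x \<in> inner_limit ?C"
    then obtain y N where y: "y \<longlonglongrightarrow> x" "\<And>k. k \<ge> N \<Longrightarrow> y k \<in> ?C k"
      by (auto simp: inner_limit_def eventually_sequentially)
    have "strict_mono (\<lambda>k. k + N)" by (simp add: strict_mono_def)
    moreover have "(\<lambda>k. y (k + N)) \<longlonglongrightarrow> x" using y(1) by (rule LIMSEQ_ignore_initial_segment)
    ultimately show "x \<in> outer_limit ?C" using y(2) unfolding outer_limit_def by fastforce
  qed
  have 3: "outer_limit ?C \<subseteq> epi (qform r A')"
  proof
    fix x assume "x \<in> outer_limit ?C"
    then obtain y s where y: "strict_mono (s :: nat \<Rightarrow> nat)" "y \<longlonglongrightarrow> x" "\<And>k. y k \<in> ?C (s k)"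
      by (auto simp: outer_limit_def)
    obtain w \<alpha> where x: "x = (w, \<alpha>)" by force
    have w: "(\<lambda>k. fst (y k)) \<longlonglongrightarrow> w" and \<alpha>: "(\<lambda>k. snd (y k)) \<longlonglongrightarrow> \<alpha>"
      using tendsto_fst[OF y(2)] tendsto_snd[OF y(2)] by (auto simp: x)
    have "qform r A' w \<le> ereal \<alpha>"
      unfolding qform_def
    proof (rule SUP_least)
      fix \<zeta>
      have s: "(\<lambda>k. A (s k) \<zeta>) \<longlonglongrightarrow> A' \<zeta>" using LIMSEQ_subseq_LIMSEQ[OF lim y(1)] by (simp add: o_def)
      have "(\<lambda>k. 2 * r * (2 * (fst (y k) \<bullet> \<zeta>) - A (s k) \<zeta> \<bullet> \<zeta> - (norm (fst (y k)))\<^sup>2)) \<longlonglongrightarrow>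
        2 * r * (2 * (w \<bullet> \<zeta>) - A' \<zeta> \<bullet> \<zeta> - (norm w)\<^sup>2)"
        by (intro tendsto_intros w s)
      moreover have "2 * r * (2 * (fst (y k) \<bullet> \<zeta>) - A (s k) \<zeta> \<bullet> \<zeta> - (norm (fst (y k)))\<^sup>2) \<le> snd (y k)" for k
        using y(3)[of k] qform_ge[of r "fst (y k)" \<zeta> "A (s k)"]
        by (auto simp: epi_def case_prod_beta dest: order_trans)
      ultimately show "ereal (2 * r * (2 * (w \<bullet> \<zeta>) - A' \<zeta> \<bullet> \<zeta> - (norm w)\<^sup>2)) \<le> ereal \<alpha>"
        using \<alpha> by (auto intro!: LIMSEQ_le)
    qed
    then show "x \<in> epi (qform r A')" by (simp add: x epi_def)
  qed
  show ?thesis unfolding epi_converges_def PK_converges_def using 1 2 3 by blast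
qed

subsection \<open>Second subderivatives at differentiability points of the proximal mapping\<close>

context prox_local begin

definition P_deriv :: "'a \<Rightarrow> ('a \<Rightarrow> 'a) \<Rightarrow> bool" where
  "P_deriv z A \<longleftrightarrow> linear A \<and> (\<forall>\<zeta>. ((\<lambda>t. (P (z + t *\<^sub>R \<zeta>) - P z) /\<^sub>R t) \<longlongrightarrow> A \<zeta>) (at 0))"

text \<open>P is the gradient of p, so a first-order expansion of P along \<zeta> integrates to a
  second-order expansion of p.\<close>

lemma p_taylor:
  assumes z: "z \<in> ball xbar \<tau>" and A: "P_deriv z A"
  shows "((\<lambda>t. (p (z + t *\<^sub>R \<zeta>) - p z - t * (P z \<bullet> \<zeta>)) / t\<^sup>2) \<longlongrightarrow> A \<zeta> \<bullet> \<zeta> / 2) (at_right 0)"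
proof (rule tendstoI)
  fix e :: real assume e: "e > 0"
  define k where "k = A \<zeta> \<bullet> \<zeta>"
  have "((\<lambda>t. ((P (z + t *\<^sub>R \<zeta>) - P z) /\<^sub>R t) \<bullet> \<zeta>) \<longlongrightarrow> k) (at 0)"
    using A unfolding k_def P_deriv_def by (intro tendsto_intros) auto
  then have ev1: "eventually (\<lambda>t. dist (((P (z + t *\<^sub>R \<zeta>) - P z) /\<^sub>R t) \<bullet> \<zeta>) k < e) (at 0)" using e by (rule tendstoD)
  have "((\<lambda>t. z + t *\<^sub>R \<zeta>) \<longlongrightarrow> z) (at (0::real))" by (auto intro!: tendsto_eq_intros)
  from topological_tendstoD[OF this open_ball z]
  have ev2: "eventually (\<lambda>t. z + t *\<^sub>R \<zeta> \<in> ball xbar \<tau>) (at (0::real))" .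
  obtain d where d: "d > 0"
    "\<And>t. t \<noteq> 0 \<Longrightarrow> \<bar>t\<bar> < d \<Longrightarrow> \<bar>((P (z + t *\<^sub>R \<zeta>) - P z) /\<^sub>R t) \<bullet> \<zeta> - k\<bar> < e \<and> z + t *\<^sub>R \<zeta> \<in> ball xbar \<tau>"
    using eventually_conj[OF ev1 ev2] unfolding eventually_at by (auto simp: dist_real_def)
  have inb: "z + s *\<^sub>R \<zeta> \<in> ball xbar \<tau>" if "0 \<le> s" "s < d" for s
    using d(2)[of s] z that by (cases "s = 0") auto
  have slope: "\<bar>P (z + s *\<^sub>R \<zeta>) \<bullet> \<zeta> - P z \<bullet> \<zeta> - s * k\<bar> \<le> e * s" if s: "0 \<le> s" "s < d" for s
  proof (cases "s = 0")
    case False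
    with s have "\<bar>((P (z + s *\<^sub>R \<zeta>) - P z) /\<^sub>R s) \<bullet> \<zeta> - k\<bar> \<le> e" using d(2)[of s] by auto
    moreover have "((P (z + s *\<^sub>R \<zeta>) - P z) /\<^sub>R s) \<bullet> \<zeta> - k = (P (z + s *\<^sub>R \<zeta>) \<bullet> \<zeta> - P z \<bullet> \<zeta> - s * k) / s"
      using False by (simp add: inner_diff_left field_simps)
    ultimately show ?thesis using False s by (simp add: abs_divide divide_le_eq)
  qed simp
  have "dist ((p (z + t *\<^sub>R \<zeta>) - p z - t * (P z \<bullet> \<zeta>)) / t\<^sup>2) (k / 2) < e" if t: "0 < t" "t < d" for t
  proof -
    \<comment> \<open>The slope error e s integrates to e s^2/2; the signs c = 1 and c = -1 give the
      upper and the lower estimate.\<close>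
    define \<psi> where "\<psi> c s = c * (p (z + s *\<^sub>R \<zeta>) - s * (P z \<bullet> \<zeta>) - s\<^sup>2 / 2 * k) - e * s\<^sup>2 / 2" for c s
    have der: "DERIV (\<psi> c) s :> c * (P (z + s *\<^sub>R \<zeta>) \<bullet> \<zeta> - P z \<bullet> \<zeta> - s * k) - e * s" if "0 \<le> s" "s \<le> t" for c s
      unfolding \<psi>_def using that t
      by (auto intro!: derivative_eq_intros P_line_derivative inb)
    have dec: "\<psi> c t \<le> \<psi> c 0" if c: "c = 1 \<or> c = -1" for c
    proof (rule DERIV_nonpos_imp_nonincreasing[of 0 t])
      fix s assume s: "0 \<le> s" "s \<le> t"
      have "c * (P (z + s *\<^sub>R \<zeta>) \<bullet> \<zeta> - P z \<bullet> \<zeta> - s * k) - e * s \<le> 0"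
        using slope[of s] s t c by auto
      then show "\<exists>y. DERIV (\<psi> c) s :> y \<and> y \<le> 0" using der[OF s] by blast
    qed (use t in simp)
    have "\<bar>p (z + t *\<^sub>R \<zeta>) - p z - t * (P z \<bullet> \<zeta>) - t\<^sup>2 / 2 * k\<bar> \<le> e * t\<^sup>2 / 2"
      using dec[of 1] dec[of "-1"] by (intro abs_leI) (simp_all add: \<psi>_def)
    moreover have "(p (z + t *\<^sub>R \<zeta>) - p z - t * (P z \<bullet> \<zeta>)) / t\<^sup>2 - k / 2 = (p (z + t *\<^sub>R \<zeta>) - p z - t * (P z \<bullet> \<zeta>) - t\<^sup>2 / 2 * k) / t\<^sup>2"
      using t by (simp add: field_simps)
    ultimately have "\<bar>(p (z + t *\<^sub>R \<zeta>) - p z - t * (P z \<bullet> \<zeta>)) / t\<^sup>2 - k / 2\<bar> \<le> e / 2"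
      using t by (simp add: abs_divide divide_le_eq)
    then show ?thesis using e by (simp add: dist_real_def)
  qed
  then show "eventually (\<lambda>t. dist ((p (z + t *\<^sub>R \<zeta>) - p z - t * (P z \<bullet> \<zeta>)) / t\<^sup>2) (A \<zeta> \<bullet> \<zeta> / 2) < e) (at_right 0)"
    using d(1) unfolding k_def eventually_at_right_field by auto
qed

lemma eventually_at_right_in_ball:
  assumes z: "z \<in> ball xbar \<tau>"
  shows "eventually (\<lambda>t. z + t *\<^sub>R \<zeta> \<in> ball xbar \<tau>) (at_right (0::real))"
proof -
  have "((\<lambda>t. z + t *\<^sub>R \<zeta>) \<longlongrightarrow> z) (at_right (0::real))" by (auto intro!: tendsto_eq_intros)
  from topological_tendstoD[OF this open_ball z] show ?thesis .
qed

lemma P_deriv_right: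
  "P_deriv z A \<Longrightarrow> ((\<lambda>t. (P (z + t *\<^sub>R \<zeta>) - P z) /\<^sub>R t) \<longlongrightarrow> A \<zeta>) (at_right 0)"
  by (auto simp: P_deriv_def intro: filterlim_at_split[THEN iffD1, THEN conjunct2])

lemma P_deriv_norm:
  assumes z: "z \<in> ball xbar \<tau>" and A: "P_deriv z A"
  shows "norm (A \<zeta>) \<le> 2 * norm \<zeta>"
proof (rule tendsto_upperbound[OF tendsto_norm[OF P_deriv_right[OF A]]])
  show "eventually (\<lambda>t. norm ((P (z + t *\<^sub>R \<zeta>) - P z) /\<^sub>R t) \<le> 2 * norm \<zeta>) (at_right 0)"
    using eventually_at_right_in_ball[OF z, of \<zeta>] eventually_at_right_less[of 0]
  proof eventually_elim
    case (elim t)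
    then show ?case using P_Lipschitz[OF elim(1) z] unfolding norm_scaleR by (simp add: field_simps)
  qed
qed simp

lemma P_deriv_sym_psd:
  assumes z: "z \<in> ball xbar \<tau>" and A: "P_deriv z A"
  shows "sym_psd A"
proof -
  have lin: "linear A" using A by (simp add: P_deriv_def)
  text \<open>
    The rescaled subgradient inequality of \<open>p\<close> says that \<open>A \<zeta>\<close> is a subgradient of the quadratic form
    \<open>\<langle>A \<zeta>, \<zeta>\<rangle>/2\<close>, which forces symmetry.
  \<close>
  have sub: "A \<zeta> \<bullet> \<zeta> / 2 + A \<zeta> \<bullet> (\<eta> - \<zeta>) \<le> A \<eta> \<bullet> \<eta> / 2" for \<zeta> \<eta>
  proof (rule tendsto_le)
    show "((\<lambda>t. (p (z + t *\<^sub>R \<eta>) - p z - t * (P z \<bullet> \<eta>)) / t\<^sup>2) \<longlongrightarrow> A \<eta> \<bullet> \<eta> / 2) (at_right 0)"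
      by (rule p_taylor[OF z A])
    show "((\<lambda>t. (p (z + t *\<^sub>R \<zeta>) - p z - t * (P z \<bullet> \<zeta>)) / t\<^sup>2 + ((P (z + t *\<^sub>R \<zeta>) - P z) /\<^sub>R t) \<bullet> (\<eta> - \<zeta>)) \<longlongrightarrow>
      A \<zeta> \<bullet> \<zeta> / 2 + A \<zeta> \<bullet> (\<eta> - \<zeta>)) (at_right 0)"
      by (intro tendsto_add p_taylor[OF z A] tendsto_inner P_deriv_right[OF A] tendsto_const)
    show "eventually (\<lambda>t. (p (z + t *\<^sub>R \<zeta>) - p z - t * (P z \<bullet> \<zeta>)) / t\<^sup>2 + ((P (z + t *\<^sub>R \<zeta>) - P z) /\<^sub>R t) \<bullet> (\<eta> - \<zeta>)
       \<le> (p (z + t *\<^sub>R \<eta>) - p z - t * (P z \<bullet> \<eta>)) / t\<^sup>2) (at_right 0)"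
      using eventually_at_right_in_ball[OF z, of \<zeta>] eventually_at_right_in_ball[OF z, of \<eta>] eventually_at_right_less[of 0]
    proof eventually_elim
      case (elim t)
      have "p (z + t *\<^sub>R \<zeta>) + t * (P (z + t *\<^sub>R \<zeta>) \<bullet> (\<eta> - \<zeta>)) \<le> p (z + t *\<^sub>R \<eta>)"
        using p_subgradient[OF elim(1,2)] by (simp add: scaleR_diff_right[symmetric])
      then have "p (z + t *\<^sub>R \<zeta>) - p z - t * (P z \<bullet> \<zeta>) + t * ((P (z + t *\<^sub>R \<zeta>) - P z) \<bullet> (\<eta> - \<zeta>)) \<le> p (z + t *\<^sub>R \<eta>) - p z - t * (P z \<bullet> \<eta>)"
        by (simp add: inner_diff_left inner_diff_right algebra_simps)
      then have "(p (z + t *\<^sub>R \<zeta>) - p z - t * (P z \<bullet> \<zeta>) + t * ((P (z + t *\<^sub>R \<zeta>) - P z) \<bullet> (\<eta> - \<zeta>))) / t\<^sup>2 \<le> (p (z + t *\<^sub>R \<eta>) - p z - t * (P z \<bullet> \<eta>)) / t\<^sup>2"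
        by (rule divide_right_mono) simp
      moreover have "(X + t * c) / t\<^sup>2 = X / t\<^sup>2 + inverse t * c" for X c
        using elim(3) by (simp add: field_simps power2_eq_square)
      ultimately show ?case by simp
    qed
  qed simp
  have psd: "0 \<le> A \<zeta> \<bullet> \<zeta>" for \<zeta>
    using sub[of 0 \<zeta>] lin by (simp add: linear_0)
  have half: "A \<zeta> \<bullet> \<xi> \<le> A \<xi> \<bullet> \<zeta>" for \<zeta> \<xi>
  proof -
    have ineq: "A \<zeta> \<bullet> \<xi> \<le> A \<xi> \<bullet> \<zeta> + s * (A \<xi> \<bullet> \<xi>)" if s: "0 < s" for s
    proof -
      have "s * (A \<zeta> \<bullet> \<xi>) \<le> s * (A \<xi> \<bullet> \<zeta> + s * (A \<xi> \<bullet> \<xi>))"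
        using sub[of \<zeta> "\<zeta> + s *\<^sub>R \<xi>"] lin
        by (simp add: linear_add linear_scale inner_add_left inner_add_right algebra_simps)
      then show ?thesis using s by simp
    qed
    have lim: "((\<lambda>s. A \<xi> \<bullet> \<zeta> + s * (A \<xi> \<bullet> \<xi>)) \<longlongrightarrow> A \<xi> \<bullet> \<zeta>) (at_right 0)" by (auto intro!: tendsto_eq_intros)
    show ?thesis
      using eventually_at_right_less[of 0] ineq by (intro tendsto_lowerbound[OF lim]) (auto elim: eventually_mono)
  qed
  show ?thesis unfolding sym_psd_def using lin psd half by (metis antisym inner_commute)
qed

text \<open>Each \<zeta> used in the Fenchel-Young inequality at z + t \<zeta> yields one term of
  the supremum in \<open>qform\<close> as a lower bound. Along the difference quotients of P in
  direction \<zeta> that inequality is an equality, which gives the matching upper bound at A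
  \<zeta>.\<close>

lemma second_subderiv_eq_qform:
  assumes z: "z \<in> ball xbar \<tau>" and A: "P_deriv z A"
  shows "second_subderiv f (P z) ((2 * r) *\<^sub>R (z - P z)) = qform r A"
proof
  fix w
  let ?v = "(2 * r) *\<^sub>R (z - P z)"
  define a where "a = 2 * r * (P z \<bullet> z - (norm (P z))\<^sup>2 / 2 - p z)"
  have a: "f (P z) = ereal a" unfolding a_def by (rule f_P[OF z])
  have psd: "sym_psd A" by (rule P_deriv_sym_psd[OF z A])
  define T where "T \<zeta> t = (p (z + t *\<^sub>R \<zeta>) - p z - t * (P z \<bullet> \<zeta>)) / t\<^sup>2" for \<zeta> t
  have T: "(T \<zeta> \<longlongrightarrow> A \<zeta> \<bullet> \<zeta> / 2) (at_right 0)" for \<zeta>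
    unfolding T_def by (rule p_taylor[OF z A])
  \<comment> \<open>Rewrites the Fenchel-Young bound at z + t \<zeta> and P z + t u as a
    second-order quotient of f, with the quotient T of p as its only non-explicit term.\<close>
  have expand: "2 * r * ((P z + t *\<^sub>R u) \<bullet> (z + t *\<^sub>R \<zeta>) - (norm (P z + t *\<^sub>R u))\<^sup>2 / 2 - p (z + t *\<^sub>R \<zeta>))
     = a + t * (?v \<bullet> u) + t\<^sup>2 / 2 * (2 * r * (2 * (u \<bullet> \<zeta>) - (norm u)\<^sup>2 - 2 * T \<zeta> t))" if "t > 0" for t u \<zeta>
  proof -
    have "p (z + t *\<^sub>R \<zeta>) = p z + t * (P z \<bullet> \<zeta>) + t\<^sup>2 * T \<zeta> t" using that by (simp add: T_def)
    moreover have "(norm (P z + t *\<^sub>R u))\<^sup>2 = (norm (P z))\<^sup>2 + 2 * t * (P z \<bullet> u) + t\<^sup>2 * (norm u)\<^sup>2"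
      unfolding power2_norm_eq_inner by (simp add: inner_add_left inner_add_right inner_commute power2_eq_square algebra_simps)
    ultimately show ?thesis
      by (simp add: a_def inner_add_left inner_add_right inner_diff_left inner_commute algebra_simps power2_eq_square)
  qed
  have ge: "ereal (2 * r * (2 * (w \<bullet> \<zeta>) - A \<zeta> \<bullet> \<zeta> - (norm w)\<^sup>2)) \<le> second_subderiv f (P z) ?v w" (is "ereal ?c \<le> _") for \<zeta>
  proof (rule second_subderiv_geI[where f=f and x="P z", OF a])
    fix e :: real assume e: "e > 0"
    have "eventually (\<lambda>t. 2 * r * T \<zeta> t < 2 * r * (A \<zeta> \<bullet> \<zeta> / 2) + e / 4) (at_right 0)"
      using tendsto_mult_left[OF T, of "2 * r" \<zeta>] e by (auto intro: order_tendstoD)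
    with eventually_at_right_in_ball[OF z, of \<zeta>]
    have "eventually (\<lambda>t. 2 * r * T \<zeta> t < 2 * r * (A \<zeta> \<bullet> \<zeta> / 2) + e / 4 \<and> z + t *\<^sub>R \<zeta> \<in> ball xbar \<tau>) (at_right 0)"
      by (rule eventually_elim2) blast
    then obtain d1 where d1: "d1 > 0" "\<And>t. 0 < t \<Longrightarrow> t < d1 \<Longrightarrow> 2 * r * T \<zeta> t < 2 * r * (A \<zeta> \<bullet> \<zeta> / 2) + e / 4 \<and> z + t *\<^sub>R \<zeta> \<in> ball xbar \<tau>"
      unfolding eventually_at_right_field by auto
    have "isCont (\<lambda>u. 2 * r * (2 * (u \<bullet> \<zeta>) - (norm u)\<^sup>2)) w" by (intro continuous_intros)
    then obtain d2 where d2: "d2 > 0" "\<And>u. dist u w < d2 \<Longrightarrow> \<bar>2 * r * (2 * (u \<bullet> \<zeta>) - (norm u)\<^sup>2) - 2 * r * (2 * (w \<bullet> \<zeta>) - (norm w)\<^sup>2)\<bar> < e / 2"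
      using e unfolding continuous_at_eps_delta by (metis dist_real_def half_gt_zero)
    have "dist xbar (P z) < \<epsilon>"
      using P_near[OF z] P_dist[OF z] z tau eps by simp
    \<comment> \<open>For t < d3 and |u| \<le> |w| + 1 the point P z + t u stays in the ball where
      \<open>f_lower\<close> holds.\<close>
    define d3 where "d3 = (\<epsilon> - dist xbar (P z)) / (norm w + 1)"
    have d3: "d3 > 0" using \<open>dist xbar (P z) < \<epsilon>\<close> by (auto simp: d3_def intro!: divide_pos_pos add_nonneg_pos)
    define d where "d = min (min d1 d2) (min d3 1)"
    have "ereal (a + t * (?v \<bullet> u) + t\<^sup>2 / 2 * (?c - e)) \<le> f (P z + t *\<^sub>R u)" if tu: "0 < t" "t < d" "dist u w < d" for t u
    proof -
      have t1: "2 * r * T \<zeta> t < 2 * r * (A \<zeta> \<bullet> \<zeta> / 2) + e / 4" "z + t *\<^sub>R \<zeta> \<in> ball xbar \<tau>" using d1(2)[of t] tu by (auto simp: d_def)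
      have u: "\<bar>2 * r * (2 * (u \<bullet> \<zeta>) - (norm u)\<^sup>2) - 2 * r * (2 * (w \<bullet> \<zeta>) - (norm w)\<^sup>2)\<bar> < e / 2" using d2(2)[of u] tu by (auto simp: d_def)
      have "norm u \<le> norm w + 1" using tu norm_triangle_sub[of u w] by (auto simp: d_def dist_norm)
      then have "t * norm u \<le> d3 * (norm w + 1)" using tu by (intro mult_mono) (auto simp: d_def)
      also have "\<dots> = \<epsilon> - dist xbar (P z)" by (simp add: d3_def add_nonneg_eq_0_iff)
      finally have "dist xbar (P z + t *\<^sub>R u) \<le> \<epsilon>"
        using dist_triangle[of xbar "P z + t *\<^sub>R u" "P z"] tu by (simp add: dist_norm)
      from f_lower[OF t1(2) this, unfolded expand[OF tu(1)]]
      have "ereal (a + t * (?v \<bullet> u) + t\<^sup>2 / 2 * (2 * r * (2 * (u \<bullet> \<zeta>) - (norm u)\<^sup>2 - 2 * T \<zeta> t))) \<le> f (P z + t *\<^sub>R u)" .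
      moreover have "?c - e \<le> 2 * r * (2 * (u \<bullet> \<zeta>) - (norm u)\<^sup>2 - 2 * T \<zeta> t)"
      proof -
        have "2 * r * (2 * (w \<bullet> \<zeta>) - (norm w)\<^sup>2) - 2 * r * (2 * (u \<bullet> \<zeta>) - (norm u)\<^sup>2) < e / 2" using u by linarith
        then show ?thesis using t1(1) by (simp add: algebra_simps)
      qed
      then have "a + t * (?v \<bullet> u) + t\<^sup>2 / 2 * (?c - e) \<le> a + t * (?v \<bullet> u) + t\<^sup>2 / 2 * (2 * r * (2 * (u \<bullet> \<zeta>) - (norm u)\<^sup>2 - 2 * T \<zeta> t))"
        by (intro add_left_mono mult_left_mono) auto
      ultimately show ?thesis by (auto intro: order_trans[rotated])
    qed
    moreover have "d > 0" using d1 d2 d3 by (simp add: d_def)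
    ultimately show "\<exists>d>0. \<forall>t u. 0 < t \<and> t < d \<and> dist u w < d \<longrightarrow> ereal (a + t * (?v \<bullet> u) + t\<^sup>2 / 2 * (?c - e)) \<le> f (P z + t *\<^sub>R u)"
      by blast
  qed
  then have lower: "qform r A w \<le> second_subderiv f (P z) ?v w"
    unfolding qform_def by (rule SUP_least)
  have upper: "second_subderiv f (P z) ?v w \<le> qform r A w"
  proof (cases "w \<in> range A")
    case False
    then show ?thesis by (simp add: qform_infinite[OF psd r])
  next
    case True
    then obtain \<zeta> where w: "w = A \<zeta>" by blast
    define U where "U t = (P (z + t *\<^sub>R \<zeta>) - P z) /\<^sub>R t" for t
    have U: "(U \<longlongrightarrow> w) (at_right 0)" unfolding U_def w by (rule P_deriv_right[OF A])
    have "((\<lambda>t. 2 * r * (2 * (U t \<bullet> \<zeta>) - (norm (U t))\<^sup>2 - 2 * T \<zeta> t)) \<longlongrightarrow>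
       2 * r * (2 * (w \<bullet> \<zeta>) - (norm w)\<^sup>2 - 2 * (A \<zeta> \<bullet> \<zeta> / 2))) (at_right 0)"
      by (intro tendsto_intros U T)
    moreover have "eventually (\<lambda>t. f (P z + t *\<^sub>R U t) = ereal (a + t * (?v \<bullet> U t) + t\<^sup>2 / 2 * (2 * r * (2 * (U t \<bullet> \<zeta>) - (norm (U t))\<^sup>2 - 2 * T \<zeta> t)))) (at_right 0)"
      using eventually_at_right_in_ball[OF z, of \<zeta>] eventually_at_right_less[of 0]
    proof eventually_elim
      case (elim t)
      have "P z + t *\<^sub>R U t = P (z + t *\<^sub>R \<zeta>)" using elim(2) by (simp add: U_def)
      then show ?case using f_P[OF elim(1)] expand[OF elim(2), of "U t" \<zeta>] by simp
    qed
    ultimately have "second_subderiv f (P z) ?v w \<le> ereal (2 * r * (2 * (w \<bullet> \<zeta>) - (norm w)\<^sup>2 - 2 * (A \<zeta> \<bullet> \<zeta> / 2)))"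
      by (intro second_subderiv_leI[where f=f and x="P z", OF a U])
    then show ?thesis by (simp add: w qform_range[OF psd r])
  qed
  show "second_subderiv f (P z) ?v w = qform r A w" using lower upper by (rule antisym[rotated])
qed

end

subsection \<open>From the quadratic bundle to tilt stability\<close>

context prox_local begin

text \<open>Violating operators near xbar have norm at most 2, so a subsequence converges to some A'
  whose form belongs to the bundle. With n = |A' \<zeta>'| the bundle bound gives n \<le> 2 r/(2 r +
  l), while the violation survives as n \<ge> 2 r/(2 r + l'); this is where l' < l is used.\<close>

lemma P_deriv_bound_near:
  assumes quad: "\<And>q w. q \<in> quad f xbar 0 \<Longrightarrow> ereal (l * (norm w)\<^sup>2) \<le> q w" and l': "0 < l'" "l' < l"
  shows "\<exists>\<eta>>0. \<eta> \<le> \<tau> \<and> (\<forall>z A \<zeta>. z \<in> ball xbar \<eta> \<and> P_deriv z A \<longrightarrow> A \<zeta> \<bullet> \<zeta> \<le> 2 * r / (2 * r + l') * (norm \<zeta>)\<^sup>2)"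
proof (rule ccontr)
  define \<mu> where "\<mu> = 2 * r / (2 * r + l')"
  have mu: "\<mu> > 0" using r l' by (simp add: \<mu>_def)
  assume neg: "\<not> ?thesis"
  have "\<exists>z A \<zeta>. z \<in> ball xbar (\<tau> / Suc n) \<and> P_deriv z A \<and> norm \<zeta> = 1 \<and> \<mu> \<le> A \<zeta> \<bullet> \<zeta>" for n :: nat
  proof -
    have "\<tau> / Suc n > 0" "\<tau> / Suc n \<le> \<tau>" using tau(1) by (auto simp: divide_le_eq)
    with neg obtain z A \<zeta> where z: "z \<in> ball xbar (\<tau> / Suc n)" "P_deriv z A" "\<mu> * (norm \<zeta>)\<^sup>2 < A \<zeta> \<bullet> \<zeta>"
      unfolding \<mu>_def by (meson not_le)
    have lin: "linear A" using z(2) by (simp add: P_deriv_def)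
    have "\<zeta> \<noteq> 0" using z(3) lin by (auto simp: linear_0)
    moreover from this have "\<mu> \<le> A (\<zeta> /\<^sub>R norm \<zeta>) \<bullet> (\<zeta> /\<^sub>R norm \<zeta>)"
      using z(3) lin by (simp add: linear_scale field_simps power2_eq_square)
    moreover have "norm (\<zeta> /\<^sub>R norm \<zeta>) = 1" using \<open>\<zeta> \<noteq> 0\<close> by simp
    ultimately show ?thesis using z(1,2) by blast
  qed
  then obtain z A \<zeta> where zA: "\<And>n::nat. z n \<in> ball xbar (\<tau> / Suc n)" "\<And>n. P_deriv (z n) (A n)"
    "\<And>n. norm (\<zeta> n) = 1" "\<And>n. \<mu> \<le> A n (\<zeta> n) \<bullet> \<zeta> n" by metis
  have z\<tau>: "z n \<in> ball xbar \<tau>" for n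
  proof -
    have "\<tau> / Suc n \<le> \<tau>" using tau(1) by (auto simp: divide_le_eq)
    then show ?thesis using zA(1)[of n] by auto
  qed
  \<comment> \<open>As bounded linear functions the operators form a finite-dimensional normed
    space, so operators and unit vectors converge along a common subsequence and evaluation is
    jointly continuous.\<close>
  define B where "B n = Blinfun (A n)" for n
  have B: "blinfun_apply (B n) = A n" for n
    using zA(2)[of n] by (auto simp: B_def P_deriv_def bounded_linear_Blinfun_apply linear_conv_bounded_linear)
  have "norm (B n) \<le> 2" for n
    by (rule norm_blinfun_bound) (use P_deriv_norm[OF z\<tau> zA(2)] in \<open>auto simp: B\<close>)
  then have "norm (B n, \<zeta> n) \<le> 3" for n
    using norm_Pair_le[of "B n" "\<zeta> n"] zA(3)[of n] by (smt (verit))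
  then have "bounded (range (\<lambda>n. (B n, \<zeta> n)))" by (auto simp: bounded_iff)
  then obtain L s where s: "strict_mono (s :: nat \<Rightarrow> nat)" "((\<lambda>n. (B n, \<zeta> n)) \<circ> s) \<longlonglongrightarrow> L"
    using bounded_imp_convergent_subsequence by blast
  obtain B' \<zeta>' where L: "L = (B', \<zeta>')" by force
  have limB: "(\<lambda>n. B (s n)) \<longlonglongrightarrow> B'" and lim\<zeta>: "(\<lambda>n. \<zeta> (s n)) \<longlonglongrightarrow> \<zeta>'"
    using tendsto_fst[OF s(2)] tendsto_snd[OF s(2)] by (auto simp: L o_def)
  define A' where "A' = blinfun_apply B'"
  have limA: "(\<lambda>n. A (s n) x) \<longlonglongrightarrow> A' x" for x
    using blinfun.tendsto[OF limB tendsto_const[of x]] by (simp add: B A'_def)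
  have psd: "sym_psd (A n)" for n by (rule P_deriv_sym_psd[OF z\<tau> zA(2)])
  have psd': "sym_psd A'"
    unfolding sym_psd_def
  proof (intro conjI allI)
    show "linear A'" unfolding A'_def by (rule bounded_linear.linear[OF blinfun.bounded_linear_right])
    fix x y
    have "(\<lambda>n. A (s n) x \<bullet> y) \<longlonglongrightarrow> A' x \<bullet> y" by (intro tendsto_intros limA)
    moreover have "(\<lambda>n. A (s n) x \<bullet> y) \<longlonglongrightarrow> x \<bullet> A' y"
      using tendsto_inner[OF tendsto_const[of x] limA[of y]] psd by (simp add: sym_psd_def)
    ultimately show "A' x \<bullet> y = x \<bullet> A' y" by (rule LIMSEQ_unique)
  next
    fix x
    have "(\<lambda>n. A (s n) x \<bullet> x) \<longlonglongrightarrow> A' x \<bullet> x" by (intro tendsto_intros limA)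
    moreover have "0 \<le> A (s n) x \<bullet> x" for n using psd[of "s n"] unfolding sym_psd_def by blast
    ultimately show "0 \<le> A' x \<bullet> x" by (intro LIMSEQ_le_const) blast+
  qed
  have "norm \<zeta>' = 1" using tendsto_norm[OF lim\<zeta>] zA(3) by (simp add: LIMSEQ_const_iff)
  have "(\<lambda>n. A (s n) (\<zeta> (s n)) \<bullet> \<zeta> (s n)) \<longlonglongrightarrow> A' \<zeta>' \<bullet> \<zeta>'"
    using tendsto_inner[OF blinfun.tendsto[OF limB lim\<zeta>] lim\<zeta>] by (simp add: B A'_def)
  then have big: "\<mu> \<le> A' \<zeta>' \<bullet> \<zeta>'" by (rule LIMSEQ_le_const) (use zA(4) in auto)
  define xs where "xs k = P (z (s k))" for k
  define vs where "vs k = (2 * r) *\<^sub>R (z (s k) - P (z (s k)))" for k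
  have dz: "(\<lambda>n. dist xbar (z n)) \<longlonglongrightarrow> 0"
  proof (rule tendsto_sandwich[OF _ _ tendsto_const])
    show "(\<lambda>n. \<tau> * inverse (real (Suc n))) \<longlonglongrightarrow> 0"
      using tendsto_mult_left[OF LIMSEQ_inverse_real_of_nat, of \<tau>] by simp
    show "\<forall>\<^sub>F n in sequentially. dist xbar (z n) \<le> \<tau> * inverse (real (Suc n))"
      using zA(1) by (intro always_eventually) (auto simp: divide_inverse intro: less_imp_le)
  qed simp
  have dzs: "(\<lambda>n. dist xbar (z (s n))) \<longlonglongrightarrow> 0" using LIMSEQ_subseq_LIMSEQ[OF dz s(1)] by (simp add: o_def)
  have "(\<lambda>k. dist (xs k) xbar) \<longlonglongrightarrow> 0"
  proof (rule tendsto_sandwich[OF _ _ tendsto_const])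
    show "(\<lambda>n. 4 * dist xbar (z (s n))) \<longlonglongrightarrow> 0" using tendsto_mult_left[OF dzs, of 4] by simp
    show "\<forall>\<^sub>F n in sequentially. dist (xs n) xbar \<le> 4 * dist xbar (z (s n))"
      using P_dist[OF z\<tau>] by (auto simp: xs_def dist_commute)
  qed simp
  then have xs: "xs \<longlonglongrightarrow> xbar" by (subst tendsto_dist_iff)
  have vs: "vs \<longlonglongrightarrow> 0"
  proof (rule Lim_null_comparison)
    show "(\<lambda>n. 10 * r * dist xbar (z (s n))) \<longlonglongrightarrow> 0" using tendsto_mult_left[OF dzs, of "10 * r"] by simp
    show "\<forall>\<^sub>F n in sequentially. norm (vs n) \<le> 10 * r * dist xbar (z (s n))"
      unfolding vs_def using P_dual[OF z\<tau>] by (intro always_eventually allI)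
  qed
  have ss: "second_subderiv f (xs k) (vs k) = qform r (A (s k))" for k
    unfolding xs_def vs_def by (rule second_subderiv_eq_qform[OF z\<tau> zA(2)])
  have "(xs k, vs k) \<in> gph_subdiff f" for k
    using P_sub[OF z\<tau>] by (simp add: gph_subdiff_def xs_def vs_def)
  moreover have "(\<lambda>k. (xs k, vs k)) \<longlonglongrightarrow> (xbar, 0)" by (intro tendsto_Pair xs vs)
  moreover have "gqf (second_subderiv f (xs k) (vs k))" for k unfolding ss by (rule gqf_qform[OF psd r])
  moreover have "epi_converges (\<lambda>k. second_subderiv f (xs k) (vs k)) (qform r A')"
    unfolding ss by (rule epi_converges_qform[OF psd psd' r limA])
  ultimately have "qform r A' \<in> quad f xbar 0"
    unfolding quad_def using gqf_qform[OF psd' r] by blast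
  from quad[OF this, of "A' \<zeta>'"]
  have "l * (norm (A' \<zeta>'))\<^sup>2 \<le> 2 * r * (A' \<zeta>' \<bullet> \<zeta>' - (norm (A' \<zeta>'))\<^sup>2)"
    by (simp add: qform_range[OF psd' r])
  moreover define n where "n = norm (A' \<zeta>')"
  moreover have cs: "A' \<zeta>' \<bullet> \<zeta>' \<le> n"
    using norm_cauchy_schwarz[of "A' \<zeta>'" \<zeta>'] \<open>norm \<zeta>' = 1\<close> by (simp add: n_def)
  ultimately have "l * n\<^sup>2 \<le> 2 * r * (n - n\<^sup>2)" using r by (smt (verit) mult_left_mono)
  then have "(2 * r + l) * n * n \<le> 2 * r * n" by (simp add: algebra_simps power2_eq_square)
  moreover have npos: "n > 0" using cs big mu by linarith
  ultimately have "(2 * r + l) * n \<le> 2 * r" by simp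
  moreover have "2 * r \<le> (2 * r + l') * n"
  proof -
    have "\<mu> \<le> n" using cs big by linarith
    then show ?thesis using r l' by (simp add: \<mu>_def divide_le_eq mult.commute)
  qed
  moreover have "(2 * r + l') * n < (2 * r + l) * n" using npos l' by simp
  ultimately show False by linarith
qed

definition uniform_growth :: "real \<Rightarrow> real \<Rightarrow> bool" where
  "uniform_growth c \<theta> \<longleftrightarrow> (\<forall>x v y. v \<in> limiting_subdiff f x \<and> dist xbar x \<le> \<theta> \<and> norm v \<le> \<theta> \<and> dist xbar y \<le> \<theta> \<longrightarrow>
     f x + ereal (v \<bullet> (y - x) + c / 2 * (norm (y - x))\<^sup>2) \<le> f y)"

text \<open>The monotonicity bound gives p a quadratic upper bound at z. Inserted into the
  Fenchel-Young inequality at a shifted z', it becomes a quadratic lower bound for f at y.\<close>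

lemma uniform_growth_if_P_bound:
  assumes eta: "0 < \<eta>" "\<eta> \<le> \<tau>" and c: "c > 0"
    and bound: "\<And>z z'. z \<in> ball xbar \<eta> \<Longrightarrow> z' \<in> ball xbar \<eta> \<Longrightarrow>
      (P z' - P z) \<bullet> (z' - z) \<le> 2 * r / (2 * r + c) * (norm (z' - z))\<^sup>2"
  shows "\<exists>\<theta>>0. \<theta> \<le> \<delta> \<and> uniform_growth c \<theta>"
proof -
  \<comment> \<open>The shift z' = z + s (y - x) gives the best lower bound when s is the reciprocal
    of the monotonicity constant of P, which is m.\<close>
  define m where "m = (2 * r + c) / (2 * r)"
  have m: "m > 0" using r c by (simp add: m_def)
  have m_inv: "2 * r / (2 * r + c) = 1 / m" by (simp add: m_def)
  \<comment> \<open>The terms 1 + 1/(2 r) bound the distance of z from xbar, and 2 m bounds the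
    shift from z to z', all in units of \<theta>.\<close>
  define K where "K = 1 + 1 / (2 * r) + 2 * m"
  have K: "K > 0" using r m by (simp add: K_def add_pos_pos)
  define \<theta> where "\<theta> = min \<delta> (\<eta> / (2 * K))"
  have \<theta>: "\<theta> > 0" "\<theta> \<le> \<delta>" "\<theta> * K < \<eta>"
  proof -
    show "\<theta> > 0" "\<theta> \<le> \<delta>" using delta eta K by (auto simp: \<theta>_def)
    have "\<theta> * K \<le> \<eta> / (2 * K) * K" using K by (intro mult_right_mono) (auto simp: \<theta>_def)
    also have "\<dots> < \<eta>" using K eta by simp
    finally show "\<theta> * K < \<eta>" .
  qed
  have "f x + ereal (v \<bullet> (y - x) + c / 2 * (norm (y - x))\<^sup>2) \<le> f y"
    if v: "v \<in> limiting_subdiff f x" "dist xbar x \<le> \<theta>" "norm v \<le> \<theta>" and y: "dist xbar y \<le> \<theta>" for x v y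
  proof -
    define z where "z = x + v /\<^sub>R (2 * r)"
    define D where "D = y - x"
    define z' where "z' = z + m *\<^sub>R D"
    have nv: "norm (v /\<^sub>R (2 * r)) \<le> \<theta> * (1 / (2 * r))" using v r by (simp add: field_simps)
    have "dist xbar z \<le> dist xbar x + norm (v /\<^sub>R (2 * r))"
      using norm_triangle_ineq[of "x - xbar" "v /\<^sub>R (2 * r)"] by (simp add: z_def dist_norm norm_minus_commute add_diff_eq algebra_simps)
    then have dz: "dist xbar z \<le> \<theta> * (1 + 1 / (2 * r))" using nv v by (simp add: distrib_left)
    also have "\<dots> \<le> \<theta> * K" using \<theta> m by (intro mult_left_mono) (auto simp: K_def)
    finally have z: "z \<in> ball xbar \<eta>" using \<theta> by simp
    have "norm D \<le> 2 * \<theta>" using v y dist_triangle3[of y x xbar] by (simp add: D_def dist_norm)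
    then have "m * norm D \<le> m * (2 * \<theta>)" using m by (intro mult_left_mono) auto
    moreover have "dist xbar z' \<le> dist xbar z + m * norm D"
      using dist_triangle[of xbar z' z] m by (simp add: z'_def dist_norm)
    moreover have "\<theta> * K = \<theta> * (1 + 1 / (2 * r)) + m * (2 * \<theta>)" by (simp add: K_def distrib_left)
    ultimately have "dist xbar z' \<le> \<theta> * K" using dz by linarith
    then have z': "z' \<in> ball xbar \<eta>" using \<theta> by simp
    have Pz: "P z = x" unfolding z_def
      using v \<theta> z eta by (intro P_unique) (auto simp: z_def)
    have zt: "z \<in> ball xbar \<tau>" "z' \<in> ball xbar \<tau>" using z z' eta by auto
    have "p z' \<le> p z + P z \<bullet> (z' - z) + (1 / m) / 2 * (norm (z' - z))\<^sup>2"
    proof (rule subgradient_quadratic_upper[where S="ball xbar \<eta>"])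
      show "p u + P u \<bullet> (u' - u) \<le> p u'" if "u \<in> ball xbar \<eta>" "u' \<in> ball xbar \<eta>" for u u'
        using that eta by (intro p_subgradient) auto
    qed (use z z' bound in \<open>auto simp: m_inv\<close>)
    then have p: "p z' \<le> p z + m * (x \<bullet> D) + m / 2 * (norm D)\<^sup>2"
      using m by (simp add: z'_def Pz power_mult_distrib power2_eq_square mult.left_commute)
    have fx: "f x = ereal (2 * r * (x \<bullet> z - (norm x)\<^sup>2 / 2 - p z))" using f_P[OF zt(1)] by (simp add: Pz)
    have yD: "y = x + D" by (simp add: D_def)
    have rz: "(2 * r) *\<^sub>R (z - x) = v" using r by (simp add: z_def)
    have "2 * r * (x \<bullet> z - (norm x)\<^sup>2 / 2 - p z) + (v \<bullet> D + c / 2 * (norm D)\<^sup>2)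
      = 2 * r * (y \<bullet> z' - (norm y)\<^sup>2 / 2 - (p z + m * (x \<bullet> D) + m / 2 * (norm D)\<^sup>2))"
    proof -
      have "v \<bullet> D = 2 * r * ((z - x) \<bullet> D)" using rz by (metis inner_scaleR_left)
      moreover have "y \<bullet> z' = x \<bullet> z + m * (x \<bullet> D) + z \<bullet> D + m * (norm D)\<^sup>2"
        by (simp add: yD z'_def power2_norm_eq_inner inner_add_left inner_add_right inner_commute distrib_left)
      moreover have "(norm y)\<^sup>2 = (norm x)\<^sup>2 + 2 * (x \<bullet> D) + (norm D)\<^sup>2"
        by (simp add: yD power2_norm_eq_inner inner_add_left inner_add_right inner_commute)
      moreover have "2 * r * m = 2 * r + c" using r by (simp add: m_def)
      then have "2 * r * m * ((norm D)\<^sup>2 / 2) = (2 * r + c) * ((norm D)\<^sup>2 / 2)" by simp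
      then have "r * (m * (norm D)\<^sup>2) = r * (norm D)\<^sup>2 + c / 2 * (norm D)\<^sup>2"
        by (simp add: distrib_right)
      ultimately show ?thesis by (simp add: inner_diff_left algebra_simps add_divide_distrib)
    qed
    also have "\<dots> \<le> 2 * r * (y \<bullet> z' - (norm y)\<^sup>2 / 2 - p z')" using p r by simp
    finally have "f x + ereal (v \<bullet> D + c / 2 * (norm D)\<^sup>2) \<le> ereal (2 * r * (y \<bullet> z' - (norm y)\<^sup>2 / 2 - p z'))"
      by (simp add: fx)
    also have "\<dots> \<le> f y" using y \<theta> delta by (intro f_lower[OF zt(2)]) auto
    finally show ?thesis by (simp add: D_def)
  qed
  then have "uniform_growth c \<theta>" unfolding uniform_growth_def by blast
  with \<theta> show ?thesis by blast
qed

lemma tilt_argmin_iff: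
  "x \<in> tilt_argmin f xbar \<gamma> v \<longleftrightarrow> dist xbar x \<le> \<gamma> \<and> (\<forall>y. dist xbar y \<le> \<gamma> \<longrightarrow> f x - ereal (v \<bullet> x) \<le> f y - ereal (v \<bullet> y))"
  by (auto simp: tilt_argmin_def is_arg_min_def not_less)

text \<open>Growth at xbar keeps tilted minimisers interior, so each is a graph point with
  subgradient v. Growth there makes it unique, and the sum of the growth inequalities at two of them
  is strong monotonicity with constant c, hence the Lipschitz constant 1/c.\<close>

lemma tilt_stable_if_uniform_growth:
  assumes \<theta>: "0 < \<theta>" "\<theta> \<le> \<delta>" and c: "c > 0" and ug: "uniform_growth c \<theta>"
  shows "tilt_stable f xbar (1 / c)"
proof -
  have ugD: "f x + ereal (v \<bullet> (y - x) + c / 2 * (norm (y - x))\<^sup>2) \<le> f y"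
    if "v \<in> limiting_subdiff f x" "dist xbar x \<le> \<theta>" "norm v \<le> \<theta>" "dist xbar y \<le> \<theta>" for x v y
    using ug that unfolding uniform_growth_def by blast
  \<comment> \<open>The first two bounds are those of \<open>perturbed_argmin\<close>; the third
    admits v itself in \<open>uniform_growth\<close>.\<close>
  define s where "s = min (min 1 (c * \<theta> / 2)) \<theta>"
  have s: "s > 0" using \<theta> c by (simp add: s_def)
  have ex: "\<exists>x. v \<in> limiting_subdiff f x \<and> dist xbar x \<le> \<theta> \<and> tilt_argmin f xbar \<theta> v = {x}"
    if v: "norm v < s" for v
  proof -
    have growth: "f xbar + ereal (c / 2 * (norm (y - xbar))\<^sup>2) \<le> f y + ereal (0 / 2 * (norm (y - xbar))\<^sup>2)"
      if "dist xbar y \<le> \<theta>" for y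
      using ugD[OF zero, of y] that \<theta> by simp
    have "\<theta> \<le> \<epsilon>" "norm v < 1" "norm v < c * \<theta> / 2" using \<theta> delta v by (auto simp: s_def)
    from perturbed_argmin[OF \<theta>(1) this(1) order_refl c growth this(2,3)]
    obtain x where x: "dist xbar x \<le> 2 * norm v / c" "v \<in> limiting_subdiff f x"
      and min: "\<And>y. dist xbar y \<le> \<theta> \<Longrightarrow> f x + ereal (- (v \<bullet> x)) \<le> f y + ereal (- (v \<bullet> y))"
      by auto
    have "2 * norm v / c \<le> \<theta>" using v c by (auto simp: s_def field_simps)
    with x have dx: "dist xbar x \<le> \<theta>" by simp
    have xin: "x \<in> tilt_argmin f xbar \<theta> v"
      unfolding tilt_argmin_iff using dx min by (simp add: minus_ereal_def)
    have uniq: "y = x" if y: "y \<in> tilt_argmin f xbar \<theta> v" for y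
    proof -
      have dy: "dist xbar y \<le> \<theta>" and le: "f y - ereal (v \<bullet> y) \<le> f x - ereal (v \<bullet> x)"
        using y dx unfolding tilt_argmin_iff by auto
      have gr: "f x + ereal (v \<bullet> (y - x) + c / 2 * (norm (y - x))\<^sup>2) \<le> f y"
        using x(2) dx dy v by (intro ugD) (auto simp: s_def)
      obtain a where a: "f x = ereal a" using limiting_subdiff_finite[OF x(2)] by (cases "f x") auto
      have "c / 2 * (norm (y - x))\<^sup>2 \<le> 0"
        using gr le by (cases "f y") (auto simp: a inner_diff_right)
      then show ?thesis using c by (simp add: mult_le_0_iff)
    qed
    show ?thesis using x(2) dx xin uniq by blast
  qed
  then obtain m :: "'a \<Rightarrow> 'a" where m: "\<And>v. norm v < s \<Longrightarrow> v \<in> limiting_subdiff f (m v)" "\<And>v. norm v < s \<Longrightarrow> dist xbar (m v) \<le> \<theta>"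
    "\<And>v. norm v < s \<Longrightarrow> tilt_argmin f xbar \<theta> v = {m v}" by metis
  have lip: "(1 / c)-lipschitz_on (ball 0 s) m"
  proof (rule lipschitz_onI)
    fix v v' :: 'a assume v: "v \<in> ball 0 s" "v' \<in> ball 0 s"
    then have n: "norm v < s" "norm v' < s" by auto
    then have n': "norm v \<le> \<theta>" "norm v' \<le> \<theta>" by (auto simp: s_def)
    obtain a a' where "f (m v) = ereal a" "f (m v') = ereal a'"
      using limiting_subdiff_finite[OF m(1)[OF n(1)]] limiting_subdiff_finite[OF m(1)[OF n(2)]]
      by (cases "f (m v)"; cases "f (m v')") auto
    with ugD[OF m(1,2)[OF n(1)] n'(1) m(2)[OF n(2)]] ugD[OF m(1,2)[OF n(2)] n'(2) m(2)[OF n(1)]]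
    have "c * (norm (m v - m v'))\<^sup>2 \<le> (v - v') \<bullet> (m v - m v')"
      by (simp add: inner_diff_left inner_diff_right norm_minus_commute[of "m v'" "m v"] algebra_simps)
    also have "\<dots> \<le> norm (v - v') * norm (m v - m v')" by (rule norm_cauchy_schwarz)
    finally have "c * norm (m v - m v') \<le> norm (v - v')"
      by (cases "m v = m v'") (auto simp: power2_eq_square mult.assoc[symmetric])
    then show "dist (m v) (m v') \<le> 1 / c * dist v v'" using c by (simp add: dist_norm field_simps)
  qed (use c in simp)
  have "xbar \<in> tilt_argmin f xbar \<theta> 0"
    unfolding tilt_argmin_iff
  proof (intro conjI allI impI)
    fix y assume y: "dist xbar y \<le> \<theta>"
    have "f xbar + ereal (c / 2 * (norm (y - xbar))\<^sup>2) \<le> f y" using ugD[OF zero, of y] y \<theta> by simp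
    moreover have "f xbar \<le> f xbar + ereal (c / 2 * (norm (y - xbar))\<^sup>2)" using c by (simp add: f_xbar)
    ultimately show "f xbar - ereal (0 \<bullet> xbar) \<le> f y - ereal (0 \<bullet> y)" by (simp add: zero_ereal_def[symmetric])
  qed (use \<theta> in simp)
  then have "tilt_argmin f xbar \<theta> 0 = {xbar}" using m(3)[of 0] s by auto
  then show ?thesis
    unfolding tilt_stable_def using \<theta> fin m(3) lip s
    by (intro conjI exI[of _ \<theta>] exI[of _ "ball 0 s"] exI[of _ m]) auto
qed

end

subsection \<open>From tilt stability to the quadratic bundle\<close>

lemma second_subderiv_ge_if_growth:
  fixes f :: "'a::euclidean_space \<Rightarrow> ereal"
  assumes fin: "\<bar>f x\<bar> \<noteq> \<infinity>" and d: "d > 0" and c: "c \<ge> 0"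
    and growth: "\<And>y. dist x y < d \<Longrightarrow> f x + ereal (v \<bullet> (y - x) + c / 2 * (norm (y - x))\<^sup>2) \<le> f y"
  shows "ereal (c * (norm w)\<^sup>2) \<le> second_subderiv f x v w"
proof -
  obtain a where a: "f x = ereal a" using fin by (cases "f x") auto
  show ?thesis
  proof (rule second_subderiv_geI[where f=f and x=x, OF a])
    fix e :: real assume e: "e > 0"
    have "isCont (\<lambda>u. c * (norm u)\<^sup>2) w" by (intro continuous_intros)
    then obtain d1 where d1: "d1 > 0" "\<And>u. dist u w < d1 \<Longrightarrow> \<bar>c * (norm u)\<^sup>2 - c * (norm w)\<^sup>2\<bar> < e"
      using e unfolding continuous_at_eps_delta by (metis dist_real_def)
    define d2 where "d2 = d / (norm w + 1)"
    have d2: "d2 > 0" using d by (auto simp: d2_def intro!: divide_pos_pos add_nonneg_pos)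
    define D where "D = min (min d1 d2) 1"
    have "ereal (a + t * (v \<bullet> u) + t\<^sup>2 / 2 * (c * (norm w)\<^sup>2 - e)) \<le> f (x + t *\<^sub>R u)"
      if tu: "0 < t" "t < D" "dist u w < D" for t u
    proof -
      have u: "\<bar>c * (norm u)\<^sup>2 - c * (norm w)\<^sup>2\<bar> < e" using d1(2)[of u] tu by (auto simp: D_def)
      have "norm u \<le> norm w + 1" using tu norm_triangle_sub[of u w] by (auto simp: D_def dist_norm)
      then have "t * norm u \<le> t * (norm w + 1)" using tu by (intro mult_left_mono) auto
      also have "\<dots> < d2 * (norm w + 1)" using tu by (intro mult_strict_right_mono) (auto simp: D_def add_nonneg_pos)
      also have "\<dots> = d" by (simp add: d2_def add_nonneg_eq_0_iff)
      finally have "dist x (x + t *\<^sub>R u) < d" using tu by (simp add: dist_norm)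
      from growth[OF this] have "ereal (a + (t * (v \<bullet> u) + c / 2 * (t\<^sup>2 * (norm u)\<^sup>2))) \<le> f (x + t *\<^sub>R u)"
        using tu by (simp add: a power_mult_distrib)
      moreover have "t\<^sup>2 / 2 * (c * (norm w)\<^sup>2 - e) \<le> t\<^sup>2 / 2 * (c * (norm u)\<^sup>2)"
        using u by (intro mult_left_mono) auto
      then have "a + t * (v \<bullet> u) + t\<^sup>2 / 2 * (c * (norm w)\<^sup>2 - e) \<le> a + (t * (v \<bullet> u) + c / 2 * (t\<^sup>2 * (norm u)\<^sup>2))"
        by (simp add: mult_ac)
      ultimately show ?thesis by (auto intro: order_trans[rotated])
    qed
    moreover have "D > 0" using d1 d2 by (simp add: D_def)
    ultimately show "\<exists>d>0. \<forall>t u. 0 < t \<and> t < d \<and> dist u w < d \<longrightarrow>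
      ereal (a + t * (v \<bullet> u) + t\<^sup>2 / 2 * (c * (norm w)\<^sup>2 - e)) \<le> f (x + t *\<^sub>R u)" by blast
  qed
qed

context prox_local begin

text \<open>Duality gives growth only at pairs (m v, v). The work lies in showing that no other
  graph points exist near (xbar, 0): m + I/(2 r) is onto, so a given pair shares its value x + v/(2
  r) with some (m v', v'), and hypomonotonicity makes the two pairs equal.\<close>

lemma growth_if_tilt_stable:
  assumes tilt: "tilt_stable f xbar \<kappa>" and \<kappa>: "\<kappa> > 0"
  shows "\<exists>\<theta>>0. \<forall>x v. v \<in> limiting_subdiff f x \<and> dist xbar x \<le> \<theta> \<and> norm v \<le> \<theta> \<longrightarrow>
    (\<exists>d>0. \<forall>y. dist x y < d \<longrightarrow> f x + ereal (v \<bullet> (y - x) + (1 / \<kappa>) / 2 * (norm (y - x))\<^sup>2) \<le> f y)"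
proof -
  obtain \<gamma> U m where g: "\<gamma> > 0" "tilt_argmin f xbar \<gamma> 0 = {xbar}" "open U" "0 \<in> U"
    "\<And>v. v \<in> U \<Longrightarrow> tilt_argmin f xbar \<gamma> v = {m v}" "\<kappa>-lipschitz_on U m"
    using tilt unfolding tilt_stable_def by metis
  have m0: "m 0 = xbar" using g(2) g(5)[OF g(4)] by simp
  obtain s0 where s0: "s0 > 0" "ball 0 s0 \<subseteq> U" using openE[OF g(3,4)] by blast
  \<comment> \<open>In turn: m is defined, v is admissible for hypomonotonicity, m v is interior to
    the \<gamma>-ball so that it is a regular subgradient point, and m v lies within \<delta> of
    xbar.\<close>
  define s where "s = min (min s0 \<delta>) (min (\<gamma> / (2 * \<kappa>)) (\<delta> / \<kappa>))"
  have s: "s > 0" using s0 g(1) delta \<kappa> by (simp add: s_def)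
  let ?S = "ball (0::'a) s"
  have SU: "?S \<subseteq> U" using s0 by (auto simp: s_def)
  have m_argmin: "m v \<in> tilt_argmin f xbar \<gamma> v" if "v \<in> ?S" for v using g(5)[of v] SU that by auto
  have mlip: "norm (m v - m v') \<le> \<kappa> * norm (v - v')" if "v \<in> ?S" "v' \<in> ?S" for v v'
    using lipschitz_onD[OF g(6) subsetD[OF SU that(1)] subsetD[OF SU that(2)]] by (simp add: dist_norm)
  have m_near: "dist xbar (m v) \<le> \<kappa> * norm v" if "v \<in> ?S" for v
    using mlip[OF that, of 0] s by (simp add: m0 dist_norm norm_minus_commute)
  have m_lt: "dist xbar (m v) < \<gamma>" "dist xbar (m v) \<le> \<delta>" if "v \<in> ?S" for v
  proof -
    have "norm v < \<gamma> / (2 * \<kappa>)" "norm v < \<delta> / \<kappa>" using that by (auto simp: s_def)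
    then have "\<kappa> * norm v < \<gamma> / 2" "\<kappa> * norm v < \<delta>" using \<kappa> by (auto simp: field_simps)
    then show "dist xbar (m v) < \<gamma>" "dist xbar (m v) \<le> \<delta>" using m_near[OF that] g(1) by linarith+
  qed
  have base: "f xbar \<le> f y" if "dist xbar y \<le> \<gamma>" for y
  proof -
    have "xbar \<in> tilt_argmin f xbar \<gamma> 0" using g(2) by simp
    then show ?thesis using that unfolding tilt_argmin_iff by (auto simp: zero_ereal_def[symmetric])
  qed
  have "\<exists>a. f (m v) = ereal a" if "v \<in> ?S" for v
  proof -
    have "f (m v) - ereal (v \<bullet> m v) \<le> f xbar - ereal (v \<bullet> xbar)"
      using m_argmin[OF that] g(1) unfolding tilt_argmin_iff by auto
    then have "f (m v) \<noteq> \<infinity>" by (auto simp: f_xbar)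
    moreover have "f (m v) \<noteq> -\<infinity>" using base[of "m v"] m_lt[OF that] by (auto simp: f_xbar)
    ultimately show ?thesis by (cases "f (m v)") auto
  qed
  then obtain \<phi> where \<phi>: "\<And>v. v \<in> ?S \<Longrightarrow> f (m v) = ereal (\<phi> v)" by metis
  \<comment> \<open>The conjugate of f restricted to the \<gamma>-ball; \<open>conj\<close> below is
    its Fenchel-Young inequality.\<close>
  define G where "G v = v \<bullet> m v - \<phi> v" for v
  have conj: "ereal (v \<bullet> y - G v) \<le> f y" if v: "v \<in> ?S" and y: "dist xbar y \<le> \<gamma>" for v y
  proof -
    have "f (m v) - ereal (v \<bullet> m v) \<le> f y - ereal (v \<bullet> y)"
      using m_argmin[OF v] y unfolding tilt_argmin_iff by auto
    then show ?thesis by (cases "f y") (auto simp: \<phi>[OF v] G_def)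
  qed
  have sub: "G v + m v \<bullet> (v' - v) \<le> G v'" if "v \<in> ?S" "v' \<in> ?S" for v v'
    using conj[OF that(2), of "m v"] m_lt[OF that(1)] by (simp add: \<phi>[OF that(1)] G_def inner_diff_right inner_commute)
  have mono: "(m v' - m v) \<bullet> (v' - v) \<le> \<kappa> * (norm (v' - v))\<^sup>2" if "v \<in> ?S" "v' \<in> ?S" for v v'
  proof -
    have "(m v' - m v) \<bullet> (v' - v) \<le> norm (m v' - m v) * norm (v' - v)" by (rule norm_cauchy_schwarz)
    also have "\<dots> \<le> \<kappa> * norm (v' - v) * norm (v' - v)" using mlip[OF that(2,1)] by (rule mult_right_mono) simp
    finally show ?thesis by (simp add: power2_eq_square)
  qed
  have m_sub: "v \<in> limiting_subdiff f (m v)" if v: "v \<in> ?S" for v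
  proof -
    have "v \<in> regular_subdiff f (m v)"
    proof (rule regular_subdiffI[of f "m v" "\<gamma> - dist xbar (m v)" 0])
      fix y assume "dist y (m v) < \<gamma> - dist xbar (m v)"
      then have "dist xbar y \<le> \<gamma>" using dist_triangle[of xbar y "m v"] by (simp add: dist_commute)
      from conj[OF v this] show "f (m v) + ereal (v \<bullet> (y - m v) - 0 * (norm (y - m v))\<^sup>2) \<le> f y"
        by (simp add: \<phi>[OF v] G_def inner_diff_right algebra_simps)
    qed (use m_lt[OF v] in \<open>auto simp: \<phi>[OF v]\<close>)
    then show ?thesis using regular_subdiff_subset_limiting by blast
  qed
  have der: "((\<lambda>h. G (v + h *\<^sub>R d)) has_real_derivative m v \<bullet> d) (at 0)" if "v \<in> ?S" for v d
    using that sub mono by (intro subgradient_line_derivative[where S="?S" and k=\<kappa>]) auto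
  text \<open>
    \<open>m + I/(2 r)\<close> maps onto a neighbourhood of \<open>xbar\<close>: its value at a minimiser of
    \<open>G + \<bar>\<cdot>\<bar>\<^sup>2/(4 r) - \<langle>z, \<cdot>\<rangle>\<close> is \<open>z\<close>.
  \<close>
  have onto: "\<exists>v\<in>?S. m v + v /\<^sub>R (2 * r) = z" if z: "dist xbar z < s / (8 * r)" for z
  proof -
    define h where "h v = G v + (norm v)\<^sup>2 / (4 * r) - z \<bullet> v" for v
    have contG: "continuous_on ?S G"
      unfolding continuous_on_eq_continuous_at[OF open_ball]
    proof
      fix v assume v: "v \<in> ?S"
      have "((\<lambda>v'. G v' - G v) \<longlongrightarrow> 0) (at v)"
      proof (rule Lim_null_comparison)
        show "((\<lambda>v'. norm (m v) * norm (v' - v) + \<kappa> * (norm (v' - v))\<^sup>2) \<longlongrightarrow> 0) (at v)"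
          by (auto intro!: tendsto_eq_intros)
        have "eventually (\<lambda>v'. v' \<in> ?S) (at v)" using v by (intro eventually_at_in_open') auto
        then show "eventually (\<lambda>v'. norm (G v' - G v) \<le> norm (m v) * norm (v' - v) + \<kappa> * (norm (v' - v))\<^sup>2) (at v)"
        proof eventually_elim
          case (elim v')
          have "m v \<bullet> (v' - v) \<le> G v' - G v" using sub[OF v elim] by simp
          moreover have "G v' - G v \<le> m v' \<bullet> (v' - v)" using sub[OF elim v] by (simp add: inner_diff_right)
          moreover have "m v' \<bullet> (v' - v) \<le> m v \<bullet> (v' - v) + \<kappa> * (norm (v' - v))\<^sup>2"
            using mono[OF v elim] by (simp add: inner_diff_left)
          moreover have "\<bar>m v \<bullet> (v' - v)\<bar> \<le> norm (m v) * norm (v' - v)" by (rule Cauchy_Schwarz_ineq2)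
          moreover have "0 \<le> \<kappa> * (norm (v' - v))\<^sup>2" using \<kappa> by simp
          ultimately show ?case by (simp add: abs_le_iff)
        qed
      qed
      then show "isCont G v" unfolding isCont_def by (rule LIM_zero_cancel)
    qed
    have sub2: "cball (0::'a) (s / 2) \<subseteq> ?S" using s by auto
    have "continuous_on (cball 0 (s / 2)) h"
      unfolding h_def using r by (intro continuous_intros continuous_on_subset[OF contG sub2]) auto
    from continuous_attains_inf[OF compact_cball _ this]
    obtain v where v: "norm v \<le> s / 2" "\<And>v'. norm v' \<le> s / 2 \<Longrightarrow> h v \<le> h v'"
      using s by auto
    have vS: "v \<in> ?S" using v(1) s by simp
    \<comment> \<open>On this sphere comparison with h 0 and the subgradient m 0 = xbar of G give
      |v|/(4 r) = s/(8 r) \<le> |z - xbar|, which is why z was taken closer than s/(8 r).\<close>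
    have "norm v \<noteq> s / 2"
    proof
      assume nv: "norm v = s / 2"
      have "G 0 + xbar \<bullet> v \<le> G v" using sub[OF _ vS, of 0] s by (simp add: m0)
      moreover have "h v \<le> h 0" using v(2)[of 0] s by simp
      ultimately have "(norm v)\<^sup>2 / (4 * r) \<le> (z - xbar) \<bullet> v" by (simp add: h_def inner_diff_left)
      also have "\<dots> \<le> norm (z - xbar) * norm v" by (rule norm_cauchy_schwarz)
      finally have "norm v * (norm v / (4 * r)) \<le> norm v * norm (z - xbar)"
        by (simp add: power2_eq_square mult.commute)
      moreover have "0 < norm v" using nv s by linarith
      ultimately have "norm v / (4 * r) \<le> norm (z - xbar)" by (simp only: mult_le_cancel_left_pos)
      then show False using z nv by (simp add: dist_norm norm_minus_commute)
    qed
    with v(1) have vlt: "norm v < s / 2" by simp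
    \<comment> \<open>This is the gradient of h at v; differentiating along d itself yields |d|^2,
      which vanishes at an interior minimiser.\<close>
    define d where "d = m v + v /\<^sub>R (2 * r) - z"
    have dd: "((\<lambda>t. h (v + t *\<^sub>R d)) has_real_derivative d \<bullet> d) (at 0)"
    proof -
      have eq: "h (v + t *\<^sub>R d) = G (v + t *\<^sub>R d) + ((norm v)\<^sup>2 + 2 * t * (v \<bullet> d) + t\<^sup>2 * (norm d)\<^sup>2) / (4 * r) - (z \<bullet> v + t * (z \<bullet> d))" for t
        unfolding h_def power2_norm_eq_inner
        by (simp add: inner_add_left inner_add_right inner_commute power2_eq_square algebra_simps)
      have "((\<lambda>t. h (v + t *\<^sub>R d)) has_real_derivative m v \<bullet> d + (2 * (v \<bullet> d)) / (4 * r) - z \<bullet> d) (at 0)"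
        unfolding eq using r by (auto intro!: derivative_eq_intros der[OF vS])
      moreover have "m v \<bullet> d + (2 * (v \<bullet> d)) / (4 * r) - z \<bullet> d = d \<bullet> d"
      proof -
        have "d \<bullet> d = (m v + v /\<^sub>R (2 * r) - z) \<bullet> d" by (subst d_def) simp
        also have "\<dots> = m v \<bullet> d + (v \<bullet> d) / (2 * r) - z \<bullet> d"
          by (simp only: inner_diff_left inner_add_left inner_scaleR_left divide_inverse mult.commute)
        finally show ?thesis by simp
      qed
      ultimately show ?thesis by simp
    qed
    obtain e where e: "e > 0" "\<And>t. \<bar>t\<bar> < e \<Longrightarrow> norm (v + t *\<^sub>R d) < s / 2"
    proof -
      have "((\<lambda>t. norm (v + t *\<^sub>R d)) \<longlongrightarrow> norm v) (at (0::real))" by (auto intro!: tendsto_eq_intros)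
      from order_tendstoD(2)[OF this vlt] obtain e where "e > 0" "\<And>t. t \<noteq> 0 \<Longrightarrow> \<bar>t\<bar> < e \<Longrightarrow> norm (v + t *\<^sub>R d) < s / 2"
        unfolding eventually_at by (auto simp: dist_real_def)
      then show ?thesis using vlt by (intro that[of e]) (metis add.right_neutral scaleR_zero_left)+
    qed
    have "d \<bullet> d = 0"
    proof (rule DERIV_local_min[OF dd e(1)], intro allI impI)
      fix t :: real assume "\<bar>0 - t\<bar> < e"
      then show "h (v + 0 *\<^sub>R d) \<le> h (v + t *\<^sub>R d)" using v(2) e(2)[of t] by simp
    qed
    then have "d = 0" by simp
    then show ?thesis using vS by (intro bexI[of _ v]) (auto simp: d_def)
  qed
  have S_le: "norm v \<le> \<delta>" if "v \<in> ?S" for v using that by (auto simp: s_def)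
  define k where "k = 1 + 1 / (2 * r)"
  have k: "k > 0" using r by (auto simp: k_def intro: add_pos_pos)
  \<comment> \<open>The second bound puts x + v/(2 r) within \<theta> k < s/(8 r) of xbar, inside
    the region covered by \<open>onto\<close>.\<close>
  define \<theta> where "\<theta> = min (\<delta> / 2) (s / (16 * r) / k)"
  have \<theta>: "\<theta> > 0" "\<theta> \<le> \<delta>" using delta s r k by (auto simp: \<theta>_def)
  have \<theta>2: "\<theta> + \<theta> * (1 / (2 * r)) < s / (8 * r)"
  proof -
    have "\<theta> * k \<le> s / (16 * r) / k * k" using k by (intro mult_right_mono) (auto simp: \<theta>_def)
    also have "\<dots> = s / (16 * r)" using k by simp
    also have "\<dots> < s / (8 * r)" using s r by (simp add: field_simps)
    finally show ?thesis by (simp add: k_def distrib_left)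
  qed
  have "\<exists>d>0. \<forall>y. dist x y < d \<longrightarrow> f x + ereal (v \<bullet> (y - x) + (1 / \<kappa>) / 2 * (norm (y - x))\<^sup>2) \<le> f y"
    if v: "v \<in> limiting_subdiff f x" "dist xbar x \<le> \<theta>" "norm v \<le> \<theta>" for x v
  proof -
    define z where "z = x + v /\<^sub>R (2 * r)"
    have nv: "norm (v /\<^sub>R (2 * r)) \<le> \<theta> * (1 / (2 * r))" using v r by (simp add: field_simps)
    have "dist xbar z \<le> dist xbar x + norm (v /\<^sub>R (2 * r))"
      using norm_triangle_ineq[of "x - xbar" "v /\<^sub>R (2 * r)"] by (simp add: z_def dist_norm norm_minus_commute add_diff_eq algebra_simps)
    then have "dist xbar z < s / (8 * r)" using nv v \<theta>2 by linarith
    from onto[OF this] obtain v' where v': "v' \<in> ?S" "m v' + v' /\<^sub>R (2 * r) = z" by blast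
    define a where "a = x - m v'"
    have "- r * (norm a)\<^sup>2 \<le> (v - v') \<bullet> a"
      unfolding a_def using v(2,3) \<theta>(2)
      by (intro hypomonotone[OF v(1) _ _ m_sub[OF v'(1)] m_lt(2)[OF v'(1)] S_le[OF v'(1)]]) auto
    also have "v - v' = - (2 * r) *\<^sub>R a"
    proof -
      have "(v - v') /\<^sub>R (2 * r) = - a" using v'(2) by (simp add: a_def z_def scaleR_diff_right algebra_simps)
      then have "(2 * r) *\<^sub>R ((v - v') /\<^sub>R (2 * r)) = (2 * r) *\<^sub>R (- a)" by simp
      then show ?thesis using r by simp
    qed
    finally have "r * (norm a)\<^sup>2 \<le> 0" by (simp add: power2_norm_eq_inner)
    then have "a = 0" using r by (simp add: mult_le_0_iff)
    with v'(2) r have xv: "x = m v" "v = v'" by (auto simp: a_def z_def)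
    with v' have vS: "v \<in> ?S" by simp
    define d where "d = min (\<kappa> * (s - norm v)) (\<gamma> - dist xbar x)"
    have d: "d > 0" using vS \<kappa> m_lt[OF vS] by (simp add: d_def xv(1)[symmetric])
    have "f x + ereal (v \<bullet> (y - x) + (1 / \<kappa>) / 2 * (norm (y - x))\<^sup>2) \<le> f y" if y: "dist x y < d" for y
    proof -
      \<comment> \<open>The tilt maximising \<langle>y - x, w - v\<rangle> - \<kappa>/2 |w - v|^2,
        so that the Fenchel-Young bound at w yields exactly |y - x|^2/(2 \<kappa>).\<close>
      define w where "w = v + (y - x) /\<^sub>R \<kappa>"
      have "norm (y - x) < \<kappa> * (s - norm v)" using y by (simp add: d_def dist_norm norm_minus_commute)
      then have "norm ((y - x) /\<^sub>R \<kappa>) < s - norm v" unfolding norm_scaleR using \<kappa> by (simp add: field_simps)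
      then have w: "w \<in> ?S" using norm_triangle_ineq[of v "(y - x) /\<^sub>R \<kappa>"] by (simp add: w_def)
      have dy: "dist xbar y \<le> \<gamma>" using y dist_triangle[of xbar y x] by (simp add: d_def)
      have "G w \<le> G v + m v \<bullet> (w - v) + \<kappa> / 2 * (norm (w - v))\<^sup>2"
        by (rule subgradient_quadratic_upper[where S="?S"]) (use vS w sub mono in auto)
      moreover define Q where "Q = (1 / \<kappa>) / 2 * (norm (y - x))\<^sup>2"
      moreover have "\<kappa> / 2 * (norm (w - v))\<^sup>2 = (1 / \<kappa>) / 2 * (norm (y - x))\<^sup>2"
      proof -
        have "norm (w - v) = norm (y - x) / \<kappa>" using \<kappa> by (simp add: w_def divide_inverse mult.commute)
        then show ?thesis using \<kappa> by (simp add: power2_eq_square)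
      qed
      moreover have "w \<bullet> y - m v \<bullet> (w - v) = v \<bullet> y + 2 * ((1 / \<kappa>) / 2 * (norm (y - x))\<^sup>2)"
      proof -
        have "w \<bullet> y - x \<bullet> (w - v) = v \<bullet> y + inverse \<kappa> * ((y - x) \<bullet> (y - x))"
          by (simp add: w_def inner_add_left inner_diff_left inner_diff_right inner_commute algebra_simps)
        then show ?thesis unfolding xv(1)[symmetric] power2_norm_eq_inner by (simp add: inverse_eq_divide)
      qed
      ultimately have "v \<bullet> y - G v + (1 / \<kappa>) / 2 * (norm (y - x))\<^sup>2 \<le> w \<bullet> y - G w"
        unfolding Q_def[symmetric] by linarith
      moreover have "f x = ereal (v \<bullet> x - G v)" using \<phi>[OF vS] by (simp add: G_def xv(1)[symmetric])
      ultimately show ?thesis using conj[OF w dy] by (auto simp: inner_diff_right intro: order_trans[rotated])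
    qed
    with d show ?thesis by blast
  qed
  with \<theta>(1) show ?thesis by blast
qed

text \<open>Every point of epi q is a limit of points in the approximating epigraphs, all of which
  eventually lie above the quadratic 1/\<kappa> |.|^2; this region is closed.\<close>

lemma quad_bound_if_tilt_stable:
  assumes tilt: "tilt_stable f xbar \<kappa>" and \<kappa>: "\<kappa> > 0" and q: "q \<in> quad f xbar 0"
  shows "ereal (1 / \<kappa> * (norm w)\<^sup>2) \<le> q w"
proof -
  obtain \<theta> where \<theta>: "\<theta> > 0" and growth: "\<And>x v. v \<in> limiting_subdiff f x \<Longrightarrow> dist xbar x \<le> \<theta> \<Longrightarrow> norm v \<le> \<theta> \<Longrightarrow>
    \<exists>d>0. \<forall>y. dist x y < d \<longrightarrow> f x + ereal (v \<bullet> (y - x) + (1 / \<kappa>) / 2 * (norm (y - x))\<^sup>2) \<le> f y"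
    using growth_if_tilt_stable[OF tilt \<kappa>] by blast
  have ge: "ereal (1 / \<kappa> * (norm u)\<^sup>2) \<le> second_subderiv f x v u"
    if v: "v \<in> limiting_subdiff f x" "dist xbar x \<le> \<theta>" "norm v \<le> \<theta>" for x v u
  proof -
    obtain d where "d > 0" "\<And>y. dist x y < d \<Longrightarrow> f x + ereal (v \<bullet> (y - x) + (1 / \<kappa>) / 2 * (norm (y - x))\<^sup>2) \<le> f y"
      using growth[OF v] by blast
    then show ?thesis using \<kappa> limiting_subdiff_finite[OF v(1)] by (intro second_subderiv_ge_if_growth) auto
  qed
  obtain xs vs where q': "gqf q" "\<And>k::nat. vs k \<in> limiting_subdiff f (xs k)" "(\<lambda>k. (xs k, vs k)) \<longlonglongrightarrow> (xbar, 0)"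
    "epi_converges (\<lambda>k. second_subderiv f (xs k) (vs k)) q"
    using q by (auto simp: quad_def gph_subdiff_def)
  have "xs \<longlonglongrightarrow> xbar" "vs \<longlonglongrightarrow> 0" using tendsto_fst[OF q'(3)] tendsto_snd[OF q'(3)] by auto
  then have "eventually (\<lambda>k. dist (xs k) xbar < \<theta>) sequentially" "eventually (\<lambda>k. dist (vs k) 0 < \<theta>) sequentially"
    using \<theta> by (auto dest: tendstoD)
  then have ev: "eventually (\<lambda>k. \<forall>u. ereal (1 / \<kappa> * (norm u)\<^sup>2) \<le> second_subderiv f (xs k) (vs k) u) sequentially"
    by eventually_elim (intro allI ge q'(2); simp add: dist_commute)
  show ?thesis
  proof (rule ereal_le_real)
    fix \<alpha> assume "q w \<le> ereal \<alpha>"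
    then have "(w, \<alpha>) \<in> inner_limit (\<lambda>k. epi (second_subderiv f (xs k) (vs k)))"
      using q'(4) by (simp add: epi_converges_def PK_converges_def epi_def)
    then obtain y where y: "y \<longlonglongrightarrow> (w, \<alpha>)" "eventually (\<lambda>k. y k \<in> epi (second_subderiv f (xs k) (vs k))) sequentially"
      by (auto simp: inner_limit_def)
    have "eventually (\<lambda>k. 1 / \<kappa> * (norm (fst (y k)))\<^sup>2 \<le> snd (y k)) sequentially"
      using ev y(2)
    proof eventually_elim
      case (elim k)
      have "ereal (1 / \<kappa> * (norm (fst (y k)))\<^sup>2) \<le> second_subderiv f (xs k) (vs k) (fst (y k))"
        using elim(1) by blast
      also have "\<dots> \<le> ereal (snd (y k))" using elim(2) by (simp add: epi_def case_prod_beta)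
      finally show ?case by simp
    qed
    moreover have "(\<lambda>k. snd (y k)) \<longlonglongrightarrow> \<alpha>" using tendsto_snd[OF y(1)] by simp
    moreover have "(\<lambda>k. 1 / \<kappa> * (norm (fst (y k)))\<^sup>2) \<longlonglongrightarrow> 1 / \<kappa> * (norm w)\<^sup>2"
      using tendsto_fst[OF y(1)] by (intro tendsto_intros) auto
    ultimately have "1 / \<kappa> * (norm w)\<^sup>2 \<le> \<alpha>" by (intro tendsto_le[OF sequentially_bot])
    then show "ereal (1 / \<kappa> * (norm w)\<^sup>2) \<le> ereal \<alpha>" by simp
  qed
qed

end

subsection \<open>Integrating the derivative bound\<close>

context prox_local begin

text \<open>Rademacher's theorem is available for globally Lipschitz functions, whereas P is
  controlled only near xbar. Composing with the nonexpansive projection onto a smaller closed ball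
  gives a global extension that agrees with P, and has its directional derivatives, on the open
  ball.\<close>

lemma AE_P_deriv:
  assumes \<eta>: "0 < \<eta>" "\<eta> < \<tau>" and F: "\<And>z. F z = P (closest_point (cball xbar \<eta>) z)"
  shows "AE z in lborel. z \<in> ball xbar \<eta> \<longrightarrow>
    (\<exists>A. P_deriv z A \<and> (\<forall>w. ((\<lambda>t. (F (z + t *\<^sub>R w) - F z) /\<^sub>R t) \<longlongrightarrow> A w) (at 0)))"
    and "2-lipschitz_on UNIV F"
proof -
  let ?C = "cball xbar \<eta>"
  have C: "closest_point ?C z \<in> ?C" for z using \<eta> by (intro closest_point_in_set) auto
  have C\<tau>: "closest_point ?C z \<in> ball xbar \<tau>" for z using C[of z] \<eta> by auto
  show lip: "2-lipschitz_on UNIV F"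
  proof (rule lipschitz_onI)
    fix z z'
    have "dist (F z) (F z') \<le> 2 * dist (closest_point ?C z) (closest_point ?C z')"
      using P_Lipschitz[OF C\<tau> C\<tau>, of z z'] by (simp add: F dist_norm)
    also have "\<dots> \<le> 2 * dist z z'" using \<eta> by (intro mult_left_mono closest_point_lipschitz) auto
    finally show "dist (F z) (F z') \<le> 2 * dist z z'" .
  qed simp
  have FP: "F z = P z" if "z \<in> ball xbar \<eta>" for z using that by (simp add: F closest_point_self)
  have "AE z in lborel. \<forall>b\<in>Basis. \<exists>A. linear A \<and> (\<forall>w. ((\<lambda>t. (F (z + t *\<^sub>R w) \<bullet> b - F z \<bullet> b) / t) \<longlongrightarrow> A w) (at 0))"
    unfolding AE_finite_all[OF finite_Basis]
  proof
    fix b :: 'a assume b: "b \<in> Basis"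
    have "2-lipschitz_on UNIV (\<lambda>z. F z \<bullet> b)"
    proof (rule lipschitz_onI)
      fix z z'
      have "dist (F z \<bullet> b) (F z' \<bullet> b) \<le> dist (F z) (F z')"
        using Basis_le_norm[OF b, of "F z - F z'"] by (simp add: dist_norm inner_diff_left)
      also have "\<dots> \<le> 2 * dist z z'" using lip by (rule lipschitz_onD) auto
      finally show "dist (F z \<bullet> b) (F z' \<bullet> b) \<le> 2 * dist z z'" .
    qed simp
    from Rademacher_Gateaux[OF this]
    show "AE z in lborel. \<exists>A. linear A \<and> (\<forall>w. ((\<lambda>t. (F (z + t *\<^sub>R w) \<bullet> b - F z \<bullet> b) / t) \<longlongrightarrow> A w) (at 0))" .
  qed
  then show "AE z in lborel. z \<in> ball xbar \<eta> \<longrightarrow>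
    (\<exists>A. P_deriv z A \<and> (\<forall>w. ((\<lambda>t. (F (z + t *\<^sub>R w) - F z) /\<^sub>R t) \<longlongrightarrow> A w) (at 0)))"
  proof eventually_elim
    case (elim z)
    obtain a where "\<forall>b\<in>Basis. linear (a b) \<and> (\<forall>w. ((\<lambda>t. (F (z + t *\<^sub>R w) \<bullet> b - F z \<bullet> b) / t) \<longlongrightarrow> a b w) (at 0))"
      using bchoice[OF elim] by blast
    then have a: "\<And>b. b \<in> Basis \<Longrightarrow> linear (a b)"
      "\<And>b w. b \<in> Basis \<Longrightarrow> ((\<lambda>t. (F (z + t *\<^sub>R w) \<bullet> b - F z \<bullet> b) / t) \<longlongrightarrow> a b w) (at 0)"
      by blast+
    define A where "A w = (\<Sum>b\<in>Basis. a b w *\<^sub>R b)" for w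
    have lin: "linear A" unfolding A_def
      by (rule linearI) (simp_all add: linear_add[OF a(1)] linear_scale[OF a(1)] scaleR_add_left sum.distrib scaleR_sum_right cong: sum.cong)
    have lim: "((\<lambda>t. (F (z + t *\<^sub>R w) - F z) /\<^sub>R t) \<longlongrightarrow> A w) (at 0)" for w
    proof (rule tendsto_componentwise_iff[THEN iffD2], intro ballI)
      fix b :: 'a assume b: "b \<in> Basis"
      have "A w \<bullet> b = a b w" using b by (simp add: A_def inner_sum_left_Basis)
      then show "((\<lambda>t. ((F (z + t *\<^sub>R w) - F z) /\<^sub>R t) \<bullet> b) \<longlongrightarrow> A w \<bullet> b) (at 0)"
        using a(2)[OF b, of w] by (simp add: inner_diff_left divide_inverse mult.commute)
    qed
    show ?case
    proof (intro impI exI[of _ A] conjI)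
      assume z: "z \<in> ball xbar \<eta>"
      have "((\<lambda>t. (P (z + t *\<^sub>R w) - P z) /\<^sub>R t) \<longlongrightarrow> A w) (at 0)" for w
      proof (rule Lim_transform_eventually[OF lim])
        have "((\<lambda>t. z + t *\<^sub>R w) \<longlongrightarrow> z) (at (0::real))" by (auto intro!: tendsto_eq_intros)
        from topological_tendstoD[OF this open_ball z]
        show "eventually (\<lambda>t. (F (z + t *\<^sub>R w) - F z) /\<^sub>R t = (P (z + t *\<^sub>R w) - P z) /\<^sub>R t) (at 0)"
          by eventually_elim (simp add: FP FP[OF z])
      qed
      with lin show "P_deriv z A" by (simp add: P_deriv_def)
    qed (use lim in blast)
  qed
qed

text \<open>For w = z' - z the scalar function \<langle>F u, w\<rangle> has derivative \<langle>A w,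
  w\<rangle> along w at almost every u, so the claim is a bound on one increment.\<close>

lemma P_monotone_upper_if_deriv_bound:
  assumes \<eta>: "0 < \<eta>" "\<eta> < \<tau>"
    and bound: "\<And>z A \<zeta>. z \<in> ball xbar \<eta> \<Longrightarrow> P_deriv z A \<Longrightarrow> A \<zeta> \<bullet> \<zeta> \<le> \<mu> * (norm \<zeta>)\<^sup>2"
    and z: "z \<in> ball xbar \<eta>" "z' \<in> ball xbar \<eta>"
  shows "(P z' - P z) \<bullet> (z' - z) \<le> \<mu> * (norm (z' - z))\<^sup>2"
proof -
  define F where "F z = P (closest_point (cball xbar \<eta>) z)" for z
  define w where "w = z' - z"
  have FP: "F u = P u" if "u \<in> ball xbar \<eta>" for u using that by (simp add: F_def closest_point_self)
  have lipF: "2-lipschitz_on UNIV F" by (rule AE_P_deriv(2)[OF \<eta> F_def])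
  have lip: "(2 * norm w)-lipschitz_on UNIV (\<lambda>u. F u \<bullet> w)"
  proof (rule lipschitz_onI)
    fix u u'
    have "\<bar>(F u - F u') \<bullet> w\<bar> \<le> norm (F u - F u') * norm w" by (rule Cauchy_Schwarz_ineq2)
    also have "\<dots> \<le> 2 * dist u u' * norm w"
      using lipschitz_onD[OF lipF, of u u'] by (intro mult_right_mono) (auto simp: dist_norm)
    finally show "dist (F u \<bullet> w) (F u' \<bullet> w) \<le> 2 * norm w * dist u u'"
      by (simp add: dist_real_def inner_diff_left mult_ac)
  qed simp
  have "F (z + w) \<bullet> w - F z \<bullet> w \<le> \<mu> * (norm w)\<^sup>2"
  proof (rule increment_le_if_AE_dir_deriv_le[OF lip, where G="ball xbar \<eta>"])
    show "closed_segment z (z + w) \<subseteq> ball xbar \<eta>"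
      using z by (intro closed_segment_subset) (auto simp: w_def)
    from AE_P_deriv(1)[OF \<eta> F_def]
    show "AE u in lborel. u \<in> ball xbar \<eta> \<longrightarrow> dir_deriv (\<lambda>u. F u \<bullet> w) w u \<le> \<mu> * (norm w)\<^sup>2"
    proof eventually_elim
      case (elim u)
      show ?case
      proof
        assume u: "u \<in> ball xbar \<eta>"
        with elim obtain A where A: "P_deriv u A" "((\<lambda>t. (F (u + t *\<^sub>R w) - F u) /\<^sub>R t) \<longlongrightarrow> A w) (at 0)" by blast
        have "((\<lambda>t. (F (u + t *\<^sub>R w) \<bullet> w - F u \<bullet> w) / t) \<longlongrightarrow> A w \<bullet> w) (at 0)"
          using tendsto_inner[OF A(2) tendsto_const[of w]] by (simp add: inner_diff_left divide_inverse mult.commute)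
        from dir_deriv_eqI(2)[OF this] bound[OF u A(1), of w]
        show "dir_deriv (\<lambda>u. F u \<bullet> w) w u \<le> \<mu> * (norm w)\<^sup>2" by simp
      qed
    qed
  qed simp
  then show ?thesis using z by (simp add: w_def FP inner_diff_left)
qed

lemma tilt_stable_if_quad_bound:
  assumes quad: "\<And>q w. q \<in> quad f xbar 0 \<Longrightarrow> ereal (l * (norm w)\<^sup>2) \<le> q w" and c: "0 < c" "c < l"
  shows "tilt_stable f xbar (1 / c)"
proof -
  obtain \<eta> where \<eta>: "0 < \<eta>" "\<eta> \<le> \<tau>"
    "\<And>z A \<zeta>. z \<in> ball xbar \<eta> \<Longrightarrow> P_deriv z A \<Longrightarrow> A \<zeta> \<bullet> \<zeta> \<le> 2 * r / (2 * r + c) * (norm \<zeta>)\<^sup>2"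
    using P_deriv_bound_near[of l c, OF _ c] quad by blast
  \<comment> \<open>Halving makes the radius strictly smaller than \<tau>, so that the closed ball
    used for the projection lies where P is Lipschitz.\<close>
  define \<eta>' where "\<eta>' = \<eta> / 2"
  have \<eta>': "0 < \<eta>'" "\<eta>' < \<tau>" "ball xbar \<eta>' \<subseteq> ball xbar \<eta>" using \<eta>(1,2) by (auto simp: \<eta>'_def)
  have "(P z' - P z) \<bullet> (z' - z) \<le> 2 * r / (2 * r + c) * (norm (z' - z))\<^sup>2"
    if "z \<in> ball xbar \<eta>'" "z' \<in> ball xbar \<eta>'" for z z'
    using \<eta>' \<eta>(3) that by (intro P_monotone_upper_if_deriv_bound[where \<eta>="\<eta>'"]) auto
  from uniform_growth_if_P_bound[OF \<eta>'(1) less_imp_le[OF \<eta>'(2)] c(1) this]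
  obtain \<theta> where "0 < \<theta>" "\<theta> \<le> \<delta>" "uniform_growth c \<theta>" by blast
  then show ?thesis using c(1) by (intro tilt_stable_if_uniform_growth)
qed

end

theorem theorem3p9:
  fixes f :: "'a::euclidean_space \<Rightarrow> ereal" and xbar :: 'a and \<kappa> \<l> :: real
  assumes "prox_regular f xbar 0"
    and "subdiff_continuous f xbar 0"
    and "\<kappa> > 0" and "\<l> > 0"
  shows "(\<l> = 1 / \<kappa> \<longrightarrow> tilt_stable f xbar \<kappa> \<longrightarrow>
            (\<forall>q \<in> quad f xbar 0. \<forall>w. q w \<ge> ereal (\<l> * (norm w)\<^sup>2))) \<and>
         (\<l> > 1 / \<kappa> \<longrightarrow> (\<forall>q \<in> quad f xbar 0. \<forall>w. q w \<ge> ereal (\<l> * (norm w)\<^sup>2)) \<longrightarrow>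
            tilt_stable f xbar \<kappa>)"
proof -
  obtain \<epsilon> \<delta> r where "prox_local f xbar \<epsilon> \<delta> r"
    using prox_local_exists[OF assms(1,2)] by blast
  then interpret prox_local f xbar \<epsilon> \<delta> r .
  \<comment> \<open>The converse takes c = 1/\<kappa>, strictly below \<l>, and 1/c is again
    \<kappa>.\<close>
  show ?thesis
    using quad_bound_if_tilt_stable[OF _ assms(3)] tilt_stable_if_quad_bound[of \<l> "1 / \<kappa>"] assms(3)
    by auto
qed

end
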